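(* Let $\xi$ be a model, $h\ge0$, let $\phi\in\mathcal{C}$ minimize $P_{h,\xi}$ on $\mathcal{C}$ and $\eta\in\mathcal{K}_{h,\xi}$ maximize $D$ on $\mathcal{K}_{h,\xi}$. Then: (1) (a) there is $c>0$ with $c\le\phi$ on $[0,1]$; (b) $\phi'\in L^\infty$. (2) (a) $\eta\in C^2([0,1])$; (b) $1/\sqrt{\eta''}\in C([0,1])$, its distributional derivative $(1/\sqrt{\eta''})'$ belongs to $L^1$ and is monotone decreasing, and its second distributional derivative satisfies $(1/\sqrt{\eta''})''=-\mu$ for some nonnegative Radon measure $\mu$ on $(0,1)$ with $\operatorname{supp}\mu\subset\{\xi=\eta\}$; (c) on the set $\{\xi=\eta\}$ one has $\eta'(t)=\xi'(t)$ and $\eta''(t)\ge\xi''(t)$; (d) $\eta'(1)=\xi'(1)$, and either $\eta(0)=\xi(0)$ or $\phi'(0)=0$. (3) $\phi''=(1/\sqrt{\eta''})''=-\mu$ as distributions on $(0,1)$, and $\mu$ is a finite measure.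
   Context: A model is $\xi(t)=\sum_{p\ge2}\beta_p^2t^p$, real $\beta_p$ not all zero, with $\xi(1+\epsilon)<\infty$ for some $\epsilon>0$. $\mathcal{C}$ is the set of $\phi\in C([0,1])$ with $\phi\ge0$, non-increasing and concave; $P_{h,\xi}(\phi)=\int_0^1(\xi''\phi+1/\phi)dx+h^2\phi(0)$. For $\phi\in\mathcal{C}$, $\phi'(0)=\lim_{t\to0^+}(\phi(t)-\phi(0))/t$. $\mathcal{K}_{h,\xi}$ is the set of convex $\eta\in C([0,1])$ with $\eta\ge\xi$, $\eta(1)=\xi(1)$, $\eta'(0)=\xi'(0)-h^2$ (one-sided derivatives at endpoints); $\eta''$ is the distributional second derivative (a nonnegative measure on $(0,1)$), $\eta''_{ac}$ its absolutely continuous density, and $D(\eta)=2\int_0^1\sqrt{\eta''_{ac}}\,dx$. Minimizers of $P_{h,\xi}$ and maximizers of $D$ exist. *)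

theory Defs
  imports "HOL-Analysis.Analysis"
begin

definition xi :: "(nat \<Rightarrow> real) \<Rightarrow> real \<Rightarrow> real" where
  "xi \<beta> t = (\<Sum>p. (if 2 \<le> p then (\<beta> p)\<^sup>2 * t ^ p else 0))"

definition is_model :: "(nat \<Rightarrow> real) \<Rightarrow> bool" where
  "is_model \<beta> \<longleftrightarrow> (\<exists>p\<ge>2. \<beta> p \<noteq> 0) \<and>
     (\<exists>\<epsilon>>0. summable (\<lambda>p. (if 2 \<le> p then (\<beta> p)\<^sup>2 * (1 + \<epsilon>) ^ p else 0)))"

definition Cset :: "(real \<Rightarrow> real) \<Rightarrow> bool" where
  "Cset \<phi> \<longleftrightarrow> continuous_on {0..1} \<phi> \<and> (\<forall>x\<in>{0..1}. 0 \<le> \<phi> x) \<and>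
     (\<forall>x\<in>{0..1}. \<forall>y\<in>{0..1}. x \<le> y \<longrightarrow> \<phi> y \<le> \<phi> x) \<and> concave_on {0..1} \<phi>"

text \<open>P_{h,xi}(phi) as an extended nonnegative real (1/0 = infinity).\<close>
definition Pfun :: "(nat \<Rightarrow> real) \<Rightarrow> real \<Rightarrow> (real \<Rightarrow> real) \<Rightarrow> ennreal" where
  "Pfun \<beta> h \<phi> =
     (\<integral>\<^sup>+ x\<in>{0..1}. (ennreal (deriv (deriv (xi \<beta>)) x * \<phi> x) + inverse (ennreal (\<phi> x))) \<partial>lborel)
     + ennreal (h\<^sup>2 * \<phi> 0)"

definition test_fun :: "(real \<Rightarrow> real) \<Rightarrow> bool" where
  "test_fun \<psi> \<longleftrightarrow> (\<forall>n x. ((deriv ^^ n) \<psi>) differentiable (at x)) \<and>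
     (\<exists>a b. 0 < a \<and> a \<le> b \<and> b < 1 \<and> (\<forall>x. x \<notin> {a..b} \<longrightarrow> \<psi> x = 0))"

definition weak_deriv :: "(real \<Rightarrow> real) \<Rightarrow> (real \<Rightarrow> real) \<Rightarrow> bool" where
  "weak_deriv f g \<longleftrightarrow> (\<forall>a b. 0 < a \<longrightarrow> b < 1 \<longrightarrow> g absolutely_integrable_on {a..b}) \<and>
     (\<forall>\<psi>. test_fun \<psi> \<longrightarrow>
        integral {0..1} (\<lambda>x. f x * deriv \<psi> x) = - integral {0..1} (\<lambda>x. g x * \<psi> x))"

definition radon01 :: "real measure \<Rightarrow> bool" where
  "radon01 \<mu> \<longleftrightarrow> sets \<mu> = sets borel \<and> emeasure \<mu> (- {0<..<1}) = 0 \<and>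
     (\<forall>a b. 0 < a \<longrightarrow> b < 1 \<longrightarrow> emeasure \<mu> {a..b} < \<infinity>)"

definition msupp :: "real measure \<Rightarrow> real set" where
  "msupp \<mu> = {x. \<forall>e>0. emeasure \<mu> (ball x e) > 0}"

definition dist_dd_measure :: "(real \<Rightarrow> real) \<Rightarrow> real measure \<Rightarrow> bool" where
  "dist_dd_measure f \<nu> \<longleftrightarrow> radon01 \<nu> \<and>
     (\<forall>\<psi>. test_fun \<psi> \<longrightarrow> integral {0..1} (\<lambda>x. f x * deriv (deriv \<psi>) x) = integral\<^sup>L \<nu> \<psi>)"

text \<open>d is the density of the absolutely continuous part of nu (Lebesgue decomposition
  nu = d dx + nu_s, with nu_s concentrated on a Lebesgue-null Borel set N).\<close>
definition ac_density :: "real measure \<Rightarrow> (real \<Rightarrow> real) \<Rightarrow> bool" where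
  "ac_density \<nu> d \<longleftrightarrow> d \<in> borel_measurable borel \<and> (\<forall>x. 0 \<le> d x) \<and>
     (\<exists>N\<in>sets borel. emeasure lborel N = 0 \<and>
        (\<forall>A\<in>sets borel. emeasure \<nu> A = emeasure (density lborel (\<lambda>x. ennreal (d x))) A
                                        + emeasure \<nu> (A \<inter> N)))"

text \<open>D(eta) = 2 int_0^1 sqrt(eta''_ac). The density is a.e. unique, so the choice is harmless.\<close>
definition Dfun :: "(real \<Rightarrow> real) \<Rightarrow> ennreal" where
  "Dfun \<eta> = (let d = (SOME d. \<exists>\<nu>. dist_dd_measure \<eta> \<nu> \<and> ac_density \<nu> d)
              in 2 * (\<integral>\<^sup>+ x\<in>{0<..<1}. ennreal (sqrt (d x)) \<partial>lborel))"

definition Kset :: "(nat \<Rightarrow> real) \<Rightarrow> real \<Rightarrow> (real \<Rightarrow> real) \<Rightarrow> bool" where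
  "Kset \<beta> h \<eta> \<longleftrightarrow> continuous_on {0..1} \<eta> \<and> convex_on {0..1} \<eta> \<and>
     (\<forall>x\<in>{0..1}. xi \<beta> x \<le> \<eta> x) \<and> \<eta> 1 = xi \<beta> 1 \<and>
     (\<eta> has_real_derivative (deriv (xi \<beta>) 0 - h\<^sup>2)) (at 0 within {0..1})"

end

theory Submission
  imports Defs "HOL-Computational_Algebra.Polynomial"
begin

text \<open>
  The two problems are dual to each other. The first variation of \<open>P\<close> at the minimizer \<open>\<phi>\<close> is the
  functional \<open>L \<psi> = \<integral> (\<xi>'' - 1 / \<phi>\<^sup>2) \<psi> + h\<^sup>2 \<psi>(0)\<close>, which is nonnegative on the cone of competitors
  and vanishes at \<open>\<phi>\<close> and at 1. Let \<open>E\<close> solve \<open>E'' = 1 / \<phi>\<^sup>2\<close>, \<open>E'(0) = - h\<^sup>2\<close>, \<open>E(1) = \<xi>(1)\<close>. Then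
  \<open>E(s) - \<xi>(s) = L (1 - max s t) \<ge> 0\<close>, so \<open>E\<close> is admissible for the dual problem, and \<open>L \<phi> = 0\<close> becomes
  the complementary slackness \<open>\<integral> (E - \<xi>) d\<mu> = 0\<close> with \<open>\<mu> = - \<phi>''\<close>. For any admissible \<open>\<eta>\<close> with
  \<open>\<nu> = \<eta>''\<close> and density \<open>d\<close>, the inequality \<open>2 sqrt d \<le> \<phi> d + 1 / \<phi>\<close> and two integrations by parts give
  \<open>D(\<eta>) \<le> \<integral> \<phi> d\<nu> + \<integral> 1 / \<phi> \<le> 2 \<integral> 1 / \<phi> = D(E)\<close>, and equality forces \<open>\<nu> = dx / \<phi>\<^sup>2\<close>, that is
  \<open>\<eta> = E\<close>. Before that, comparing \<open>\<phi>\<close> with its tangent near 1 shows \<open>\<phi>(1) > 0\<close> and, together with the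
  first variation, that \<open>\<phi>\<close> is Lipschitz.
\<close>

section \<open>Test functions determine Radon measures\<close>

text \<open>\<open>P\<close> is minimized over a cone, so variations are one-sided, and a nonzero
  element of this cone can vanish or have unbounded slope only at 1. Positivity at 1 gives meaning
  to \<open>1 / \<phi>^2\<close>; the Lipschitz bound makes \<open>\<mu>\<close> finite and the
  boundary terms at 1 available. Since \<open>\<mu>\<close> and \<open>\<eta>''\<close> are only
  measures, convex functions are handled through their bounded right derivatives, and every
  integration by parts comes from one Fubini argument against a finite measure. \<open>Dfun\<close>
  selects some density of some distributional second derivative. To evaluate it, test functions must
  separate Radon measures on the open interval and a Lebesgue decomposition must exist; this is the
  reason for constructing explicit smooth bumps. The slope of \<open>\<phi>\<close> at 0 is not seen
  by \<open>\<mu>\<close>. It enters the duality as a separate nonnegative term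
  \<open>(E 0 - X0 0) * k 0\<close>, and the vanishing of this product is the alternative at 0 in
  the theorem.\<close>

definition flat_exp :: "real poly \<Rightarrow> real \<Rightarrow> real" where
  "flat_exp p x = (if 0 < x then poly p (1 / x) * exp (- (1 / x)) else 0)"

lemma poly_times_exp_minus_tendsto_0:
  "((\<lambda>y::real. poly p y * exp (- y)) \<longlongrightarrow> 0) at_top"
proof -
  have "((\<lambda>y::real. \<Sum>i\<le>degree p. coeff p i * (y ^ i / exp y)) \<longlongrightarrow> (\<Sum>i\<le>degree p. coeff p i * 0)) at_top"
    by (intro tendsto_sum tendsto_mult tendsto_const tendsto_power_div_exp_0)
  moreover have "(\<lambda>y::real. \<Sum>i\<le>degree p. coeff p i * (y ^ i / exp y)) = (\<lambda>y. poly p y * exp (- y))"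
    unfolding poly_altdef sum_distrib_right
    by (intro ext sum.cong refl) (simp add: exp_minus divide_inverse)
  ultimately show ?thesis by simp
qed

lemma flat_exp_over_tendsto_0: "((\<lambda>x. flat_exp p x / x) \<longlongrightarrow> 0) (at 0)"
proof (rule filterlim_split_at_real)
  show "((\<lambda>x. flat_exp p x / x) \<longlongrightarrow> 0) (at_left 0)"
    by (rule tendsto_eventually) (auto simp: eventually_at_filter flat_exp_def)
  \<comment> \<open>Dividing by \<open>x\<close> multiplies the polynomial in \<open>1 / x\<close>
    by its variable, hence \<open>pCons 0 p\<close>.\<close>
  have "((\<lambda>x::real. poly (pCons 0 p) (inverse x) * exp (- inverse x)) \<longlongrightarrow> 0) (at_right 0)"
    by (rule filterlim_compose[OF poly_times_exp_minus_tendsto_0 filterlim_inverse_at_top_right])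
  then show "((\<lambda>x. flat_exp p x / x) \<longlongrightarrow> 0) (at_right 0)"
    by (rule Lim_transform_eventually)
       (auto simp: eventually_at_filter flat_exp_def field_simps)
qed

text \<open>For \<open>x > 0\<close> the chain rule produces the factor \<open>1 / x^2\<close> and
  the polynomial \<open>p - pderiv p\<close>, so the family is closed under differentiation. At 0
  the difference quotient is the one just shown to tend to 0.\<close>

lemma flat_exp_has_derivative:
  "(flat_exp p has_real_derivative flat_exp ([:0, 0, 1:] * (p - pderiv p)) x) (at x)"
proof -
  consider "x > 0" | "x < 0" | "x = 0" by linarith
  then show ?thesis
  proof cases
    case 1
    have "((\<lambda>x. poly p (1 / x) * exp (- (1 / x))) has_real_derivative
        flat_exp ([:0, 0, 1:] * (p - pderiv p)) x) (at x)"
      using 1 by (auto intro!: derivative_eq_intros poly_DERIV[THEN DERIV_chain2]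
          simp: flat_exp_def field_simps)
    then show ?thesis
      by (rule has_field_derivative_transform_within_open[of _ _ _ "{0<..}"])
         (use 1 in \<open>auto simp: flat_exp_def\<close>)
  next
    case 2
    have "((\<lambda>x. 0) has_real_derivative flat_exp ([:0, 0, 1:] * (p - pderiv p)) x) (at x)"
      using 2 by (auto simp: flat_exp_def)
    then show ?thesis
      by (rule has_field_derivative_transform_within_open[of _ _ _ "{..<0}"])
         (use 2 in \<open>auto simp: flat_exp_def\<close>)
  next
    case 3
    then show ?thesis
      using flat_exp_over_tendsto_0[of p] by (simp add: DERIV_def flat_exp_def)
  qed
qed

text \<open>One flat factor for each end of the interval. Arbitrary polynomials make the span stable
  under the product rule; scalars are absorbed in the polynomials, so closure under sums suffices.
  Stability gives smoothness of all orders by induction.\<close>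

inductive_set bump_span :: "real \<Rightarrow> real \<Rightarrow> real \<Rightarrow> (real \<Rightarrow> real) set" for n a b where
  prod: "(\<lambda>x. flat_exp p (n * (x - a)) * flat_exp q (n * (b - x))) \<in> bump_span n a b"
| add: "f \<in> bump_span n a b \<Longrightarrow> g \<in> bump_span n a b \<Longrightarrow> (\<lambda>x. f x + g x) \<in> bump_span n a b"

lemma flat_exp_smult: "flat_exp (smult c p) x = c * flat_exp p x"
  by (simp add: flat_exp_def)

lemma bump_span_has_derivative:
  assumes "f \<in> bump_span n a b"
  shows "\<exists>g\<in>bump_span n a b. \<forall>x. (f has_real_derivative g x) (at x)"
  using assms
proof induction
  case (prod p q)
  let ?D = "\<lambda>p. [:0, 0, 1:] * (p - pderiv p) :: real poly"
  let ?g = "\<lambda>x. flat_exp (smult n (?D p)) (n * (x - a)) * flat_exp q (n * (b - x))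
    + flat_exp p (n * (x - a)) * flat_exp (smult (- n) (?D q)) (n * (b - x))"
  have g: "?g \<in> bump_span n a b"
    by (intro bump_span.add bump_span.prod)
  have "((\<lambda>x. flat_exp p (n * (x - a)) * flat_exp q (n * (b - x)))
      has_real_derivative ?g x) (at x)" for x
    unfolding flat_exp_smult
    by (rule derivative_eq_intros flat_exp_has_derivative[THEN DERIV_chain2] refl)+
       (simp add: algebra_simps)
  then show ?case by (intro bexI[OF _ g] allI)
next
  case (add f g)
  then obtain f' g' where "f' \<in> bump_span n a b" "g' \<in> bump_span n a b"
    "\<And>x. (f has_real_derivative f' x) (at x)" "\<And>x. (g has_real_derivative g' x) (at x)"
    by blast
  then show ?case
    by (intro bexI[of _ "\<lambda>x. f' x + g' x"] allI DERIV_add bump_span.add)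
qed

lemma bump_span_higher_deriv: "f \<in> bump_span n a b \<Longrightarrow> (deriv ^^ m) f \<in> bump_span n a b"
proof (induction m)
  case (Suc m)
  then obtain g where "g \<in> bump_span n a b" "\<And>x. ((deriv ^^ m) f has_real_derivative g x) (at x)"
    using bump_span_has_derivative by blast
  then show ?case
    using DERIV_imp_deriv[of "(deriv ^^ m) f"] by (simp add: ext[of "deriv ((deriv ^^ m) f)" g])
qed simp

text \<open>Scaling by \<open>Suc n\<close> steepens both flanks: for \<open>y > 0\<close>,
  \<open>exp (- 1 / ((n + 1) y))\<close> tends to 1. The bumps thus converge to the indicator of the
  open interval while staying below it.\<close>

definition bump :: "real \<Rightarrow> real \<Rightarrow> nat \<Rightarrow> real \<Rightarrow> real" where
  "bump a b n x = flat_exp 1 (real (Suc n) * (x - a)) * flat_exp 1 (real (Suc n) * (b - x))"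

lemma test_fun_bump:
  assumes "0 < a" "a \<le> b" "b < 1"
  shows "test_fun (bump a b n)"
proof -
  have "bump a b n \<in> bump_span (real (Suc n)) a b"
    unfolding bump_def[abs_def] by (rule bump_span.prod)
  then have "(deriv ^^ m) (bump a b n) differentiable (at x)" for m x
    using bump_span_higher_deriv bump_span_has_derivative real_differentiable_def by blast
  moreover have "bump a b n x = 0" if "x \<notin> {a..b}" for x
    using that by (auto simp: bump_def flat_exp_def zero_less_mult_iff)
  ultimately show ?thesis
    unfolding test_fun_def using assms by blast
qed

lemma bump_nonneg: "0 \<le> bump a b n x"
  by (simp add: bump_def flat_exp_def)

lemma flat_exp_1_bounds: "0 \<le> flat_exp 1 x" "flat_exp 1 x \<le> 1"
  by (simp_all add: flat_exp_def)

lemma bump_le_indicator: "bump a b n x \<le> indicator {a<..<b} x"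
proof (cases "x \<in> {a<..<b}")
  case True
  then show ?thesis
    unfolding bump_def using mult_le_one[OF flat_exp_1_bounds(2) flat_exp_1_bounds(1,2)] by simp
next
  case False
  then have "flat_exp 1 (real (Suc n) * (x - a)) = 0 \<or> flat_exp 1 (real (Suc n) * (b - x)) = 0"
    by (auto simp: flat_exp_def zero_less_mult_iff)
  with False show ?thesis by (auto simp: bump_def)
qed

lemma bump_tendsto_indicator: "(\<lambda>n. bump a b n x) \<longlonglongrightarrow> indicator {a<..<b} x"
proof (cases "x \<in> {a<..<b}")
  case True
  have *: "(\<lambda>n. exp (- (1 / (real (Suc n) * y)))) \<longlonglongrightarrow> 1" if "y > 0" for y :: real
  proof -
    have "(\<lambda>n. exp (- (1 / y * (1 / real (Suc n))))) \<longlonglongrightarrow> exp (- (1 / y * 0))"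
      by (intro tendsto_intros LIMSEQ_Suc[OF lim_1_over_n])
    then show ?thesis by (simp add: mult.commute)
  qed
  have "(\<lambda>n. exp (- (1 / (real (Suc n) * (x - a)))) * exp (- (1 / (real (Suc n) * (b - x))))) \<longlonglongrightarrow> 1 * 1"
    by (intro tendsto_mult *) (use True in auto)
  moreover have "bump a b n x = exp (- (1 / (real (Suc n) * (x - a)))) * exp (- (1 / (real (Suc n) * (b - x))))" for n
    using True by (simp add: bump_def flat_exp_def)
  ultimately show ?thesis using True by simp
next
  case False
  then have "bump a b n x = 0" for n
    using bump_nonneg[of a b n x] bump_le_indicator[of a b n x] by simp
  with False show ?thesis by simp
qed

lemma test_fun_differentiable: "test_fun \<psi> \<Longrightarrow> (\<psi> has_real_derivative deriv \<psi> x) (at x)"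
  unfolding test_fun_def by (metis DERIV_deriv_iff_real_differentiable funpow_0)

lemma test_fun_deriv: "test_fun \<psi> \<Longrightarrow> (deriv \<psi> has_real_derivative deriv (deriv \<psi>) x) (at x)"
  unfolding test_fun_def
  by (metis DERIV_deriv_iff_real_differentiable One_nat_def funpow_0 funpow.simps(2) comp_apply)

lemma test_fun_deriv2: "test_fun \<psi> \<Longrightarrow> continuous_on UNIV (deriv (deriv \<psi>))"
proof -
  assume "test_fun \<psi>"
  then have "((deriv ^^ 2) \<psi>) differentiable (at x)" for x
    unfolding test_fun_def by blast
  then show ?thesis
    by (simp add: numeral_2_eq_2 continuous_at_imp_continuous_on differentiable_imp_continuous_within)
qed

text \<open>The closed interval lies inside the open unit interval, so the bumps are test functions
  and the masses are finite. The limit indicator dominates the bumps, and dominated convergence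
  turns equal integrals into equal masses.\<close>

lemma radon01_test_fun_interval:
  assumes "radon01 \<mu>" "radon01 \<nu>"
    and "\<And>\<psi>. test_fun \<psi> \<Longrightarrow> integral\<^sup>L \<mu> \<psi> = integral\<^sup>L \<nu> \<psi>"
    and "0 < a" "b < 1"
  shows "emeasure \<mu> {a<..<b} = emeasure \<nu> {a<..<b}"
proof (cases "a \<le> b")
  case True
  have lim: "(\<lambda>n. integral\<^sup>L M (bump a b n)) \<longlonglongrightarrow> measure M {a<..<b}"
    and fin: "emeasure M {a<..<b} < \<infinity>" if "radon01 M" for M
  proof -
    have [measurable_cong]: "sets M = sets borel" using that by (simp add: radon01_def)
    have "emeasure M {a..b} < \<infinity>"
      using that assms(4,5) by (simp add: radon01_def)
    moreover have "emeasure M {a<..<b} \<le> emeasure M {a..b}"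
      by (rule emeasure_mono) auto
    ultimately show fin: "emeasure M {a<..<b} < \<infinity>" by simp
    have "(\<lambda>n. integral\<^sup>L M (bump a b n)) \<longlonglongrightarrow> integral\<^sup>L M (indicator {a<..<b})"
    proof (rule integral_dominated_convergence[where w="indicator {a<..<b}"])
      show "integrable M (indicator {a<..<b} :: real \<Rightarrow> real)"
        using fin by (intro integrable_real_indicator) auto
      show "bump a b n \<in> borel_measurable M" for n
        unfolding measurable_cong_sets[OF \<open>sets M = sets borel\<close> refl]
        by (intro borel_measurable_continuous_onI continuous_at_imp_continuous_on ballI
            DERIV_isCont[OF test_fun_differentiable] test_fun_bump assms True)
      show "indicator {a<..<b} \<in> borel_measurable M" by measurable
      show "AE x in M. (\<lambda>n. bump a b n x) \<longlonglongrightarrow> indicator {a<..<b} x"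
        using bump_tendsto_indicator by simp
      show "AE x in M. norm (bump a b n x) \<le> indicator {a<..<b} x" for n
        using bump_le_indicator bump_nonneg by simp
    qed
    moreover have "space M = UNIV" using sets_eq_imp_space_eq[OF \<open>sets M = sets borel\<close>] by simp
    ultimately show "(\<lambda>n. integral\<^sup>L M (bump a b n)) \<longlonglongrightarrow> measure M {a<..<b}" by simp
  qed
  have "measure \<mu> {a<..<b} = measure \<nu> {a<..<b}"
    using lim[OF assms(1)] lim[OF assms(2)] assms(3)[OF test_fun_bump[OF assms(4) True assms(5)]]
    by (simp add: LIMSEQ_unique)
  then show ?thesis
    using fin[OF assms(1)] fin[OF assms(2)] by (simp add: emeasure_eq_ennreal_measure)
qed simp

text \<open>A Radon measure on the open interval may have infinite mass near 0 and 1. Uniqueness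
  from a generator is therefore applied to the restrictions to \<open>J n\<close>, which are finite
  on bounded intervals, and the result is recovered by monotone exhaustion.\<close>

lemma radon01_eqI:
  assumes \<mu>: "radon01 \<mu>" and \<nu>: "radon01 \<nu>"
    and eq: "\<And>\<psi>. test_fun \<psi> \<Longrightarrow> integral\<^sup>L \<mu> \<psi> = integral\<^sup>L \<nu> \<psi>"
  shows "\<mu> = \<nu>"
proof -
  have sets: "sets \<mu> = sets borel" "sets \<nu> = sets borel"
    using \<mu> \<nu> by (auto simp: radon01_def)
  have gen: "sets borel = sigma_sets UNIV (range (\<lambda>(a, b). {a<..<b :: real}))"
    unfolding borel_eq_box box_real by (rule sets_measure_of) simp
  define J where "J n = {1 / real (Suc n)<..<1 - 1 / real (Suc n)}" for n
  have Jb: "J n \<in> sets borel" for n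
    by (simp add: J_def)
  have J: "emeasure \<mu> (A \<inter> J n) = emeasure \<nu> (A \<inter> J n)" if A: "A \<in> sets borel" for A n
  proof -
    have "density \<mu> (indicator (J n)) = density \<nu> (indicator (J n))"
    proof (rule measure_eqI_generator_eq[where E="range (\<lambda>(a, b). {a<..<b})" and \<Omega>=UNIV
          and A="\<lambda>i. {- real i<..<real i}"])
      show "Int_stable (range (\<lambda>(a, b). {a<..<b :: real}))"
        unfolding Int_stable_def
      proof (intro ballI)
        fix X Y assume "X \<in> range (\<lambda>(a, b). {a<..<b :: real})" "Y \<in> range (\<lambda>(a, b). {a<..<b :: real})"
        then obtain a b c d where "X = {a<..<b}" "Y = {c<..<d}" by auto
        then have "X \<inter> Y = (\<lambda>(a, b). {a<..<b}) (max a c, min b d)" by auto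
        then show "X \<inter> Y \<in> range (\<lambda>(a, b). {a<..<b :: real})" by blast
      qed
      show "emeasure (density \<mu> (indicator (J n))) X = emeasure (density \<nu> (indicator (J n))) X"
        if "X \<in> range (\<lambda>(a, b). {a<..<b})" for X
      proof -
        from that obtain a b where X: "X = {a<..<b}" by auto
        \<comment> \<open>Intersecting with \<open>J n\<close> pushes the end points strictly inside
          the unit interval, where the comparison on open intervals is available.\<close>
        have "J n \<inter> X = {max a (1 / real (Suc n))<..<min b (1 - 1 / real (Suc n))}"
          by (auto simp: J_def X)
        moreover have "0 < max a (1 / real (Suc n))" "min b (1 - 1 / real (Suc n)) < 1"
          by (auto simp: less_max_iff_disj min_less_iff_disj)
        ultimately have "emeasure \<mu> (J n \<inter> X) = emeasure \<nu> (J n \<inter> X)"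
          using radon01_test_fun_interval[OF \<mu> \<nu> eq] by simp
        then show ?thesis
          by (simp add: emeasure_restricted sets Jb X)
      qed
      show "sets (density \<mu> (indicator (J n))) = sigma_sets UNIV (range (\<lambda>(a, b). {a<..<b}))"
        "sets (density \<nu> (indicator (J n))) = sigma_sets UNIV (range (\<lambda>(a, b). {a<..<b}))"
        using gen by (simp_all add: sets)
      show "(\<Union>i. {- real i<..<real i}) = UNIV"
      proof (intro set_eqI iffI UNIV_I)
        fix x :: real
        obtain i where "\<bar>x\<bar> < real i" using reals_Archimedean2 by blast
        then show "x \<in> (\<Union>i. {- real i<..<real i})" by (auto intro!: exI[of _ i])
      qed
      show "emeasure (density \<mu> (indicator (J n))) {- real i<..<real i} \<noteq> \<infinity>" for i
      proof -
        have "emeasure \<mu> (J n \<inter> {- real i<..<real i}) \<le> emeasure \<mu> {1 / real (Suc n)..1 - 1 / real (Suc n)}"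
          by (rule emeasure_mono) (simp_all add: J_def sets subset_eq)
        also have "\<dots> < \<infinity>" using \<mu> by (simp add: radon01_def)
        finally show ?thesis
          by (simp add: emeasure_restricted sets Jb)
      qed
      show "range (\<lambda>i. {- real i<..<real i}) \<subseteq> range (\<lambda>(a, b). {a<..<b})"
        by (metis (no_types, lifting) case_prod_conv image_subsetI rangeI)
    qed simp
    then have "emeasure (density \<mu> (indicator (J n))) A = emeasure (density \<nu> (indicator (J n))) A"
      by simp
    then show ?thesis
      using A by (simp add: emeasure_restricted sets Jb Int_commute)
  qed
  show ?thesis
  proof (rule measure_eqI)
    show "sets \<mu> = sets \<nu>" by (simp add: sets)
    fix A assume "A \<in> sets \<mu>"
    then have A: "A \<in> sets borel" by (simp add: sets)
    have inc: "incseq (\<lambda>n. A \<inter> J n)"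
    proof (rule monoI)
      fix m n :: nat assume "m \<le> n"
      then have "1 / real (Suc n) \<le> 1 / real (Suc m)" by (simp add: frac_le)
      then show "A \<inter> J m \<subseteq> A \<inter> J n" by (auto simp: J_def)
    qed
    have un: "(\<Union>n. A \<inter> J n) = A \<inter> {0<..<1}"
    proof (intro set_eqI iffI)
      fix x assume "x \<in> (\<Union>n. A \<inter> J n)"
      then obtain n where "x \<in> A" "1 / real (Suc n) < x" "x < 1 - 1 / real (Suc n)"
        by (auto simp: J_def)
      moreover have "0 < 1 / real (Suc n)" by simp
      ultimately have "0 < x" "x < 1" by linarith+
      with \<open>x \<in> A\<close> show "x \<in> A \<inter> {0<..<1}" by simp
    next
      fix x assume x: "x \<in> A \<inter> {0<..<1}"
      then have "0 < min x (1 - x)" by simp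
      then obtain n where "1 / real (Suc n) < min x (1 - x)"
        by (rule nat_approx_posE)
      then have "x \<in> J n" by (simp add: J_def)
      then show "x \<in> (\<Union>n. A \<inter> J n)" using x by blast
    qed
    have *: "emeasure M A = (SUP n. emeasure M (A \<inter> J n))" if "radon01 M" for M
    proof -
      have sM: "sets M = sets borel" "emeasure M (- {0<..<1}) = 0"
        using that by (auto simp: radon01_def)
      have "emeasure M A = emeasure M (A \<inter> {0<..<1})"
      proof (rule emeasure_eq_AE)
        show "AE x in M. x \<in> A \<longleftrightarrow> x \<in> A \<inter> {0<..<1}"
          by (rule AE_I[of _ _ "- {0<..<1}"]) (auto simp: sM)
      qed (use A in \<open>simp_all add: sM\<close>)
      also have "\<dots> = (SUP n. emeasure M (A \<inter> J n))"
      proof -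
        have "range (\<lambda>n. A \<inter> J n) \<subseteq> sets M"
          using A by (auto simp: sM Jb)
        from SUP_emeasure_incseq[OF this inc] show ?thesis by (simp only: un)
      qed
      finally show ?thesis .
    qed
    show "emeasure \<mu> A = emeasure \<nu> A"
      using *[OF \<mu>] *[OF \<nu>] J[OF A] by simp
  qed
qed

section \<open>Convex functions with bounded slopes\<close>

text \<open>For convex \<open>f\<close> the difference quotient decreases as \<open>y\<close>
  decreases to \<open>x\<close>, so this infimum is the right derivative.\<close>

definition right_slope :: "(real \<Rightarrow> real) \<Rightarrow> real \<Rightarrow> real" where
  "right_slope f x = (INF y\<in>{x<..1}. (f y - f x) / (y - x))"

text \<open>The right derivative of a convex function on the unit interval, extended by constants so that it is
  right continuous on the whole line and its Stieltjes measure is concentrated on the open interval.\<close>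
definition slope_fun :: "(real \<Rightarrow> real) \<Rightarrow> real \<Rightarrow> real" where
  "slope_fun f x = (if x < 0 then right_slope f 0 else if x < 1 then right_slope f x
     else (SUP z\<in>{0..<1}. right_slope f z))"

text \<open>Cutting the interval into \<open>n + 1\<close> equal pieces and telescoping
  \<open>a\<close> gains a factor \<open>1 / (n + 1)\<close> in the bound. It replaces an argument
  by almost everywhere differentiability.\<close>

lemma constant_if_increments_small:
  fixes D a :: "real \<Rightarrow> real"
  assumes bd: "\<And>x y. 0 \<le> x \<Longrightarrow> x \<le> y \<Longrightarrow> y \<le> 1 \<Longrightarrow> \<bar>D y - D x\<bar> \<le> (a y - a x) * (y - x)"
    and xy: "0 \<le> x" "x \<le> y" "y \<le> 1"
  shows "D x = D y"
proof -
  have *: "\<bar>D y - D x\<bar> \<le> (a y - a x) * (y - x) / real (Suc n)" for n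
  proof -
    define d where "d = (y - x) / real (Suc n)"
    define p where "p i = x + real i * d" for i :: nat
    have nd: "real (Suc n) * d = y - x" by (simp add: d_def del: of_nat_Suc)
    then have p0: "p 0 = x" "p (Suc n) = y" by (simp_all add: p_def)
    have inc: "p (Suc i) - p i = d" for i
      by (simp add: p_def algebra_simps)
    have nonneg: "0 \<le> d" using xy by (simp add: d_def)
    have range: "0 \<le> p i" "p i \<le> p (Suc i)" "p (Suc i) \<le> 1" if "i < Suc n" for i
    proof -
      show "0 \<le> p i" using xy nonneg by (simp add: p_def)
      show "p i \<le> p (Suc i)" using inc[of i] nonneg by linarith
      have "real (Suc i) * d \<le> real (Suc n) * d"
        using that nonneg by (intro mult_right_mono) auto
      then show "p (Suc i) \<le> 1" using xy nd by (simp add: p_def)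
    qed
    have "D y - D x = (\<Sum>i<Suc n. D (p (Suc i)) - D (p i))"
      using sum_lessThan_telescope[of "\<lambda>i. D (p i)" "Suc n"] p0 by simp
    then have "\<bar>D y - D x\<bar> \<le> (\<Sum>i<Suc n. \<bar>D (p (Suc i)) - D (p i)\<bar>)"
      by (simp only: sum_abs)
    also have "\<dots> \<le> (\<Sum>i<Suc n. (a (p (Suc i)) - a (p i)) * d)"
    proof (rule sum_mono)
      fix i assume "i \<in> {..<Suc n}"
      then show "\<bar>D (p (Suc i)) - D (p i)\<bar> \<le> (a (p (Suc i)) - a (p i)) * d"
        using bd[of "p i" "p (Suc i)"] range[of i] inc[of i] by simp
    qed
    also have "\<dots> = (a y - a x) * d"
      unfolding sum_distrib_right[symmetric]
      using sum_lessThan_telescope[of "\<lambda>i. a (p i)" "Suc n"] p0 by simp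
    finally show ?thesis by (simp add: d_def)
  qed
  have "(\<lambda>n. (a y - a x) * (y - x) * (1 / real (Suc n))) \<longlonglongrightarrow> (a y - a x) * (y - x) * 0"
    by (intro tendsto_mult tendsto_const LIMSEQ_Suc[OF lim_1_over_n])
  then have "\<bar>D y - D x\<bar> \<le> 0"
    by (intro LIMSEQ_le_const[of _ 0]) (use * in auto)
  then show ?thesis by simp
qed

text \<open>Slope bounds are demanded only at the two ends; convexity carries them to all chords.
  They make the right derivative bounded and its Stieltjes measure finite.\<close>

locale convex_bounded_slope =
  fixes f :: "real \<Rightarrow> real" and A B :: real
  assumes conv: "convex_on {0..1} f" and cont: "continuous_on {0..1} f"
    and lower_slope: "\<And>y. y \<in> {0<..1} \<Longrightarrow> A * y \<le> f y - f 0"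
    and upper_slope: "\<And>x. x \<in> {0..<1} \<Longrightarrow> f 1 - f x \<le> B * (1 - x)"
begin

abbreviation chord :: "real \<Rightarrow> real \<Rightarrow> real" where
  "chord x y \<equiv> (f y - f x) / (y - x)"

lemma chord_mono: "0 \<le> x \<Longrightarrow> x < y \<Longrightarrow> y < z \<Longrightarrow> z \<le> 1 \<Longrightarrow> chord x y \<le> chord y z"
  using convex_on_slope_le[OF conv, of x z y] minus_divide_divide[of "f y - f x" "y - x"]
    minus_divide_divide[of "f z - f y" "z - y"] by simp

lemma chord_ge: "0 \<le> x \<Longrightarrow> x < y \<Longrightarrow> y \<le> 1 \<Longrightarrow> A \<le> chord x y"
proof -
  assume *: "0 \<le> x" "x < y" "y \<le> 1"
  have A: "A \<le> chord 0 z" if "0 < z" "z \<le> 1" for z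
    using lower_slope[of z] that by (simp add: field_simps)
  show ?thesis
  proof (cases "x = 0")
    case True
    then show ?thesis using A[of y] * by simp
  next
    case False
    then show ?thesis using A[of x] chord_mono[of 0 x y] * by linarith
  qed
qed

lemma chord_le: "0 \<le> x \<Longrightarrow> x < y \<Longrightarrow> y \<le> 1 \<Longrightarrow> chord x y \<le> B"
proof -
  assume *: "0 \<le> x" "x < y" "y \<le> 1"
  have B: "chord z 1 \<le> B" if "0 \<le> z" "z < 1" for z
    using upper_slope[of z] that by (simp add: field_simps)
  show ?thesis
  proof (cases "y = 1")
    case True
    then show ?thesis using B[of x] * by simp
  next
    case False
    then show ?thesis using B[of y] chord_mono[of x y 1] * by linarith
  qed
qed

lemma right_slope_le: "0 \<le> x \<Longrightarrow> x < y \<Longrightarrow> y \<le> 1 \<Longrightarrow> right_slope f x \<le> chord x y"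
  unfolding right_slope_def
  by (rule cINF_lower) (auto intro!: bdd_belowI2[of _ A] chord_ge)

lemma right_slope_ge:
  "x < 1 \<Longrightarrow> (\<And>y. x < y \<Longrightarrow> y \<le> 1 \<Longrightarrow> c \<le> chord x y) \<Longrightarrow> c \<le> right_slope f x"
  unfolding right_slope_def by (rule cINF_greatest) auto

lemma chord_le_right_slope: "0 \<le> x \<Longrightarrow> x < y \<Longrightarrow> y < 1 \<Longrightarrow> chord x y \<le> right_slope f y"
  by (rule right_slope_ge) (auto intro: chord_mono)

lemma right_slope_mono: "0 \<le> x \<Longrightarrow> x \<le> y \<Longrightarrow> y < 1 \<Longrightarrow> right_slope f x \<le> right_slope f y"
  using right_slope_le[of x y] chord_le_right_slope[of x y] by (cases "x = y") auto

lemma right_slope_bounds: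
  assumes "0 \<le> x" "x < 1"
  shows "A \<le> right_slope f x" "right_slope f x \<le> B"
  using assms right_slope_le[of x 1] chord_le[of x 1]
  by (auto intro!: right_slope_ge chord_ge)

abbreviation "a \<equiv> slope_fun f"

lemma slope_fun_inner: "0 \<le> x \<Longrightarrow> x < 1 \<Longrightarrow> a x = right_slope f x"
  by (simp add: slope_fun_def)

lemma slope_fun_const: "x \<le> 0 \<Longrightarrow> a x = a 0" "1 \<le> x \<Longrightarrow> a x = a 1"
  by (simp_all add: slope_fun_def)

lemma right_slope_le_end: "0 \<le> x \<Longrightarrow> x < 1 \<Longrightarrow> right_slope f x \<le> a 1"
  unfolding slope_fun_def
  by (auto intro!: cSUP_upper bdd_aboveI2[of _ _ B] right_slope_bounds)

lemma slope_fun_end_le: "(\<And>x. 0 \<le> x \<Longrightarrow> x < 1 \<Longrightarrow> right_slope f x \<le> c) \<Longrightarrow> a 1 \<le> c"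
  unfolding slope_fun_def by (auto intro!: cSUP_least)

lemma slope_fun_bounds: "A \<le> a x" "a x \<le> B"
proof -
  have 0: "A \<le> a 0" "a 0 \<le> B"
    using right_slope_bounds[of 0] by (simp_all add: slope_fun_inner)
  have 1: "A \<le> a 1"
    using right_slope_bounds(1)[of 0] right_slope_le_end[of 0] by simp
  have 2: "a 1 \<le> B"
    by (rule slope_fun_end_le) (rule right_slope_bounds)
  consider "x \<le> 0" | "0 \<le> x" "x < 1" | "1 \<le> x" by linarith
  then have "A \<le> a x \<and> a x \<le> B"
  proof cases
    case 1
    then show ?thesis using 0 slope_fun_const(1)[of x] by presburger
  next
    case 2
    then show ?thesis using right_slope_bounds[of x] slope_fun_inner by simp
  next
    case 3
    then show ?thesis using \<open>A \<le> a 1\<close> \<open>a 1 \<le> B\<close> slope_fun_const(2)[of x] by presburger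
  qed
  then show "A \<le> a x" "a x \<le> B" by auto
qed

lemma slope_fun_mono: "x \<le> y \<Longrightarrow> a x \<le> a y"
proof -
  assume xy: "x \<le> y"
  have 01: "a u \<le> a v" if "0 \<le> u" "u \<le> v" "v \<le> 1" for u v
  proof (cases "v = 1")
    case True
    then show ?thesis
      using that right_slope_le_end[of u] slope_fun_inner[of u] by (cases "u = 1") simp_all
  next
    case False
    then show ?thesis
      using that right_slope_mono[of u v] slope_fun_inner[of u] slope_fun_inner[of v] by simp
  qed
  define u v where "u = max 0 (min 1 x)" and "v = max 0 (min 1 y)"
  have "a x = a u"
  proof -
    have "x \<le> 0 \<and> u = 0 \<or> u = x \<or> 1 \<le> x \<and> u = 1" by (auto simp: u_def)
    then show ?thesis using slope_fun_const[of x] by metis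
  qed
  moreover have "a y = a v"
  proof -
    have "y \<le> 0 \<and> v = 0 \<or> v = y \<or> 1 \<le> y \<and> v = 1" by (auto simp: v_def)
    then show ?thesis using slope_fun_const[of y] by metis
  qed
  moreover have "a u \<le> a v"
    using xy by (intro 01) (auto simp: u_def v_def)
  ultimately show ?thesis by simp
qed

lemma slope_fun_measurable [measurable]: "a \<in> borel_measurable borel"
  by (rule borel_measurable_mono) (simp add: monoI slope_fun_mono)

text \<open>Inside the interval the slope is an infimum of chords that depend continuously on their
  left end, hence upper semicontinuous from the right; monotonicity supplies the other half.\<close>

lemma slope_fun_right_cont: "continuous (at_right x) a"
  unfolding continuous_within
proof (rule order_tendstoI)
  fix c assume "c < a x"
  then show "\<forall>\<^sub>F z in at_right x. c < a z"
    using slope_fun_mono[of x] by (auto simp: eventually_at_filter intro!: always_eventually intro: less_le_trans)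
next
  fix c assume c: "a x < c"
  consider "x < 0" | "0 \<le> x" "x < 1" | "1 \<le> x" by linarith
  then show "\<forall>\<^sub>F z in at_right x. a z < c"
  proof cases
    case 1
    have "\<forall>\<^sub>F z in at_right x. z < 0" using 1 by (rule order_tendstoD[OF tendsto_ident_at])
    then show ?thesis
    proof eventually_elim
      case (elim z)
      then show ?case using 1 c slope_fun_const(1)[of x] slope_fun_const(1)[of z] by simp
    qed
  next
    case 3
    have "\<forall>\<^sub>F z in at_right x. x < z" by (rule eventually_at_right_less)
    then show ?thesis
    proof eventually_elim
      case (elim z)
      then show ?case using 3 c slope_fun_const(2)[of x] slope_fun_const(2)[of z] by simp
    qed
  next
    case 2
    have "\<exists>y\<in>{x<..1}. chord x y < c"
    proof (rule ccontr)
      assume "\<not> ?thesis"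
      then have "c \<le> right_slope f x"
        using 2 by (intro right_slope_ge) (auto simp: not_less)
      then show False using c 2 by (simp add: slope_fun_inner)
    qed
    then obtain y where y: "x < y" "y \<le> 1" "chord x y < c" by auto
    have "(f \<longlongrightarrow> f x) (at x within {0..1})"
      using cont 2 by (auto simp: continuous_on_def)
    then have "(f \<longlongrightarrow> f x) (at x within {x..1})"
      by (rule tendsto_within_subset) (use 2 in auto)
    then have "(f \<longlongrightarrow> f x) (at_right x)"
      using 2 by (simp add: at_within_Icc_at_right)
    then have "((\<lambda>z. chord z y) \<longlongrightarrow> chord x y) (at_right x)"
      using y by (intro tendsto_intros) auto
    then have "\<forall>\<^sub>F z in at_right x. chord z y < c"
      using y by (intro order_tendstoD)
    moreover have "\<forall>\<^sub>F z in at_right x. z < y" using y by (intro order_tendstoD[OF tendsto_ident_at])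
    moreover have "\<forall>\<^sub>F z in at_right x. x < z" by (rule eventually_at_right_less)
    ultimately show ?thesis
    proof eventually_elim
      case (elim z)
      then have "right_slope f z \<le> chord z y" using 2 y by (intro right_slope_le) auto
      then show ?case using elim 2 y by (simp add: slope_fun_inner)
    qed
  qed
qed

text \<open>The value at 1 was chosen as the supremum of the slopes precisely so that no jump, and
  hence no atom, arises at 1.\<close>

lemma slope_fun_left_cont_1: "continuous (at_left 1) a"
  unfolding continuous_within
proof (rule order_tendstoI)
  fix c assume "a 1 < c"
  then show "\<forall>\<^sub>F z in at_left 1. a z < c"
  proof -
    have "a z < c" if "z < 1" for z
      using slope_fun_mono[of z 1] that \<open>a 1 < c\<close> by simp
    then show ?thesis by (simp add: eventually_at_filter)
  qed
next
  fix c assume c: "c < a 1"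
  have "\<exists>z\<in>{0..<1}. c < right_slope f z"
  proof (rule ccontr)
    assume "\<not> ?thesis"
    then have "a 1 \<le> c" by (intro slope_fun_end_le) (auto simp: not_less)
    then show False using c by simp
  qed
  then obtain z where z: "0 \<le> z" "z < 1" "c < a z" by (auto simp: slope_fun_inner)
  have "\<forall>\<^sub>F y in at_left 1. z < y" using z by (intro order_tendstoD[OF tendsto_ident_at])
  then show "\<forall>\<^sub>F y in at_left 1. c < a y"
  proof eventually_elim
    case (elim y)
    then show ?case using z slope_fun_mono[of z y] by simp
  qed
qed

lemma chord_le_slope_fun: "0 \<le> x \<Longrightarrow> x < y \<Longrightarrow> y \<le> 1 \<Longrightarrow> chord x y \<le> a y"
proof -
  assume *: "0 \<le> x" "x < y" "y \<le> 1"
  show ?thesis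
  proof (cases "y = 1")
    case False
    then show ?thesis using chord_le_right_slope[of x y] * by (simp add: slope_fun_inner)
  next
    case True
    have "(f \<longlongrightarrow> f 1) (at 1 within {0..1})"
      using cont by (auto simp: continuous_on_def)
    then have "(f \<longlongrightarrow> f 1) (at_left 1)"
      by (simp add: at_within_Icc_at_left)
    then have lim: "((\<lambda>z. chord x z) \<longlongrightarrow> chord x 1) (at_left 1)"
      using * True by (intro tendsto_intros) auto
    have "\<forall>\<^sub>F z in at_left 1. x < z" using * True by (intro order_tendstoD[OF tendsto_ident_at]) auto
    moreover have "\<forall>\<^sub>F z in at_left (1::real). z < 1" by (simp add: eventually_at_filter)
    ultimately have "\<forall>\<^sub>F z in at_left 1. chord x z \<le> a 1"
    proof eventually_elim
      case (elim z)
      then show ?case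
        using chord_le_right_slope[of x z] right_slope_le_end[of z] * by linarith
    qed
    then show ?thesis
      using tendsto_upperbound[OF lim] True by simp
  qed
qed

lemma slope_fun_sandwich:
  assumes "0 \<le> x" "x \<le> y" "y \<le> 1"
  shows "a x * (y - x) \<le> f y - f x" "f y - f x \<le> a y * (y - x)"
  using assms right_slope_le[of x y] chord_le_slope_fun[of x y] slope_fun_inner[of x]
  by (cases "x = y"; simp add: field_simps)+

lemma slope_fun_abs_le: "\<bar>a x\<bar> \<le> max \<bar>A\<bar> \<bar>B\<bar>"
  using slope_fun_bounds[of x] by linarith

lemma slope_fun_set_integrable: "set_integrable lborel {x..y} a"
proof (rule set_integrable_bound[of _ _ "\<lambda>_. max \<bar>A\<bar> \<bar>B\<bar>"])
  show "set_integrable lborel {x..y} (\<lambda>_. max \<bar>A\<bar> \<bar>B\<bar>)"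
    by (intro borel_integrable_atLeastAtMost' continuous_on_const)
  show "set_borel_measurable lborel {x..y} a"
    unfolding set_borel_measurable_def by measurable
  show "AE z in lborel. z \<in> {x..y} \<longrightarrow> norm (a z) \<le> norm (max \<bar>A\<bar> \<bar>B\<bar>)"
    using slope_fun_abs_le by (intro AE_I2) (metis abs_ge_self order_trans real_norm_def)
qed

lemma slope_fun_integrable: "a integrable_on {x..y}"
  using slope_fun_set_integrable set_borel_integral_eq_integral(1) by blast

text \<open>On every subinterval both the increment of \<open>f\<close> and the integral of the
  slope lie between \<open>a x * (y - x)\<close> and \<open>a y * (y - x)\<close>, so their
  difference has negligible increments.\<close>

lemma integral_slope_fun:
  assumes "0 \<le> x" "x \<le> y" "y \<le> 1"
  shows "integral {x..y} a = f y - f x"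
proof -
  have "f x - integral {0..x} a = f y - integral {0..y} a"
  proof (rule constant_if_increments_small[of "\<lambda>x. f x - integral {0..x} a" a, OF _ assms])
    fix x y :: real assume xy: "0 \<le> x" "x \<le> y" "y \<le> 1"
    have "integral {0..x} a + integral {x..y} a = integral {0..y} a"
      by (rule Henstock_Kurzweil_Integration.integral_combine) (use xy slope_fun_integrable in auto)
    moreover have "integral {x..y} a \<le> integral {x..y} (\<lambda>_. a y)"
      by (rule integral_le) (auto intro: slope_fun_integrable slope_fun_mono)
    moreover have "integral {x..y} (\<lambda>_. a x) \<le> integral {x..y} a"
      by (rule integral_le) (auto intro: slope_fun_integrable slope_fun_mono)
    ultimately show "\<bar>(f y - integral {0..y} a) - (f x - integral {0..x} a)\<bar> \<le> (a y - a x) * (y - x)"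
      using slope_fun_sandwich[OF xy] xy unfolding abs_le_iff by (simp add: algebra_simps)
  qed
  moreover have "integral {0..x} a + integral {x..y} a = integral {0..y} a"
    by (rule Henstock_Kurzweil_Integration.integral_combine) (use assms slope_fun_integrable in auto)
  ultimately show ?thesis by simp
qed

lemma right_slope_limit: "((\<lambda>t. (f t - f 0) / t) \<longlongrightarrow> a 0) (at_right 0)"
proof (rule tendsto_sandwich[of "\<lambda>_. a 0" _ _ a])
  have ev: "\<forall>\<^sub>F y in at_right (0::real). 0 < y \<and> y < 1"
    by (intro eventually_conj eventually_at_right_less order_tendstoD(2)[OF tendsto_ident_at]) simp
  show "\<forall>\<^sub>F y in at_right 0. a 0 \<le> (f y - f 0) / y"
    using ev by eventually_elim (use right_slope_le[of 0] slope_fun_inner[of 0] in simp)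
  show "\<forall>\<^sub>F y in at_right 0. (f y - f 0) / y \<le> a y"
    using ev by eventually_elim (use chord_le_slope_fun[of 0] in simp)
  show "(a \<longlongrightarrow> a 0) (at_right 0)"
    using slope_fun_right_cont[of 0] by (simp add: continuous_within)
qed simp

lemma slope_fun_0_eq:
  assumes "(f has_real_derivative D) (at 0 within {0..1})"
  shows "a 0 = D"
proof -
  have "((\<lambda>y. (f y - f 0) / (y - 0)) \<longlongrightarrow> D) (at 0 within {0..1})"
    using assms by (simp add: has_field_derivative_iff)
  then have "((\<lambda>y. (f y - f 0) / y) \<longlongrightarrow> D) (at_right 0)"
    by (simp add: at_within_Icc_at_right)
  then show ?thesis using tendsto_unique[OF _ right_slope_limit] by simp
qed

section \<open>The Stieltjes measure of the right derivative\<close>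

abbreviation "m \<equiv> interval_measure a"

lemma emeasure_slope_Ioc: "x \<le> y \<Longrightarrow> emeasure m {x<..y} = ennreal (a y - a x)"
  by (rule emeasure_interval_measure_Ioc) (auto intro: slope_fun_mono slope_fun_right_cont)

text \<open>The extension to the left takes the value \<open>a 0\<close>, so the initial slope
  creates no atom at 0; left continuity excludes one at 1. The end slopes therefore appear only as
  boundary terms.\<close>

lemma slope_measure_outside: "emeasure m (- {0<..<1}) = 0"
proof -
  have "{- real n<..0} \<in> null_sets m" for n
    using emeasure_slope_Ioc[of "- real n" 0] slope_fun_const(1)[of "- real n"] by auto
  then have 1: "(\<Union>n. {- real n<..0}) \<in> null_sets m" by (rule null_sets_UN)
  have "{1<..1 + real n} \<in> null_sets m" for n
    using emeasure_slope_Ioc[of 1 "1 + real n"] slope_fun_const(2)[of "1 + real n"] by auto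
  then have 2: "(\<Union>n. {1<..1 + real n}) \<in> null_sets m" by (rule null_sets_UN)
  have "emeasure m {1} \<le> 0"
  proof (rule tendsto_lowerbound)
    show "((\<lambda>z. ennreal (a 1 - a z)) \<longlongrightarrow> 0) (at_left 1)"
    proof -
      have "((\<lambda>z. ennreal (a 1 - a z)) \<longlongrightarrow> ennreal (a 1 - a 1)) (at_left 1)"
        using slope_fun_left_cont_1 by (intro tendsto_intros) (simp add: continuous_within)
      then show ?thesis by simp
    qed
    have "\<forall>\<^sub>F z in at_left (1::real). z < 1" by (simp add: eventually_at_filter)
    then show "\<forall>\<^sub>F z in at_left 1. emeasure m {1} \<le> ennreal (a 1 - a z)"
    proof eventually_elim
      case (elim z)
      then have "emeasure m {1} \<le> emeasure m {z<..1}" by (intro emeasure_mono) auto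
      then show ?case using elim by (simp add: emeasure_slope_Ioc)
    qed
  qed simp
  then have 3: "{1} \<in> null_sets m" by auto
  have "- {0<..<1} \<subseteq> (\<Union>n. {- real n<..0}) \<union> ((\<Union>n. {1<..1 + real n}) \<union> {1})"
  proof
    fix x :: real assume x: "x \<in> - {0<..<1}"
    obtain n where "\<bar>x\<bar> < real n" using reals_Archimedean2 by blast
    with x have "x \<in> {- real n<..0} \<or> x \<in> {1<..1 + real n} \<or> x = 1" by auto
    then show "x \<in> (\<Union>n. {- real n<..0}) \<union> ((\<Union>n. {1<..1 + real n}) \<union> {1})"
      by blast
  qed
  then have "- {0<..<1} \<in> null_sets m"
    by (intro null_sets_subset[OF null_sets.Un[OF 1 null_sets.Un[OF 2 3]]]) (simp_all only: sets_interval_measure, simp)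
  then show ?thesis by (rule null_setsD1)
qed

lemma AE_slope_measure: "AE x in m. x \<in> {0<..<1}"
proof (rule AE_I[OF _ slope_measure_outside])
  show "- {0<..<1} \<in> sets m" by simp
qed blast

lemma emeasure_slope_atMost: "0 \<le> t \<Longrightarrow> emeasure m {..t} = ennreal (a t - a 0)"
proof -
  assume t: "0 \<le> t"
  have "AE x in m. x \<in> {..t} \<longleftrightarrow> x \<in> {0<..t}"
    using AE_slope_measure by eventually_elim auto
  then have "emeasure m {..t} = emeasure m {0<..t}"
    by (rule emeasure_eq_AE) auto
  then show ?thesis using emeasure_slope_Ioc[OF t] by simp
qed

lemma emeasure_slope_UNIV: "emeasure m UNIV = ennreal (a 1 - a 0)"
proof -
  have "AE x in m. x \<in> UNIV \<longleftrightarrow> x \<in> {..1}"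
    using AE_slope_measure by eventually_elim auto
  then have "emeasure m UNIV = emeasure m {..1}"
    by (rule emeasure_eq_AE) auto
  then show ?thesis using emeasure_slope_atMost[of 1] by simp
qed

lemma finite_slope_measure: "finite_measure m"
  by (rule finite_measureI) (simp add: emeasure_slope_UNIV)

lemma radon01_slope_measure: "radon01 m"
  unfolding radon01_def
  using slope_measure_outside finite_measure.emeasure_finite[OF finite_slope_measure]
  by (auto simp: less_top)

end

section \<open>Integration by parts against Stieltjes measures\<close>

text \<open>\<open>W\<close> is Lipschitz on the unit interval with derivative \<open>b\<close>
  almost everywhere. The integral formulation covers functions such as \<open>\<phi>\<close> that
  may have corners, and boundedness of \<open>b\<close> is what Fubini uses.\<close>

definition primitive :: "(real \<Rightarrow> real) \<Rightarrow> (real \<Rightarrow> real) \<Rightarrow> bool" where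
  "primitive W b \<longleftrightarrow> b \<in> borel_measurable borel \<and> (\<exists>K. \<forall>t\<in>{0..1}. \<bar>b t\<bar> \<le> K) \<and>
     (\<forall>x\<in>{0..1}. W 1 - W x = integral {x..1} b)"

lemma primitiveE:
  assumes "primitive W b"
  obtains K where "b \<in> borel_measurable borel" "0 \<le> K" "\<And>t. t \<in> {0..1} \<Longrightarrow> \<bar>b t\<bar> \<le> K"
    "\<And>x. x \<in> {0..1} \<Longrightarrow> W 1 - W x = integral {x..1} b"
proof -
  from assms obtain K where K: "b \<in> borel_measurable borel" "\<forall>t\<in>{0..1}. \<bar>b t\<bar> \<le> K"
    "\<forall>x\<in>{0..1}. W 1 - W x = integral {x..1} b"
    unfolding primitive_def by blast
  show thesis
    by (rule that[of "\<bar>K\<bar>"]) (use K in fastforce)+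
qed

lemma bounded_set_integrable:
  fixes b :: "real \<Rightarrow> real"
  assumes "b \<in> borel_measurable borel" "\<And>t. t \<in> {0..1} \<Longrightarrow> \<bar>b t\<bar> \<le> K" "{x..y} \<subseteq> {0..1}"
  shows "set_integrable lborel {x..y} b"
proof (rule set_integrable_bound[of _ _ "\<lambda>_. K"])
  show "set_integrable lborel {x..y} (\<lambda>_. K)"
    by (intro borel_integrable_atLeastAtMost' continuous_on_const)
  show "set_borel_measurable lborel {x..y} b"
    using assms(1) unfolding set_borel_measurable_def by measurable
  have "norm (b z) \<le> norm K" if "z \<in> {x..y}" for z
    using assms(2)[of z] assms(3) that by auto
  then show "AE z in lborel. z \<in> {x..y} \<longrightarrow> norm (b z) \<le> norm K"
    by simp
qed

lemma primitive_set_integrable: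
  "primitive W b \<Longrightarrow> {x..y} \<subseteq> {0..1} \<Longrightarrow> set_integrable lborel {x..y} b"
  by (erule primitiveE) (blast intro: bounded_set_integrable)

lemma primitive_integrable: "primitive W b \<Longrightarrow> {x..y} \<subseteq> {0..1} \<Longrightarrow> b integrable_on {x..y}"
  using primitive_set_integrable set_borel_integral_eq_integral(1) by blast

lemma primitive_integral:
  assumes "primitive W b" "0 \<le> x" "x \<le> y" "y \<le> 1"
  shows "integral {x..y} b = W y - W x"
proof -
  have "integral {x..y} b + integral {y..1} b = integral {x..1} b"
    by (rule Henstock_Kurzweil_Integration.integral_combine)
       (use assms in \<open>auto intro!: primitive_integrable[OF assms(1)]\<close>)
  moreover have "W 1 - W x = integral {x..1} b" "W 1 - W y = integral {y..1} b"
    using assms unfolding primitive_def by auto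
  ultimately show ?thesis by linarith
qed

text \<open>The indicator turns a derivative known only on the unit interval into a Borel function
  on the line.\<close>

lemma primitive_of_C1:
  assumes "\<And>x. x \<in> {0..1} \<Longrightarrow> (W has_real_derivative b x) (at x within {0..1})"
    and "continuous_on {0..1} b"
  shows "primitive W (\<lambda>x. indicator {0..1} x * b x)"
  unfolding primitive_def
proof (intro conjI ballI)
  show "(\<lambda>x. indicator {0..1} x * b x) \<in> borel_measurable borel"
    using borel_measurable_continuous_on_indicator[OF _ assms(2)] by simp
  have "bounded (b ` {0..1})"
    by (intro compact_imp_bounded compact_continuous_image assms) auto
  then obtain K where "\<forall>t\<in>{0..1}. \<bar>b t\<bar> \<le> K" by (auto simp: bounded_iff)
  then show "\<exists>K. \<forall>t\<in>{0..1}. \<bar>indicator {0..1} t * b t\<bar> \<le> K"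
    by (intro exI[of _ K]) simp
  fix x :: real assume x: "x \<in> {0..1}"
  have "(b has_integral (W 1 - W x)) {x..1}"
    by (rule fundamental_theorem_of_calculus)
       (use x in \<open>auto simp flip: has_real_derivative_iff_has_vector_derivative
          intro!: has_field_derivative_subset[OF assms(1)]\<close>)
  then have "((\<lambda>t. indicator {0..1} t * b t) has_integral (W 1 - W x)) {x..1}"
    by (rule has_integral_eq[rotated]) (use x in auto)
  then show "W 1 - W x = integral {x..1} (\<lambda>t. indicator {0..1} t * b t)"
    by (simp add: integral_unique)
qed

lemma primitive_diff:
  assumes "primitive V b" "primitive W c"
  shows "primitive (\<lambda>x. V x - W x) (\<lambda>x. b x - c x)"
proof -
  from assms(1) obtain K where K: "b \<in> borel_measurable borel" "\<And>t. t \<in> {0..1} \<Longrightarrow> \<bar>b t\<bar> \<le> K"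
    "\<And>x. x \<in> {0..1} \<Longrightarrow> V 1 - V x = integral {x..1} b" by (rule primitiveE) blast
  from assms(2) obtain L where L: "c \<in> borel_measurable borel" "\<And>t. t \<in> {0..1} \<Longrightarrow> \<bar>c t\<bar> \<le> L"
    "\<And>x. x \<in> {0..1} \<Longrightarrow> W 1 - W x = integral {x..1} c" by (rule primitiveE) blast
  show ?thesis
    unfolding primitive_def
  proof (intro conjI ballI exI[of _ "K + L"])
    show "(\<lambda>x. b x - c x) \<in> borel_measurable borel" using K(1) L(1) by measurable
    show "\<bar>b t - c t\<bar> \<le> K + L" if "t \<in> {0..1}" for t
      using K(2)[OF that] L(2)[OF that] by linarith
    show "V 1 - W 1 - (V x - W x) = integral {x..1} (\<lambda>x. b x - c x)" if "x \<in> {0..1}" for x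
      using K(3)[OF that] L(3)[OF that] that
      by (subst integral_diff) (auto intro!: primitive_integrable[OF assms(1)] primitive_integrable[OF assms(2)])
  qed
qed

lemma primitive_uminus: "primitive W b \<Longrightarrow> primitive (\<lambda>x. - W x) (\<lambda>x. - b x)"
  using primitive_diff[of "\<lambda>_. 0" "\<lambda>_. 0" W b] by (simp add: primitive_def[of "\<lambda>_. 0"] exI[of _ 0])

text \<open>The kernel lives on \<open>s \<le> t\<close>: integrated in \<open>t\<close> it gives
  \<open>w s * (W 1 - W s)\<close>, integrated in \<open>s\<close> it gives \<open>b t\<close> times
  the weighted mass of \<open>{..t}\<close>. A bounded function on a product of finite mass is
  integrable.\<close>

lemma fubini_weight:
  fixes M :: "real measure" and b w :: "real \<Rightarrow> real"
  assumes fin: "finite_measure M" and sM[measurable_cong]: "sets M = sets borel"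
    and [measurable]: "b \<in> borel_measurable borel" "w \<in> borel_measurable borel"
    and K: "\<forall>t\<in>{0..1}. \<bar>b t\<bar> \<le> K" and L: "\<And>s. \<bar>w s\<bar> \<le> L"
  defines "F \<equiv> \<lambda>s t. (if t \<in> {0..1} \<and> s \<le> t then w s * b t else 0)"
  shows "(\<integral>s. (\<integral>t. F s t \<partial>lborel) \<partial>M) = (\<integral>t. (\<integral>s. F s t \<partial>M) \<partial>lborel)"
    and "integrable M (\<lambda>s. \<integral>t. F s t \<partial>lborel)"
    and "integrable lborel (\<lambda>t. \<integral>s. F s t \<partial>M)"
proof -
  interpret M: finite_measure M by fact
  interpret P: pair_sigma_finite M lborel ..
  have spM: "space M = UNIV" using sets_eq_imp_space_eq[OF sM] by simp
  have [measurable]: "case_prod F \<in> borel_measurable (M \<Otimes>\<^sub>M lborel)"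
    unfolding F_def split_beta' by measurable
  have int: "integrable (M \<Otimes>\<^sub>M lborel) (case_prod F)"
  proof (rule Bochner_Integration.integrable_bound)
    show "integrable (M \<Otimes>\<^sub>M lborel) (\<lambda>x. (L * K) * indicator (UNIV \<times> {0..1::real}) x)"
    proof (intro integrable_mult_right integrable_real_indicator)
      have "emeasure (M \<Otimes>\<^sub>M lborel) (UNIV \<times> {0..1::real}) = emeasure M UNIV * emeasure lborel {0..1::real}"
        by (rule lborel.emeasure_pair_measure_Times) (simp_all add: sM)
      also have "\<dots> < \<infinity>" by (simp add: less_top[symmetric])
      finally show "emeasure (M \<Otimes>\<^sub>M lborel) (UNIV \<times> {0..1::real}) < \<infinity>" .
    qed (simp add: sM)
    have "norm (case_prod F x) \<le> norm (L * K * indicator (UNIV \<times> {0..1::real}) x)" for x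
    proof (cases x)
      case (Pair s t)
      have "\<bar>w s * b t\<bar> \<le> \<bar>L * K\<bar>" if "t \<in> {0..1}"
        using L[of s] bspec[OF K that] unfolding abs_mult by (intro mult_mono) auto
      then show ?thesis using Pair by (auto simp: F_def indicator_def)
    qed
    then show "AE x in M \<Otimes>\<^sub>M lborel. norm (case_prod F x) \<le> norm (L * K * indicator (UNIV \<times> {0..1::real}) x)"
      by simp
  qed simp
  show "(\<integral>s. (\<integral>t. F s t \<partial>lborel) \<partial>M) = (\<integral>t. (\<integral>s. F s t \<partial>M) \<partial>lborel)"
    using P.Fubini_integral[OF int] by simp
  show "integrable M (\<lambda>s. \<integral>t. F s t \<partial>lborel)"
    using P.integrable_fst[OF int] by simp
  show "integrable lborel (\<lambda>t. \<integral>s. F s t \<partial>M)"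
    using P.integrable_snd[OF int] by simp
qed

text \<open>Insert \<open>W s = W 1 - integral {s..1} b\<close> and exchange the integrals. The
  weight lets one lemma serve twice: Lebesgue measure with a derivative as weight, and a Stieltjes
  measure with the indicator of the open interval.\<close>

lemma integral_weight_primitive:
  fixes M :: "real measure" and w :: "real \<Rightarrow> real"
  assumes fin: "finite_measure M" and sM[measurable_cong]: "sets M = sets borel"
    and prim: "primitive W b"
    and w[measurable]: "w \<in> borel_measurable borel" and L: "\<And>s. \<bar>w s\<bar> \<le> L"
    and w0: "\<And>s. s \<notin> {0..1} \<Longrightarrow> w s = 0"
  shows "(\<integral>s. w s * W s \<partial>M) = W 1 * (\<integral>s. w s \<partial>M) - integral {0..1} (\<lambda>t. b t * (\<integral>s. w s * indicator {..t} s \<partial>M))"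
    and "integrable M (\<lambda>s. w s * W s)"
proof -
  interpret M: finite_measure M by fact
  from prim obtain K where b[measurable]: "b \<in> borel_measurable borel" and K: "\<forall>t\<in>{0..1}. \<bar>b t\<bar> \<le> K"
    and W: "\<And>x. x \<in> {0..1} \<Longrightarrow> W 1 - W x = integral {x..1} b" by (rule primitiveE) blast
  define F where "F = (\<lambda>s t. (if t \<in> {0..1} \<and> s \<le> t then w s * b t else 0))"
  have fub: "(\<integral>s. (\<integral>t. F s t \<partial>lborel) \<partial>M) = (\<integral>t. (\<integral>s. F s t \<partial>M) \<partial>lborel)"
    "integrable M (\<lambda>s. \<integral>t. F s t \<partial>lborel)" "integrable lborel (\<lambda>t. \<integral>s. F s t \<partial>M)"
    unfolding F_def using fubini_weight[OF fin sM b w K L] by blast+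
  have inner: "(\<integral>t. F s t \<partial>lborel) = w s * (W 1 - W s)" for s
  proof (cases "s \<in> {0..1}")
    case True
    have "(\<integral>t. F s t \<partial>lborel) = (\<integral>t. w s * (indicator {s..1} t *\<^sub>R b t) \<partial>lborel)"
      by (rule Bochner_Integration.integral_cong) (use True in \<open>auto simp: F_def indicator_def\<close>)
    also have "\<dots> = w s * (LINT t:{s..1}|lborel. b t)"
      by (simp add: set_lebesgue_integral_def)
    also have "(LINT t:{s..1}|lborel. b t) = integral {s..1} b"
      by (rule set_borel_integral_eq_integral) (use True in \<open>auto intro!: primitive_set_integrable[OF prim]\<close>)
    finally show ?thesis using W[OF True] by simp
  next
    case False
    then have "F s = (\<lambda>_. 0)" using w0[OF False] by (simp add: F_def fun_eq_iff)
    then show ?thesis using False by (simp add: w0)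
  qed
  have outer: "(\<integral>s. F s t \<partial>M) = indicator {0..1} t *\<^sub>R (b t * (\<integral>s. w s * indicator {..t} s \<partial>M))" for t
  proof (cases "t \<in> {0..1}")
    case True
    have "(\<integral>s. F s t \<partial>M) = (\<integral>s. b t * (w s * indicator {..t} s) \<partial>M)"
      by (rule Bochner_Integration.integral_cong) (use True in \<open>auto simp: F_def indicator_def\<close>)
    then show ?thesis using True by simp
  next
    case False
    then have "(\<lambda>s. F s t) = (\<lambda>_. 0)" by (auto simp: F_def fun_eq_iff)
    then show ?thesis using False by simp
  qed
  have iw: "integrable M w"
    by (rule M.integrable_const_bound[of _ L]) (use L in auto)
  have i1: "integrable M (\<lambda>s. w s * (W 1 - W s))" using fub(2) unfolding inner .
  have "integrable M (\<lambda>s. W 1 * w s - w s * (W 1 - W s))"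
    using i1 iw by simp
  then show "integrable M (\<lambda>s. w s * W s)" by (simp add: algebra_simps)
  have "(\<integral>s. w s * W s \<partial>M) = (\<integral>s. W 1 * w s - w s * (W 1 - W s) \<partial>M)"
    by (simp add: algebra_simps)
  also have "\<dots> = W 1 * (\<integral>s. w s \<partial>M) - (\<integral>s. w s * (W 1 - W s) \<partial>M)"
    using i1 iw by simp
  also have "(\<integral>s. w s * (W 1 - W s) \<partial>M) = (LINT t:{0..1}|lborel. b t * (\<integral>s. w s * indicator {..t} s \<partial>M))"
    using fub(1) unfolding inner outer set_lebesgue_integral_def .
  also have "\<dots> = integral {0..1} (\<lambda>t. b t * (\<integral>s. w s * indicator {..t} s \<partial>M))"
    by (rule set_borel_integral_eq_integral) (use fub(3) in \<open>simp add: outer set_integrable_def\<close>)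
  finally show "(\<integral>s. w s * W s \<partial>M) = W 1 * (\<integral>s. w s \<partial>M) - integral {0..1} (\<lambda>t. b t * (\<integral>s. w s * indicator {..t} s \<partial>M))" .
qed

lemma primitive_integrable_mult:
  assumes "primitive V b" "primitive W c"
  shows "(\<lambda>t. b t * W t) integrable_on {0..1}" "(\<lambda>t. b t * c t) integrable_on {0..1}"
proof -
  from assms(1) obtain K where K: "b \<in> borel_measurable borel" "0 \<le> K" "\<And>t. t \<in> {0..1} \<Longrightarrow> \<bar>b t\<bar> \<le> K"
    by (rule primitiveE) blast
  from assms(2) obtain L where L: "c \<in> borel_measurable borel" "0 \<le> L" "\<And>t. t \<in> {0..1} \<Longrightarrow> \<bar>c t\<bar> \<le> L"
    and W: "\<And>x. x \<in> {0..1} \<Longrightarrow> W 1 - W x = integral {x..1} c" by (rule primitiveE) blast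
  have "set_integrable lborel {0..1} (\<lambda>t. b t * c t)"
    by (rule bounded_set_integrable[of _ "K * L"])
       (use K L in \<open>auto simp: abs_mult intro!: mult_mono\<close>)
  then show "(\<lambda>t. b t * c t) integrable_on {0..1}" by (rule set_borel_integral_eq_integral)
  have cont: "continuous_on {0..1} W"
  proof -
    have "continuous_on {0..1} (\<lambda>x. integral {x..1} c)"
      by (rule indefinite_integral_continuous_1') (auto intro!: primitive_integrable[OF assms(2)])
    then have "continuous_on {0..1} (\<lambda>x. W 1 - integral {x..1} c)"
      by (intro continuous_intros)
    then show ?thesis
      by (rule continuous_on_cong[THEN iffD1, rotated 2]) (use W in \<open>auto simp: algebra_simps\<close>)
  qed
  then have m: "(\<lambda>x. indicator {0..1} x * W x) \<in> borel_measurable borel"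
    using borel_measurable_continuous_on_indicator[OF _ cont] by simp
  have "bounded (W ` {0..1})"
    by (intro compact_imp_bounded compact_continuous_image cont) auto
  then obtain N where N: "\<And>t. t \<in> {0..1} \<Longrightarrow> \<bar>W t\<bar> \<le> N"
    unfolding bounded_iff real_norm_def by blast
  have "set_integrable lborel {0..1} (\<lambda>t. b t * (indicator {0..1} t * W t))"
    by (rule bounded_set_integrable[of _ "K * N"])
       (use K m N in \<open>auto simp: abs_mult intro!: mult_mono\<close>)
  then have "(\<lambda>t. b t * (indicator {0..1} t * W t)) integrable_on {0..1}"
    by (rule set_borel_integral_eq_integral)
  then show "(\<lambda>t. b t * W t) integrable_on {0..1}"
    by (rule integrable_eq) simp
qed

text \<open>Neither factor need be differentiable everywhere, so the formula comes from Fubini: with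
  Lebesgue measure on the unit interval and weight \<open>q\<close>, the cumulative weight up to
  \<open>t\<close> is \<open>V t - V 0\<close>.\<close>

lemma primitive_by_parts:
  assumes V: "primitive V q" and W: "primitive W b"
  shows "integral {0..1} (\<lambda>t. q t * W t) = V 1 * W 1 - V 0 * W 0 - integral {0..1} (\<lambda>t. b t * V t)"
proof -
  from V obtain L where q[measurable]: "q \<in> borel_measurable borel" and L: "0 \<le> L" "\<And>t. t \<in> {0..1} \<Longrightarrow> \<bar>q t\<bar> \<le> L"
    by (rule primitiveE) blast
  define M where "M = density lborel (indicator {0..1::real})"
  define w where "w = (\<lambda>s. indicator {0..1} s * q s)"
  have [measurable]: "w \<in> borel_measurable borel" unfolding w_def by measurable
  have fin: "finite_measure M"
    by (rule finite_measureI) (simp add: M_def emeasure_restricted)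
  have wM: "(\<integral>s. w s * g s \<partial>M) = (\<integral>s. w s * g s \<partial>lborel)" if "(\<lambda>s. w s * g s) \<in> borel_measurable borel" for g
  proof -
    have "M = density lborel (\<lambda>s. ennreal (indicator {0..1} s))"
      by (simp add: M_def ennreal_indicator)
    then have "(\<integral>s. w s * g s \<partial>M) = (\<integral>s. indicator {0..1} s *\<^sub>R (w s * g s) \<partial>lborel)"
      using that by (simp add: integral_density)
    also have "\<dots> = (\<integral>s. w s * g s \<partial>lborel)"
      by (rule Bochner_Integration.integral_cong) (auto simp: w_def indicator_def)
    finally show ?thesis .
  qed
  note wp = integral_weight_primitive[OF fin _ W, of w L]
  have wL: "\<bar>w s\<bar> \<le> L" for s using L by (auto simp: w_def indicator_def)
  have wp1: "(\<integral>s. w s * W s \<partial>M) = W 1 * (\<integral>s. w s \<partial>M) - integral {0..1} (\<lambda>t. b t * (\<integral>s. w s * indicator {..t} s \<partial>M))"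
    and wp2: "integrable M (\<lambda>s. w s * W s)"
    by (rule wp; use wL in \<open>simp add: M_def w_def\<close>)+
  have meas: "(\<lambda>s. w s * W s) \<in> borel_measurable borel"
    using borel_measurable_integrable[OF wp2] by (simp add: M_def)
  have part: "(\<integral>s. w s * indicator {..t} s \<partial>M) = V t - V 0" if "t \<in> {0..1}" for t
  proof -
    have "(\<integral>s. w s * indicator {..t} s \<partial>M) = (\<integral>s. w s * indicator {..t} s \<partial>lborel)"
      by (rule wM) measurable
    also have "\<dots> = (LINT s:{0..t}|lborel. q s)"
      unfolding set_lebesgue_integral_def
      by (rule Bochner_Integration.integral_cong) (use that in \<open>auto simp: w_def indicator_def\<close>)
    also have "\<dots> = integral {0..t} q"
      by (rule set_borel_integral_eq_integral) (use that in \<open>auto intro!: primitive_set_integrable[OF V]\<close>)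
    finally show ?thesis using primitive_integral[OF V, of 0 t] that by simp
  qed
  have int1: "(\<integral>s. w s \<partial>M) = V 1 - V 0"
  proof -
    have "(\<integral>s. w s \<partial>M) = (\<integral>s. w s * indicator {..1} s \<partial>M)"
      by (rule Bochner_Integration.integral_cong) (auto simp: w_def indicator_def)
    then show ?thesis using part[of 1] by simp
  qed
  have lhs: "(\<integral>s. w s * W s \<partial>M) = integral {0..1} (\<lambda>t. q t * W t)"
  proof -
    have eq: "w s * W s = indicator {0..1} s *\<^sub>R (q s * W s)" for s by (simp add: w_def)
    have "(\<integral>s. w s * W s \<partial>M) = (LINT s:{0..1}|lborel. q s * W s)"
      using wM[OF meas] unfolding set_lebesgue_integral_def eq .
    also have "\<dots> = integral {0..1} (\<lambda>t. q t * W t)"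
    proof (rule set_borel_integral_eq_integral)
      have "M = density lborel (\<lambda>s. ennreal (indicator {0..1} s))"
        by (simp add: M_def ennreal_indicator)
      then have "integrable lborel (\<lambda>s. indicator {0..1} s *\<^sub>R (w s * W s))"
        using wp2 meas by (simp add: integrable_density)
      then show "set_integrable lborel {0..1} (\<lambda>t. q t * W t)"
        unfolding set_integrable_def by (rule Bochner_Integration.integrable_cong[THEN iffD1, rotated 2])
          (auto simp: w_def indicator_def)
    qed
    finally show ?thesis .
  qed
  have "integral {0..1} (\<lambda>t. b t * (\<integral>s. w s * indicator {..t} s \<partial>M)) = integral {0..1} (\<lambda>t. b t * V t - b t * V 0)"
    by (rule integral_cong) (simp add: part algebra_simps)
  also have "\<dots> = integral {0..1} (\<lambda>t. b t * V t) - integral {0..1} b * V 0"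
    using primitive_integrable_mult(1)[OF W V] primitive_integrable[OF W, of 0 1]
    by (subst integral_diff) (auto intro!: integrable_on_mult_left)
  finally show ?thesis
    using wp1 primitive_integral[OF W, of 0 1] unfolding lhs int1 by (simp add: algebra_simps)
qed

section \<open>Test functions and distributional derivatives\<close>

lemma test_fun_support:
  assumes "test_fun \<psi>"
  shows "\<psi> 0 = 0" "\<psi> 1 = 0" "deriv \<psi> 0 = 0" "deriv \<psi> 1 = 0" "\<And>x. x \<notin> {0<..<1} \<Longrightarrow> \<psi> x = 0"
proof -
  from assms obtain a b where ab: "0 < a" "b < 1" "\<And>x. x \<notin> {a..b} \<Longrightarrow> \<psi> x = 0"
    by (auto simp: test_fun_def)
  show "\<psi> 0 = 0" "\<psi> 1 = 0" "\<And>x. x \<notin> {0<..<1} \<Longrightarrow> \<psi> x = 0" using ab by auto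
  have "deriv \<psi> x = 0" if "x < a \<or> b < x" for x
  proof -
    have "((\<lambda>_. 0) has_real_derivative 0) (at x)" by simp
    then have "(\<psi> has_real_derivative 0) (at x)"
      by (rule has_field_derivative_transform_within_open[of _ _ _ "{..<a} \<union> {b<..}"])
         (use ab that in auto)
    then show ?thesis by (rule DERIV_imp_deriv)
  qed
  then show "deriv \<psi> 0 = 0" "deriv \<psi> 1 = 0" using ab by auto
qed

lemma test_fun_primitive:
  assumes "test_fun \<psi>"
  shows "primitive \<psi> (\<lambda>x. indicator {0..1} x * deriv \<psi> x)"
    and "primitive (deriv \<psi>) (\<lambda>x. indicator {0..1} x * deriv (deriv \<psi>) x)"
proof -
  have "continuous_on {0..1} (deriv \<psi>)"
    by (intro continuous_at_imp_continuous_on ballI DERIV_isCont[OF test_fun_deriv[OF assms]])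
  then show "primitive \<psi> (\<lambda>x. indicator {0..1} x * deriv \<psi> x)"
    by (intro primitive_of_C1 has_field_derivative_at_within[OF test_fun_differentiable[OF assms]])
  have "continuous_on {0..1} (deriv (deriv \<psi>))"
    using test_fun_deriv2[OF assms] continuous_on_subset by blast
  then show "primitive (deriv \<psi>) (\<lambda>x. indicator {0..1} x * deriv (deriv \<psi>) x)"
    by (intro primitive_of_C1 has_field_derivative_at_within[OF test_fun_deriv[OF assms]])
qed

lemma weak_deriv_primitive:
  assumes "primitive W b"
  shows "weak_deriv W b"
  unfolding weak_deriv_def
proof (intro conjI allI impI)
  fix x y :: real assume "0 < x" "y < 1"
  then have "set_integrable lborel {x..y} b" by (intro primitive_set_integrable[OF assms]) auto
  then show "b absolutely_integrable_on {x..y}"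
    unfolding set_integrable_def
    using integrable_completion[OF borel_measurable_integrable] by blast
next
  fix \<psi> assume \<psi>: "test_fun \<psi>"
  have "integral {0..1} (\<lambda>x. W x * deriv \<psi> x) = integral {0..1} (\<lambda>x. indicator {0..1} x * deriv \<psi> x * W x)"
    by (rule integral_cong) simp
  then show "integral {0..1} (\<lambda>x. W x * deriv \<psi> x) = - integral {0..1} (\<lambda>x. b x * \<psi> x)"
    using primitive_by_parts[OF test_fun_primitive(1)[OF \<psi>] assms] test_fun_support[OF \<psi>] by simp
qed

context convex_bounded_slope begin

lemma primitive_slope_fun: "primitive f a"
  unfolding primitive_def using slope_fun_abs_le integral_slope_fun slope_fun_measurable by auto

text \<open>With the indicator of the open interval as weight, the cumulative mass up to
  \<open>t\<close> is \<open>a t - a 0\<close>, because the ends carry no mass.\<close>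

lemma integral_slope_measure:
  assumes W: "primitive W b"
  shows "(LINT s:{0<..<1}|m. W s) = W 1 * a 1 - W 0 * a 0 - integral {0..1} (\<lambda>t. b t * a t)"
    and "set_integrable m {0<..<1} W"
proof -
  interpret finite_measure m by (rule finite_slope_measure)
  define w where "w = (indicator {0<..<1} :: real \<Rightarrow> real)"
  have wp: "(\<integral>s. w s * W s \<partial>m) = W 1 * (\<integral>s. w s \<partial>m) - integral {0..1} (\<lambda>t. b t * (\<integral>s. w s * indicator {..t} s \<partial>m))"
    "integrable m (\<lambda>s. w s * W s)"
    by (rule integral_weight_primitive[OF finite_slope_measure _ W, of w 1];
        force simp: w_def indicator_def)+
  have part: "(\<integral>s. w s * indicator {..t} s \<partial>m) = a t - a 0" if "0 \<le> t" for t
  proof -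
    have "(\<integral>s. w s * indicator {..t} s \<partial>m) = (\<integral>s. indicator {..t} s \<partial>m)"
    proof (rule integral_cong_AE)
      show "AE s in m. w s * indicator {..t} s = indicator {..t} s"
        using AE_slope_measure by eventually_elim (simp add: w_def)
    qed (simp_all add: w_def)
    also have "\<dots> = measure m {..t}" by simp
    also have "\<dots> = a t - a 0"
      using emeasure_slope_atMost[OF that] slope_fun_mono[OF that] by (simp add: measure_def)
    finally show ?thesis .
  qed
  have int1: "(\<integral>s. w s \<partial>m) = a 1 - a 0"
  proof -
    have "(\<integral>s. w s \<partial>m) = (\<integral>s. w s * indicator {..1} s \<partial>m)"
      by (rule Bochner_Integration.integral_cong) (auto simp: w_def indicator_def)
    then show ?thesis using part[of 1] by simp
  qed
  have "integral {0..1} (\<lambda>t. b t * (\<integral>s. w s * indicator {..t} s \<partial>m)) = integral {0..1} (\<lambda>t. b t * a t - b t * a 0)"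
    by (rule integral_cong) (simp add: part algebra_simps)
  also have "\<dots> = integral {0..1} (\<lambda>t. b t * a t) - integral {0..1} b * a 0"
    using primitive_integrable_mult(2)[OF W primitive_slope_fun] primitive_integrable[OF W, of 0 1]
    by (subst integral_diff) (auto intro!: integrable_on_mult_left)
  finally have "(\<integral>s. w s * W s \<partial>m) = W 1 * a 1 - W 0 * a 0 - integral {0..1} (\<lambda>t. b t * a t)"
    using wp(1) primitive_integral[OF W, of 0 1] unfolding int1 by (simp add: algebra_simps)
  then show "(LINT s:{0<..<1}|m. W s) = W 1 * a 1 - W 0 * a 0 - integral {0..1} (\<lambda>t. b t * a t)"
    by (simp add: set_lebesgue_integral_def w_def)
  show "set_integrable m {0<..<1} W"
    using wp(2) by (simp add: set_integrable_def w_def)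
qed

text \<open>One Lebesgue and one Stieltjes integration by parts; test functions and their
  derivatives vanish at 0 and 1, which removes all boundary terms.\<close>

lemma dist_dd_slope_measure: "dist_dd_measure f m"
  unfolding dist_dd_measure_def
proof (intro conjI radon01_slope_measure allI impI)
  fix \<psi> assume \<psi>: "test_fun \<psi>"
  note s = test_fun_support[OF \<psi>]
  have "integral {0..1} (\<lambda>x. f x * deriv (deriv \<psi>) x)
      = integral {0..1} (\<lambda>x. indicator {0..1} x * deriv (deriv \<psi>) x * f x)"
    by (rule integral_cong) simp
  also have "\<dots> = - integral {0..1} (\<lambda>t. a t * deriv \<psi> t)"
    using primitive_by_parts[OF test_fun_primitive(2)[OF \<psi>] primitive_slope_fun] s by simp
  also have "\<dots> = - integral {0..1} (\<lambda>t. indicator {0..1} t * deriv \<psi> t * a t)"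
    by (intro arg_cong[of _ _ uminus] integral_cong) simp
  also have "\<dots> = (LINT s:{0<..<1}|m. \<psi> s)"
    using integral_slope_measure(1)[OF test_fun_primitive(1)[OF \<psi>]] s by simp
  also have "\<dots> = integral\<^sup>L m \<psi>"
    unfolding set_lebesgue_integral_def
    by (rule Bochner_Integration.integral_cong) (use s(5) in \<open>auto simp: indicator_def\<close>)
  finally show "integral {0..1} (\<lambda>x. f x * deriv (deriv \<psi>) x) = integral\<^sup>L m \<psi>" .
qed

end

section \<open>Lebesgue decomposition and the functional D\<close>

text \<open>Exhaustion: the union of a sequence of null sets approaching the supremum of
  \<open>\<nu>\<close> over null sets attains it. A null set with mass outside the union would
  exceed the supremum, since \<open>\<nu>\<close> is finite.\<close>

lemma maximal_null_set:
  fixes \<nu> :: "real measure"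
  assumes fin: "finite_measure \<nu>" and sets: "sets \<nu> = sets borel"
  obtains N where "N \<in> null_sets lborel"
    "\<And>A. A \<in> null_sets lborel \<Longrightarrow> emeasure \<nu> (A - N) = 0"
proof -
  interpret finite_measure \<nu> by fact
  define s where "s = (SUP A\<in>null_sets lborel. emeasure \<nu> A)"
  have ne: "emeasure \<nu> ` null_sets lborel \<noteq> {}" by blast
  obtain c :: "nat \<Rightarrow> ennreal" where c: "range c \<subseteq> emeasure \<nu> ` null_sets lborel" "s = (SUP i. c i)"
    using ennreal_Sup_countable_SUP[OF ne] unfolding s_def by blast
  then have "\<forall>i. \<exists>A. A \<in> null_sets lborel \<and> c i = emeasure \<nu> A" by blast
  from choice[OF this] obtain Ns where Ns: "\<And>i. Ns i \<in> null_sets lborel" "\<And>i. c i = emeasure \<nu> (Ns i)"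
    by blast
  define N where "N = (\<Union>i. Ns i)"
  have N: "N \<in> null_sets lborel" unfolding N_def using Ns(1) by (rule null_sets_UN)
  have sb: "A \<in> sets \<nu>" if "A \<in> null_sets lborel" for A
    using null_setsD2[OF that] by (simp add: sets)
  have sN: "s \<le> emeasure \<nu> N"
    unfolding c(2)
  proof (rule SUP_least)
    fix i
    have "emeasure \<nu> (Ns i) \<le> emeasure \<nu> N"
      by (rule emeasure_mono[OF _ sb[OF N]]) (unfold N_def, blast)
    then show "c i \<le> emeasure \<nu> N" by (simp add: Ns(2))
  qed
  show thesis
  proof (rule that[OF N])
    fix A :: "real set" assume A: "A \<in> null_sets lborel"
    have "emeasure \<nu> N + emeasure \<nu> (A - N) = emeasure \<nu> (N \<union> (A - N))"
      by (rule plus_emeasure) (use sb[OF A] sb[OF N] in blast)+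
    also have "\<dots> = emeasure \<nu> (N \<union> A)" by (simp only: Un_Diff_cancel)
    also have "\<dots> \<le> s"
      unfolding s_def by (rule SUP_upper) (rule null_sets.Un[OF N A])
    also note sN
    finally have "emeasure \<nu> N + emeasure \<nu> (A - N) \<le> emeasure \<nu> N + 0"
      by (simp only: add_0_right)
    then have "emeasure \<nu> (A - N) \<le> 0"
      unfolding ennreal_add_left_cancel_le using emeasure_finite[of N] by (simp only: infinity_ennreal_def) blast
    then show "emeasure \<nu> (A - N) = 0" by (simp only: le_zero_eq)
  qed
qed

text \<open>Off the maximal null set \<open>\<nu>\<close> is absolutely continuous, and
  Radon-Nikodym applies. Finiteness of \<open>\<nu>\<close> makes the density finite almost
  everywhere, so passing to reals by \<open>enn2real\<close> changes nothing in measure.\<close>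

lemma ac_density_exists:
  assumes fin: "finite_measure \<nu>" and sets: "sets \<nu> = sets borel"
  shows "\<exists>d. ac_density \<nu> d"
proof -
  interpret finite_measure \<nu> by fact
  have sp: "space \<nu> = UNIV" using sets_eq_imp_space_eq[OF sets] by simp
  obtain N where N: "N \<in> null_sets lborel"
    "\<And>A. A \<in> null_sets lborel \<Longrightarrow> emeasure \<nu> (A - N) = 0"
    using maximal_null_set[OF assms] by blast
  have Nb: "N \<in> sets borel" using N(1) by (auto dest: null_setsD2)
  define \<rho> where "\<rho> = density \<nu> (indicator (- N))"
  have \<rho>: "emeasure \<rho> A = emeasure \<nu> (A - N)" if "A \<in> sets borel" for A
    unfolding \<rho>_def using that Nb
    by (subst emeasure_restricted) (auto simp: sets intro!: arg_cong[of _ _ "emeasure \<nu>"])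
  have s\<rho>: "sets \<rho> = sets borel" by (simp add: \<rho>_def sets)
  have "absolutely_continuous lborel \<rho>"
    unfolding absolutely_continuous_def
  proof
    fix A :: "real set" assume A: "A \<in> null_sets lborel"
    then have "A \<in> sets borel" by (auto dest: null_setsD2)
    then show "A \<in> null_sets \<rho>" using \<rho>[of A] N(2)[OF A] s\<rho> by auto
  qed
  then obtain f where f[measurable]: "f \<in> borel_measurable lborel" and fd: "density lborel f = \<rho>"
    using sigma_finite_measure.Radon_Nikodym[OF sigma_finite_lborel, of \<rho>] s\<rho> by auto
  have "(\<integral>\<^sup>+x. f x \<partial>lborel) = emeasure \<rho> UNIV"
    unfolding fd[symmetric] by (simp add: emeasure_density)
  also have "\<dots> < \<infinity>" using \<rho>[of UNIV] by (simp add: less_top[symmetric])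
  finally have "AE x in lborel. f x \<noteq> \<infinity>"
    by (intro nn_integral_PInf_AE) (auto simp: less_top[symmetric])
  then have "AE x in lborel. ennreal (enn2real (f x)) = f x"
    by eventually_elim (simp add: less_top[symmetric])
  then have dd: "density lborel (\<lambda>x. ennreal (enn2real (f x))) = \<rho>"
    unfolding fd[symmetric] by (intro density_cong) auto
  have dec: "emeasure \<nu> A = emeasure \<rho> A + emeasure \<nu> (A \<inter> N)" if A: "A \<in> sets borel" for A
  proof -
    have "emeasure \<nu> (A - N) + emeasure \<nu> (A \<inter> N) = emeasure \<nu> ((A - N) \<union> (A \<inter> N))"
      by (rule plus_emeasure) (use A Nb sets in auto)
    also have "(A - N) \<union> (A \<inter> N) = A" by blast
    finally show ?thesis using \<rho>[OF A] by simp
  qed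
  have "ac_density \<nu> (\<lambda>x. enn2real (f x))"
    unfolding ac_density_def dd
  proof (intro conjI bexI[of _ N] ballI)
    show "(\<lambda>x. enn2real (f x)) \<in> borel_measurable borel" by simp
  qed (use Nb null_setsD1[OF N(1)] dec in \<open>blast intro: enn2real_nonneg\<close>)+
  then show ?thesis by blast
qed

lemma dist_dd_measure_unique: "dist_dd_measure f \<mu> \<Longrightarrow> dist_dd_measure f \<nu> \<Longrightarrow> \<mu> = \<nu>"
  unfolding dist_dd_measure_def by (intro radon01_eqI) auto

text \<open>The choice operator only promises a density of some measure representing the second
  derivative; uniqueness of that measure identifies it with the given \<open>\<nu>\<close>.\<close>

lemma Dfun_eq:
  assumes \<nu>: "dist_dd_measure f \<nu>" and ex: "\<exists>d. ac_density \<nu> d"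
  obtains d where "ac_density \<nu> d" "Dfun f = 2 * (\<integral>\<^sup>+ x\<in>{0<..<1}. ennreal (sqrt (d x)) \<partial>lborel)"
proof -
  define d where "d = (SOME d. \<exists>\<nu>. dist_dd_measure f \<nu> \<and> ac_density \<nu> d)"
  have "\<exists>\<nu>. dist_dd_measure f \<nu> \<and> ac_density \<nu> d"
    unfolding d_def by (rule someI_ex[of "\<lambda>d. \<exists>\<nu>. dist_dd_measure f \<nu> \<and> ac_density \<nu> d"]) (use assms in blast)
  then have "ac_density \<nu> d" using dist_dd_measure_unique[OF \<nu>] by blast
  then show thesis
    by (rule that) (simp add: Dfun_def d_def Let_def)
qed

text \<open>A measure with a Lebesgue density does not charge the null set carrying the singular
  part, so both densities define the same measure.\<close>

lemma ac_density_unique: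
  assumes d: "ac_density (density lborel (\<lambda>x. ennreal (v x))) d"
    and v[measurable]: "v \<in> borel_measurable borel" and v0: "\<And>x. 0 \<le> v x"
  shows "AE x in lborel. d x = v x"
proof -
  from d obtain N where [measurable]: "d \<in> borel_measurable borel" and d0: "\<And>x. 0 \<le> d x"
    and N: "N \<in> sets borel" "emeasure lborel N = 0"
    and dec: "\<And>A. A \<in> sets borel \<Longrightarrow> emeasure (density lborel (\<lambda>x. ennreal (v x))) A =
      emeasure (density lborel (\<lambda>x. ennreal (d x))) A + emeasure (density lborel (\<lambda>x. ennreal (v x))) (A \<inter> N)"
    unfolding ac_density_def by blast
  have Nn: "N \<in> null_sets lborel" using N by auto
  have "density lborel (\<lambda>x. ennreal (v x)) = density lborel (\<lambda>x. ennreal (d x))"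
  proof (rule measure_eqI)
    fix A assume "A \<in> sets (density lborel (\<lambda>x. ennreal (v x)))"
    then have A: "A \<in> sets borel" by simp
    have "A \<inter> N \<in> null_sets lborel"
      by (rule null_sets_subset[OF Nn]) (use A N in auto)
    then have "A \<inter> N \<in> null_sets (density lborel (\<lambda>x. ennreal (v x)))"
      using AE_not_in[OF \<open>A \<inter> N \<in> null_sets lborel\<close>] A N(1)
      by (simp add: null_sets_density_iff) (auto elim!: eventually_mono)
    then show "emeasure (density lborel (\<lambda>x. ennreal (v x))) A = emeasure (density lborel (\<lambda>x. ennreal (d x))) A"
      using dec[OF A] by (simp add: null_setsD1)
  qed simp
  then have "AE x in lborel. ennreal (v x) = ennreal (d x)"
    by (subst (asm) sigma_finite_measure.density_unique_iff[OF sigma_finite_lborel]) auto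
  then show ?thesis
    by eventually_elim (use d0 v0 in \<open>simp add: ennreal_inj\<close>)
qed

section \<open>The model and the constraint set of the primal problem\<close>

text \<open>The radius of convergence exceeds 1, so termwise differentiation is valid in a
  neighbourhood of the whole closed interval. The third derivative controls the growth of
  \<open>\<xi>''\<close>, and the fourth yields continuity of the third. The series starts at the
  square, hence \<open>\<xi>'(0) = 0\<close>.\<close>

lemma is_model_derivatives:
  assumes "is_model \<beta>"
  shows "\<exists>X3 X4. (\<forall>x\<in>{0..1}. (xi \<beta> has_real_derivative deriv (xi \<beta>) x) (at x) \<and>
      (deriv (xi \<beta>) has_real_derivative deriv (deriv (xi \<beta>)) x) (at x) \<and>
      (deriv (deriv (xi \<beta>)) has_real_derivative X3 x) (at x) \<and>
      (X3 has_real_derivative X4 x) (at x) \<and> 0 \<le> deriv (deriv (xi \<beta>)) x \<and> 0 \<le> X3 x) \<and>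
    deriv (xi \<beta>) 0 = 0"
proof -
  define c where "c p = (if 2 \<le> p then (\<beta> p)\<^sup>2 else 0)" for p :: nat
  define S where "S c = (\<lambda>x::real. \<Sum>n. c n * x ^ n)" for c :: "nat \<Rightarrow> real"
  have xi: "xi \<beta> = S c"
    unfolding xi_def S_def c_def by (intro ext suminf_cong) auto
  from assms obtain e where e: "e > 0" "summable (\<lambda>p. c p * (1 + e) ^ p)"
    unfolding is_model_def c_def by (auto simp: if_distrib[of "\<lambda>u. u * _"] cong: if_cong)
  define K where "K = 1 + e"
  have K: "K > 1" using e by (simp add: K_def)
  have s0: "\<And>z. norm z < K \<Longrightarrow> summable (\<lambda>n. c n * z ^ n)"
    using powser_inside[OF e(2)] e(1) by (simp add: K_def)
  have step: "(\<And>z. norm z < K \<Longrightarrow> summable (\<lambda>n. diffs d n * z ^ n))"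
    "\<And>z. norm z < K \<Longrightarrow> (S d has_real_derivative S (diffs d) z) (at z)"
    if "\<And>z. norm z < K \<Longrightarrow> summable (\<lambda>n. d n * z ^ n)" for d :: "nat \<Rightarrow> real"
    using termdiff_converges[OF _ that] termdiffs_strong'[OF that] unfolding S_def by blast+
  note s1 = step(1)[OF s0] note s2 = step(1)[OF s1] note s3 = step(1)[OF s2]
  have d0: "deriv (xi \<beta>) z = S (diffs c) z" if "norm z < K" for z
    using step(2)[OF s0 that] unfolding xi by (simp add: DERIV_imp_deriv)
  have dd: "(deriv (xi \<beta>) has_real_derivative S (diffs (diffs c)) z) (at z)" if "norm z < K" for z
    by (rule has_field_derivative_transform_within_open[OF step(2)[OF s1 that], of "ball 0 K"])
       (use that d0 in auto)
  have d1: "deriv (deriv (xi \<beta>)) z = S (diffs (diffs c)) z" if "norm z < K" for z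
    using dd[OF that] by (rule DERIV_imp_deriv)
  have ddd: "(deriv (deriv (xi \<beta>)) has_real_derivative S (diffs (diffs (diffs c))) z) (at z)" if "norm z < K" for z
    by (rule has_field_derivative_transform_within_open[OF step(2)[OF s2 that], of "ball 0 K"])
       (use that d1 in auto)
  have K1: "norm x < K" if "x \<in> {0..1}" for x :: real using that K by auto
  have c0: "0 \<le> c n" "0 \<le> diffs (diffs c) n" "0 \<le> diffs (diffs (diffs c)) n" for n
    by (simp_all add: c_def diffs_def)
  show ?thesis
  proof (rule exI[of _ "S (diffs (diffs (diffs c)))"], rule exI[of _ "S (diffs (diffs (diffs (diffs c))))"],
      intro conjI ballI)
    fix x :: real assume x: "x \<in> {0..1}"
    note k = K1[OF x]
    show "(xi \<beta> has_real_derivative deriv (xi \<beta>) x) (at x)"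
      using step(2)[OF s0 k] d0[OF k] unfolding xi by simp
    show "(deriv (xi \<beta>) has_real_derivative deriv (deriv (xi \<beta>)) x) (at x)"
      using dd[OF k] d1[OF k] by simp
    show "(deriv (deriv (xi \<beta>)) has_real_derivative S (diffs (diffs (diffs c))) x) (at x)"
      by (rule ddd[OF k])
    show "(S (diffs (diffs (diffs c))) has_real_derivative S (diffs (diffs (diffs (diffs c)))) x) (at x)"
      by (rule step(2)[OF s3 k])
    show "0 \<le> deriv (deriv (xi \<beta>)) x"
      unfolding d1[OF k] S_def using x c0 by (intro suminf_nonneg s2 k) auto
    show "0 \<le> S (diffs (diffs (diffs c))) x"
      unfolding S_def using x c0 by (intro suminf_nonneg s3 k) auto
  next
    have "deriv (xi \<beta>) 0 = S (diffs c) 0" using d0[of 0] K by simp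
    then show "deriv (xi \<beta>) 0 = 0"
      unfolding S_def powser_zero by (simp add: diffs_def c_def)
  qed
qed

section \<open>Concave competitors and their tangent extensions\<close>

lemma concave_chord_mono:
  fixes f :: "real \<Rightarrow> real"
  assumes "concave_on {0..1} f" "0 \<le> x" "x < y" "y < z" "z \<le> 1"
  shows "(f z - f y) / (z - y) \<le> (f y - f x) / (y - x)"
proof -
  have conv: "convex_on {0..1} (\<lambda>x. - f x)" using assms(1) by (simp add: concave_on_def)
  have "(- f x - - f y) / (x - y) \<le> (- f y - - f z) / (y - z)"
    using convex_on_slope_le[OF conv, of x z y] assms by simp
  moreover have "(- f x - - f y) / (x - y) = - ((f y - f x) / (y - x))"
    "(- f y - - f z) / (y - z) = - ((f z - f y) / (z - y))"
    using assms by (simp_all add: field_simps)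
  ultimately show ?thesis by linarith
qed

text \<open>\<open>r\<close> is the right derivative of \<open>\<phi>\<close> at the interior point
  \<open>s\<close>, finite because chords from the left bound it. The new function stays above
  \<open>\<phi>\<close>, hence nonnegative, and its slopes still decrease.\<close>

lemma Cset_tangent_extension:
  assumes C: "Cset \<phi>" and s: "0 < s" "s < 1"
  obtains r where "Cset (\<lambda>t. if t \<le> s then \<phi> t else \<phi> s + r * (t - s))" "r \<le> 0"
    "\<And>t. t \<in> {0..1} \<Longrightarrow> \<phi> t \<le> \<phi> s + r * (t - s)"
proof -
  have conc: "concave_on {0..1} \<phi>" and cont: "continuous_on {0..1} \<phi>"
    and nonneg: "\<And>x. x \<in> {0..1} \<Longrightarrow> 0 \<le> \<phi> x"
    and anti: "\<And>x y. x \<in> {0..1} \<Longrightarrow> y \<in> {0..1} \<Longrightarrow> x \<le> y \<Longrightarrow> \<phi> y \<le> \<phi> x"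
    using C unfolding Cset_def by blast+
  let ?c = "\<lambda>x y. (\<phi> y - \<phi> x) / (y - x)"
  have chord: "?c s y \<le> ?c x s" if "0 \<le> x" "x < s" "s < y" "y \<le> 1" for x y
    using concave_chord_mono[OF conc] that by blast
  define r where "r = (SUP y\<in>{s<..1}. ?c s y)"
  have bdd: "bdd_above (?c s ` {s<..1})"
    by (rule bdd_aboveI2[of _ _ "?c 0 s"]) (use chord[of 0] s in auto)
  have r_ge: "?c s y \<le> r" if "s < y" "y \<le> 1" for y
    unfolding r_def by (rule cSUP_upper[OF _ bdd]) (use that in auto)
  have r_le: "r \<le> ?c x s" if "0 \<le> x" "x < s" for x
    unfolding r_def by (rule cSUP_least) (use chord that s in auto)
  have "r \<le> 0"
    unfolding r_def
  proof (rule cSUP_least)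
    fix y assume y: "y \<in> {s<..1}"
    then have "\<phi> y \<le> \<phi> s" using anti[of s y] s by auto
    then show "?c s y \<le> 0" using y by (simp add: divide_nonpos_pos)
  qed (use s in auto)
  have line: "\<phi> t \<le> \<phi> s + r * (t - s)" if t: "t \<in> {0..1}" for t
  proof -
    consider "t < s" | "t = s" | "s < t" by linarith
    then show ?thesis
    proof cases
      case 1
      then have "r * (s - t) \<le> \<phi> s - \<phi> t" using r_le[of t] t by (simp add: field_simps)
      then show ?thesis by (simp add: algebra_simps)
    next
      case 3
      then have "\<phi> t - \<phi> s \<le> r * (t - s)" using r_ge[of t] t by (simp add: field_simps)
      then show ?thesis by simp
    qed simp
  qed
  define l where "l t = \<phi> s + r * (t - s)" for t
  define g where "g t = (if t \<le> s then \<phi> t else l t)" for t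
  have g_ge: "\<phi> t \<le> g t" if "t \<in> {0..1}" for t using line[OF that] by (simp add: g_def l_def)
  have g_le: "g t \<le> l t" if "t \<in> {0..1}" for t using line[OF that] by (simp add: g_def l_def)
  have l_anti: "l y \<le> l x" if "x \<le> y" for x y
    using that \<open>r \<le> 0\<close> by (simp add: l_def mult_left_mono_neg)
  have "Cset g"
    unfolding Cset_def
  proof (intro conjI ballI impI)
    have "continuous_on ({0..s} \<union> {s..1}) (\<lambda>t. if t \<le> s then \<phi> t else l t)"
      by (rule continuous_on_cases)
         (use s in \<open>auto intro!: continuous_intros continuous_on_subset[OF cont] simp: l_def\<close>)
    moreover have "{0..s} \<union> {s..1} = {0..1}" using s by auto
    ultimately show "continuous_on {0..1} g" unfolding g_def[abs_def] by simp
    show "0 \<le> g x" if "x \<in> {0..1}" for x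
      using nonneg[OF that] g_ge[OF that] by linarith
    show "g y \<le> g x" if "x \<in> {0..1}" "y \<in> {0..1}" "x \<le> y" for x y
    proof -
      consider "y \<le> s" | "x \<le> s" "s < y" | "s < x" by linarith
      then show ?thesis
      proof cases
        case 1
        then show ?thesis using anti[OF that] that by (simp add: g_def)
      next
        case 2
        then have "g y \<le> l s" "l s \<le> g x"
          using l_anti[of s y] anti[of x s] that s by (auto simp: g_def l_def)
        then show ?thesis by linarith
      next
        case 3
        then show ?thesis using l_anti[of x y] that by (simp add: g_def)
      qed
    qed
    show "concave_on {0..1} g"
      unfolding concave_on_def
    proof (rule convex_on_linorderI)
      fix t x y :: real
      assume t: "0 < t" "t < 1" and xy: "x \<in> {0..1}" "y \<in> {0..1}" "x < y"
      define z where "z = (1 - t) * x + t * y"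
      have z1: "z - x = t * (y - x)" by (simp add: z_def algebra_simps)
      have z2: "y - z = (1 - t) * (y - x)" by (simp add: z_def algebra_simps)
      have xz: "x < z" using z1 t xy by (smt (verit) mult_pos_pos)
      have zy: "z < y" using z2 t xy by (smt (verit) mult_pos_pos)
      have lz: "l z = (1 - t) * l x + t * l y"
        by (simp add: l_def z_def algebra_simps)
      have "(1 - t) * g x + t * g y \<le> g z"
      \<comment> \<open>Right of \<open>s\<close> the point lies on the tangent line, and
        \<open>g\<close> lies below this line everywhere. Left of \<open>s\<close> the line has to
        be replaced by a chord of \<open>\<phi>\<close>.\<close>
      proof (cases "s < z")
        case True
        have "(1 - t) * g x + t * g y \<le> (1 - t) * l x + t * l y"
          using g_le[OF xy(1)] g_le[OF xy(2)] t by (intro add_mono mult_left_mono) auto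
        also have "\<dots> = g z" using True lz by (simp add: g_def)
        finally show ?thesis .
      next
        case False
        then have gz: "g z = \<phi> z" "g x = \<phi> x" using xz by (simp_all add: g_def)
        show ?thesis
        proof (cases "y \<le> s")
          case True
          then show ?thesis
            using concave_onD[OF conc, of t x y] t xy gz by (simp add: g_def z_def)
        next
          case y: False
          \<comment> \<open>\<open>k\<close> is the slope from \<open>x\<close> to \<open>s\<close>.
            The chord lies below \<open>\<phi>\<close> up to \<open>s\<close>, and because
            \<open>r \<le> k\<close> its prolongation lies above the tangent part.\<close>
          define k where "k = ?c x s"
          have xs: "x < s" using xz False by simp
          have rk: "r \<le> k" unfolding k_def using r_le[of x] xs xy by simp
          have ks: "k * (s - x) = \<phi> s - \<phi> x" unfolding k_def using xs by simp
          have "\<phi> x + k * (z - x) \<le> \<phi> z"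
          proof (cases "z = s")
            case True
            then show ?thesis using ks by simp
          next
            case zs: False
            then have "?c z s \<le> ?c x z" using concave_chord_mono[OF conc, of x z s] xz False xy s by simp
            then have "(\<phi> s - \<phi> z) * (z - x) \<le> (\<phi> z - \<phi> x) * (s - z)"
              using xz False zs by (simp add: field_simps)
            then have "(\<phi> s - \<phi> x) * (z - x) \<le> (\<phi> z - \<phi> x) * (s - x)"
              by (simp add: algebra_simps)
            then have "k * (z - x) * (s - x) \<le> (\<phi> z - \<phi> x) * (s - x)"
              by (simp add: ks[symmetric] mult_ac)
            then show ?thesis using xs by (simp add: mult_le_cancel_right)
          qed
          moreover have "g y - \<phi> x \<le> k * (y - x)"
          proof -
            have "g y = \<phi> s + r * (y - s)" using y by (simp add: g_def l_def)
            moreover have "r * (y - s) \<le> k * (y - s)" using rk y by (intro mult_right_mono) auto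
            ultimately show ?thesis using ks by (simp add: algebra_simps)
          qed
          then have "t * (g y - \<phi> x) \<le> t * (k * (y - x))" using t by (intro mult_left_mono) auto
          ultimately have "\<phi> x + t * (g y - \<phi> x) \<le> \<phi> z" using z1 by (simp add: mult.left_commute)
          then show ?thesis unfolding gz by (simp add: algebra_simps)
        qed
      qed
      then show "- g ((1 - t) *\<^sub>R x + t *\<^sub>R y) \<le> (1 - t) * - g x + t * - g y"
        unfolding z_def by simp
    qed simp
  qed
  then have "Cset (\<lambda>t. if t \<le> s then \<phi> t else \<phi> s + r * (t - s))"
    unfolding g_def[abs_def] l_def[abs_def] .
  then show thesis using \<open>r \<le> 0\<close> line by (rule that)
qed

lemma continuous_AE_zero:
  fixes D :: "real \<Rightarrow> real"
  assumes cont: "continuous_on {0..1} D" and ae: "AE x in lborel. x \<in> {0..1} \<longrightarrow> D x = 0"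
    and x: "x \<in> {0..1}"
  shows "D x = 0"
proof -
  have c: "continuous_on {0..1} (\<lambda>x. \<bar>D x\<bar>)" by (intro continuous_intros cont)
  have "integral {0..1} (\<lambda>x. \<bar>D x\<bar>) = (LINT x:{0..1}|lborel. \<bar>D x\<bar>)"
    by (rule set_borel_integral_eq_integral(2)[symmetric]) (rule borel_integrable_atLeastAtMost'[OF c])
  also have "\<dots> = 0"
    unfolding set_lebesgue_integral_def
    by (rule integral_eq_zero_AE) (use ae in \<open>auto elim!: eventually_mono simp: indicator_def\<close>)
  finally have "integral {0..1} (\<lambda>x. \<bar>D x\<bar>) = 0" .
  then have "\<forall>x\<in>{0..1}. \<bar>D x\<bar> = 0"
    using integral_eq_0_iff[OF c] by simp
  then show ?thesis using x by simp
qed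

section \<open>Positivity of the minimizer\<close>

locale Pfun_minimizer =
  fixes \<beta> :: "nat \<Rightarrow> real" and h :: real and \<phi> :: "real \<Rightarrow> real"
  assumes model: "is_model \<beta>" and phi: "Cset \<phi>"
    and minimal: "\<And>\<psi>. Cset \<psi> \<Longrightarrow> Pfun \<beta> h \<phi> \<le> Pfun \<beta> h \<psi>"
begin

abbreviation "X0 \<equiv> xi \<beta>"
abbreviation "X1 \<equiv> deriv (xi \<beta>)"
abbreviation "X2 \<equiv> deriv (deriv (xi \<beta>))"

lemma X_derivs:
  assumes "x \<in> {0..1}"
  shows "(X0 has_real_derivative X1 x) (at x)" "(X1 has_real_derivative X2 x) (at x)" "0 \<le> X2 x"
  using is_model_derivatives[OF model] assms by blast+

lemma X1_0: "X1 0 = 0"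
  using is_model_derivatives[OF model] by blast

lemma X3_exists: obtains X3 X4 where
  "\<forall>x\<in>{0..1}. (X2 has_real_derivative X3 x) (at x)" "\<forall>x\<in>{0..1}. (X3 has_real_derivative X4 x) (at x)"
  "\<forall>x\<in>{0..1}. 0 \<le> X3 x"
  using is_model_derivatives[OF model] by blast

lemma X2_cont: "continuous_on {0..1} X2"
  by (rule X3_exists) (blast intro: continuous_at_imp_continuous_on DERIV_isCont)

lemma X1_cont: "continuous_on {0..1} X1" and X0_cont: "continuous_on {0..1} X0"
  using X_derivs by (blast intro: continuous_at_imp_continuous_on DERIV_isCont)+

lemma X2_mono: "0 \<le> x \<Longrightarrow> x \<le> y \<Longrightarrow> y \<le> 1 \<Longrightarrow> X2 x \<le> X2 y"
proof -
  assume xy: "0 \<le> x" "x \<le> y" "y \<le> 1"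
  obtain X3 X4 where X3: "\<forall>x\<in>{0..1}. (X2 has_real_derivative X3 x) (at x)"
    "\<forall>x\<in>{0..1}. (X3 has_real_derivative X4 x) (at x)" "\<forall>x\<in>{0..1}. 0 \<le> X3 x"
    by (rule X3_exists)
  show ?thesis
  proof (rule DERIV_nonneg_imp_nondecreasing[OF xy(2)])
    fix z assume "x \<le> z" "z \<le> y"
    then have "z \<in> {0..1}" using xy by simp
    then show "\<exists>d. (X2 has_real_derivative d) (at z) \<and> 0 \<le> d" using X3 by blast
  qed
qed

lemma X1_mono: "0 \<le> x \<Longrightarrow> x \<le> y \<Longrightarrow> y \<le> 1 \<Longrightarrow> X1 x \<le> X1 y"
proof (rule DERIV_nonneg_imp_nondecreasing, assumption)
  fix z assume "0 \<le> x" "y \<le> 1" "x \<le> z" "z \<le> y"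
  then have "z \<in> {0..1}" by simp
  then show "\<exists>d. (X1 has_real_derivative d) (at z) \<and> 0 \<le> d" using X_derivs(2,3) by blast
qed

lemma X2_lipschitz_1: obtains B where "0 \<le> B" "\<And>x. x \<in> {0..1} \<Longrightarrow> X2 1 - X2 x \<le> B * (1 - x)"
proof -
  obtain X3 X4 where X3: "\<forall>x\<in>{0..1}. (X2 has_real_derivative X3 x) (at x)"
    "\<forall>x\<in>{0..1}. (X3 has_real_derivative X4 x) (at x)" "\<forall>x\<in>{0..1}. 0 \<le> X3 x"
    by (rule X3_exists)
  have "continuous_on {0..1} X3"
    using X3(2) by (blast intro: continuous_at_imp_continuous_on DERIV_isCont)
  then have "bounded (X3 ` {0..1})" by (intro compact_imp_bounded compact_continuous_image) auto
  then obtain B where B: "\<forall>x\<in>{0..1}. \<bar>X3 x\<bar> \<le> B" unfolding bounded_iff by auto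
  show thesis
  proof (rule that[of B])
    show "0 \<le> B" using B by fastforce
    fix x :: real assume x: "x \<in> {0..1}"
    show "X2 1 - X2 x \<le> B * (1 - x)"
    proof (cases "x = 1")
      case False
      then have "x < 1" using x by simp
      then obtain z where z: "z > x" "z < 1" "X2 1 - X2 x = (1 - x) * X3 z"
        using MVT2[of x 1 X2 X3] X3(1) x by auto
      have "z \<in> {0..1}" using z x by simp
      then have "X3 z \<le> B" using B by fastforce
      then show ?thesis using z x by (simp add: mult.commute mult_left_mono)
    qed simp
  qed
qed

lemma X0_tangent_1: "x \<in> {0..1} \<Longrightarrow> X0 1 - X0 x \<le> X1 1 * (1 - x)"
proof (cases "x = 1")
  case False
  assume x: "x \<in> {0..1}"
  then have "x < 1" using False by simp
  then obtain z where z: "z > x" "z < 1" "X0 1 - X0 x = (1 - x) * X1 z"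
    using MVT2[of x 1 X0 X1] X_derivs(1) x by auto
  have "X1 z \<le> X1 1" using X1_mono[of z 1] z x by auto
  then show ?thesis using z x by (simp add: mult.commute mult_left_mono)
qed simp

lemma phi_cont: "continuous_on {0..1} \<phi>"
  and phi_nonneg: "x \<in> {0..1} \<Longrightarrow> 0 \<le> \<phi> x"
  and phi_anti: "0 \<le> x \<Longrightarrow> x \<le> y \<Longrightarrow> y \<le> 1 \<Longrightarrow> \<phi> y \<le> \<phi> x"
  and phi_concave: "concave_on {0..1} \<phi>"
  using phi unfolding Cset_def by auto

section \<open>Extended and real forms of the functional\<close>

definition P_integrand :: "(real \<Rightarrow> real) \<Rightarrow> real \<Rightarrow> ennreal" where
  "P_integrand \<psi> x = (ennreal (X2 x * \<psi> x) + inverse (ennreal (\<psi> x))) * indicator {0..1} x"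

lemma Pfun_eq: "Pfun \<beta> h \<psi> = (\<integral>\<^sup>+x. P_integrand \<psi> x \<partial>lborel) + ennreal (h\<^sup>2 * \<psi> 0)"
  by (simp add: Pfun_def P_integrand_def)

lemma P_integrand_measurable:
  assumes "continuous_on {0..1} \<psi>"
  shows "P_integrand \<psi> \<in> borel_measurable borel"
proof -
  have [measurable]: "(\<lambda>x. indicator {0..1} x * X2 x) \<in> borel_measurable borel"
    "(\<lambda>x. indicator {0..1} x * \<psi> x) \<in> borel_measurable borel"
    using borel_measurable_continuous_on_indicator[OF _ X2_cont]
      borel_measurable_continuous_on_indicator[OF _ assms] by simp_all
  have "P_integrand \<psi> = (\<lambda>x. (ennreal ((indicator {0..1} x * X2 x) * (indicator {0..1} x * \<psi> x))
      + inverse (ennreal (indicator {0..1} x * \<psi> x))) * indicator {0..1} x)"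
    by (auto simp: P_integrand_def fun_eq_iff indicator_def)
  also have "\<dots> \<in> borel_measurable borel" by measurable
  finally show ?thesis .
qed

text \<open>Real form of \<open>P\<close> for strictly positive competitors, on which differences
  and limits can be taken.\<close>

definition PR :: "(real \<Rightarrow> real) \<Rightarrow> real" where
  "PR \<psi> = integral {0..1} (\<lambda>x. X2 x * \<psi> x + 1 / \<psi> x) + h\<^sup>2 * \<psi> 0"

lemma P_continuous:
  assumes "continuous_on {0..1} \<psi>" "\<And>x. x \<in> {0..1} \<Longrightarrow> 0 < \<psi> x"
  shows "continuous_on {0..1} (\<lambda>x. X2 x * \<psi> x + 1 / \<psi> x)"
  by (intro continuous_intros X2_cont assms(1)) (use assms(2) in fastforce)

lemma Pfun_eq_PR:
  assumes cont: "continuous_on {0..1} \<psi>" and pos: "\<And>x. x \<in> {0..1} \<Longrightarrow> 0 < \<psi> x"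
  shows "Pfun \<beta> h \<psi> = ennreal (PR \<psi>)" "0 \<le> PR \<psi>"
proof -
  let ?f = "\<lambda>x. X2 x * \<psi> x + 1 / \<psi> x"
  have f0: "0 \<le> ?f x" if "x \<in> {0..1}" for x using X_derivs(3)[OF that] pos[OF that] by simp
  have "(?f has_integral integral {0..1} ?f) {0..1}"
    using integrable_continuous_real[OF P_continuous[OF assms]] by blast
  then have I: "integral\<^sup>N lborel (\<lambda>x. ennreal (?f x) * indicator {0..1} x) = ennreal (integral {0..1} ?f)"
    by (intro nn_integral_has_integral_lebesgue' f0)
  have pi: "P_integrand \<psi> x = ennreal (?f x) * indicator {0..1} x" for x
  proof (cases "x \<in> {0..1}")
    case True
    then show ?thesis
      using X_derivs(3)[OF True] pos[OF True]
      by (simp add: P_integrand_def inverse_ennreal divide_inverse ennreal_plus[symmetric] del: ennreal_plus)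
  qed (simp add: P_integrand_def)
  have eq: "Pfun \<beta> h \<psi> = ennreal (integral {0..1} ?f) + ennreal (h\<^sup>2 * \<psi> 0)"
    unfolding Pfun_eq pi I ..
  have nn: "0 \<le> integral {0..1} ?f" "0 \<le> h\<^sup>2 * \<psi> 0"
    using f0 pos[of 0] by (auto intro!: integral_nonneg integrable_continuous_real P_continuous[OF assms])
  then show "Pfun \<beta> h \<psi> = ennreal (PR \<psi>)" unfolding eq PR_def by (simp add: ennreal_plus)
  show "0 \<le> PR \<psi>" unfolding PR_def using nn by simp
qed

lemma Cset_const: "0 \<le> c \<Longrightarrow> Cset (\<lambda>_. c)"
  by (simp add: Cset_def concave_on_const)

lemma Pfun_finite: "Pfun \<beta> h \<phi> < \<infinity>"
proof -
  have "Pfun \<beta> h \<phi> \<le> Pfun \<beta> h (\<lambda>_. 1)" by (rule minimal) (simp add: Cset_const)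
  also have "\<dots> < \<infinity>" by (subst Pfun_eq_PR) auto
  finally show ?thesis .
qed

text \<open>Replacing \<open>\<phi>\<close> by its tangent to the right of \<open>s\<close> lowers the functional unless nothing changes,
  as long as \<open>\<xi>'' \<phi>\<^sup>2 < 1\<close> there.\<close>
lemma linear_near_1:
  assumes small: "X2 1 * (\<phi> 1)\<^sup>2 < 1"
  obtains s r where "0 < s" "s < 1" "\<And>t. t \<in> {s..1} \<Longrightarrow> \<phi> t = \<phi> s + r * (t - s)" "r \<le> 0"
proof -
  have "continuous_on {0..1} (\<lambda>t. X2 1 * (\<phi> t)\<^sup>2)" by (intro continuous_intros phi_cont)
  then have "((\<lambda>t. X2 1 * (\<phi> t)\<^sup>2) \<longlongrightarrow> X2 1 * (\<phi> 1)\<^sup>2) (at_left 1)"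
    unfolding continuous_on_def using at_within_Icc_at_left[of 0 "1::real"]
    by (metis atLeastAtMost_iff order_refl zero_le_one zero_less_one)
  then have "\<forall>\<^sub>F t in at_left 1. X2 1 * (\<phi> t)\<^sup>2 < 1" using small by (rule order_tendstoD)
  moreover have "\<forall>\<^sub>F t in at_left (1::real). 0 < t" by (rule order_tendstoD[OF tendsto_ident_at]) simp
  moreover have "\<forall>\<^sub>F t in at_left (1::real). t < 1" by (simp add: eventually_at_filter)
  ultimately have "\<forall>\<^sub>F t in at_left 1. X2 1 * (\<phi> t)\<^sup>2 < 1 \<and> 0 < t \<and> t < 1" by eventually_elim simp
  from eventually_happens[OF this] obtain s where s: "X2 1 * (\<phi> s)\<^sup>2 < 1" "0 < s" "s < 1"
    by auto
  obtain r where r: "Cset (\<lambda>t. if t \<le> s then \<phi> t else \<phi> s + r * (t - s))" "r \<le> 0"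
    "\<And>t. t \<in> {0..1} \<Longrightarrow> \<phi> t \<le> \<phi> s + r * (t - s)"
    by (rule Cset_tangent_extension[OF phi s(2,3)]) (rule that; assumption)
  define g where "g t = (if t \<le> s then \<phi> t else \<phi> s + r * (t - s))" for t
  have Cg: "Cset g" using r(1) unfolding g_def[abs_def] .
  have g_cont: "continuous_on {0..1} g" using Cg by (simp add: Cset_def)
  have g_ge: "\<phi> t \<le> g t" if "t \<in> {0..1}" for t using r(3)[OF that] by (simp add: g_def)
  have key: "P_integrand g x < P_integrand \<phi> x" if x: "x \<in> {0..1}" "\<phi> x \<noteq> g x" for x
  proof -
    have xs: "s < x" using x by (auto simp: g_def split: if_splits)
    have lt: "\<phi> x < g x" using g_ge[OF x(1)] x(2) by simp
    have gs: "g x \<le> \<phi> s" using xs r(2) by (simp add: g_def mult_nonpos_nonneg)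
    have g0: "0 < g x" using lt phi_nonneg[OF x(1)] by simp
    show ?thesis
    proof (cases "\<phi> x = 0")
      case True
      \<comment> \<open>Here the old integrand is infinite, since \<open>inverse 0\<close> is
        infinity in \<open>ennreal\<close>, while \<open>g x > 0\<close> makes the new one
        finite.\<close>
      then show ?thesis
        using x g0 by (simp add: P_integrand_def inverse_ennreal ennreal_plus[symmetric] less_top del: ennreal_plus)
    next
      case False
      then have p0: "0 < \<phi> x" using phi_nonneg[OF x(1)] by simp
      \<comment> \<open>Raising the argument from \<open>\<phi> x\<close> to \<open>g x\<close>
        changes the integrand by \<open>(g x - \<phi> x) * (X2 x - 1 / (\<phi> x * g x))\<close>,
        negative as soon as \<open>X2 x * \<phi> x * g x < 1\<close>. The bound at \<open>s\<close>
        yields this, as \<open>X2\<close> increases and both values are at most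
        \<open>\<phi> s\<close>.\<close>
      have "X2 x * (\<phi> x * g x) \<le> X2 1 * (\<phi> s * \<phi> s)"
        using X2_mono[of x 1] X_derivs(3)[of x] X_derivs(3)[of 1] x xs lt gs p0 g0
        by (intro mult_mono) auto
      then have "X2 x * (\<phi> x * g x) < 1" using s(1) by (simp add: power2_eq_square)
      then have "(g x - \<phi> x) * (X2 x * (\<phi> x * g x)) < (g x - \<phi> x) * 1"
        using lt by (intro mult_strict_left_mono) auto
      then have "X2 x * g x + 1 / g x < X2 x * \<phi> x + 1 / \<phi> x"
        using p0 g0 by (simp add: field_simps)
      then show ?thesis
        using x p0 g0 X_derivs(3)[OF x(1)]
        by (simp add: P_integrand_def inverse_ennreal divide_inverse ennreal_plus[symmetric] ennreal_less_iff del: ennreal_plus)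
    qed
  qed
  have le: "P_integrand g x \<le> P_integrand \<phi> x" for x
  proof (cases "x \<in> {0..1}")
    case True
    then show ?thesis using key[OF True] by (cases "\<phi> x = g x") (auto simp: P_integrand_def less_imp_le)
  qed (simp add: P_integrand_def)
  \<comment> \<open>Because \<open>s > 0\<close>, the boundary term at 0 is unchanged and, being
    finite, cancels in the comparison.\<close>
  have g0: "g 0 = \<phi> 0" using s by (simp add: g_def)
  have fin: "(\<integral>\<^sup>+x. P_integrand \<phi> x \<partial>lborel) \<noteq> \<infinity>"
    using Pfun_finite unfolding Pfun_eq by (auto simp: ennreal_add_eq_top less_top[symmetric])
  have "(\<integral>\<^sup>+x. P_integrand g x \<partial>lborel) \<le> (\<integral>\<^sup>+x. P_integrand \<phi> x \<partial>lborel)"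
    by (rule nn_integral_mono) (rule le)
  then have fing: "(\<integral>\<^sup>+x. P_integrand g x \<partial>lborel) \<noteq> \<infinity>" using fin by (auto simp: top_unique)
  have "\<not> (\<integral>\<^sup>+x. P_integrand g x \<partial>lborel) < (\<integral>\<^sup>+x. P_integrand \<phi> x \<partial>lborel)"
  proof -
    have "ennreal (h\<^sup>2 * \<phi> 0) + (\<integral>\<^sup>+x. P_integrand \<phi> x \<partial>lborel)
        \<le> ennreal (h\<^sup>2 * \<phi> 0) + (\<integral>\<^sup>+x. P_integrand g x \<partial>lborel)"
      using minimal[OF Cg] unfolding Pfun_eq g0 by (simp only: add.commute)
    then show ?thesis unfolding ennreal_add_left_cancel_le by (simp add: not_less)
  qed
  then have ae: "AE x in lborel. P_integrand \<phi> x \<le> P_integrand g x"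
    using nn_integral_less[of "P_integrand g" lborel "P_integrand \<phi>"] fing le
      P_integrand_measurable[OF g_cont] P_integrand_measurable[OF phi_cont] by auto
  have "AE x in lborel. x \<in> {0..1} \<longrightarrow> g x - \<phi> x = 0"
    using ae
  proof eventually_elim
    case (elim x)
    show ?case using key[of x] elim by (metis diff_self leD)
  qed
  then have eq: "g x - \<phi> x = 0" if "x \<in> {0..1}" for x
    by (rule continuous_AE_zero[rotated]) (use that in \<open>auto intro!: continuous_intros g_cont phi_cont\<close>)
  show thesis
  proof (rule that[OF s(2,3) _ r(2)])
    fix t assume t: "t \<in> {s..1}"
    then show "\<phi> t = \<phi> s + r * (t - s)" using eq[of t] s by (cases "t = s") (auto simp: g_def)
  qed
qed

text \<open>If \<open>\<phi>\<close> vanished at 1, the smallness condition would hold trivially and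
  \<open>\<phi>\<close> would be linear near 1 with a zero there, so \<open>1 / \<phi>\<close> would
  have a logarithmically divergent integral although the minimum is finite.\<close>

lemma phi_1_pos: "0 < \<phi> 1"
proof (rule ccontr)
  assume "\<not> 0 < \<phi> 1"
  then have z: "\<phi> 1 = 0" using phi_nonneg[of 1] by simp
  then obtain s r where s: "0 < s" "s < 1" and lin: "\<And>t. t \<in> {s..1} \<Longrightarrow> \<phi> t = \<phi> s + r * (t - s)" and "r \<le> 0"
    using linear_near_1 by auto
  have "\<phi> s = - r * (1 - s)" using lin[of 1] z s by simp
  then have lin': "\<phi> t = - r * (1 - t)" if "t \<in> {s..1}" for t using lin[OF that] by (simp add: algebra_simps)
  \<comment> \<open>The added 1 keeps the comparison slope positive even when
    \<open>r = 0\<close>.\<close>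
  define m where "m = 1 - r"
  have m: "0 < m" "- r \<le> m" using \<open>r \<le> 0\<close> by (auto simp: m_def)
  obtain I where I: "0 \<le> I" "Pfun \<beta> h \<phi> = ennreal I" using Pfun_finite by (cases "Pfun \<beta> h \<phi>") auto
  \<comment> \<open>Solves \<open>ln ((1 - s) / (1 - u)) / m = I + 1\<close>, so that the integral
    from \<open>s\<close> to \<open>u\<close> alone exceeds the total value
    \<open>I\<close>.\<close>
  define u where "u = 1 - (1 - s) * exp (- m * (I + 1))"
  have exp: "0 < exp (- m * (I + 1))" "exp (- m * (I + 1)) \<le> 1" using m I by auto
  have u: "s \<le> u" "u < 1"
  proof -
    have "(1 - s) * exp (- m * (I + 1)) \<le> 1 - s"
      using mult_left_mono[OF exp(2), of "1 - s"] s by (simp only: mult_1_right)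
    then show "s \<le> u" unfolding u_def by linarith
    have "0 < (1 - s) * exp (- m * (I + 1))" using s exp(1) by (intro mult_pos_pos) auto
    then show "u < 1" unfolding u_def by linarith
  qed
  have u1: "1 - u = (1 - s) * exp (- m * (I + 1))" by (simp add: u_def)
  have "((\<lambda>t. 1 / (m * (1 - t))) has_integral (- ln (1 - u) / m - - ln (1 - s) / m)) {s..u}"
  proof (rule fundamental_theorem_of_calculus[OF u(1)])
    fix t assume t: "t \<in> {s..u}"
    then have "t < 1" using u by simp
    then have "((\<lambda>t. - ln (1 - t) / m) has_real_derivative 1 / (m * (1 - t))) (at t within {s..u})"
      using m by (auto intro!: derivative_eq_intros simp: field_simps)
    then show "((\<lambda>t. - ln (1 - t) / m) has_vector_derivative 1 / (m * (1 - t))) (at t within {s..u})"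
      by (simp add: has_real_derivative_iff_has_vector_derivative)
  qed
  moreover have "- ln (1 - u) / m - - ln (1 - s) / m = I + 1"
  proof -
    have "ln (1 - u) = ln (1 - s) - m * (I + 1)"
      unfolding u1 using s by (subst ln_mult) auto
    then show ?thesis using m by (simp add: field_simps)
  qed
  ultimately have int: "integral\<^sup>N lborel (\<lambda>t. ennreal (1 / (m * (1 - t))) * indicator {s..u} t) = ennreal (I + 1)"
    using m u by (intro nn_integral_has_integral_lebesgue') auto
  have "ennreal (1 / (m * (1 - t))) * indicator {s..u} t \<le> P_integrand \<phi> t" for t
  proof (cases "t \<in> {s..u}")
    case True
    have t: "t \<in> {0..1}" "t \<in> {s..1}" "t < 1" using True s u by auto
    have "ennreal (1 / (m * (1 - t))) \<le> inverse (ennreal (\<phi> t))"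
    proof (cases "\<phi> t = 0")
      case False
      then have p: "0 < \<phi> t" using phi_nonneg[OF t(1)] by simp
      have "\<phi> t \<le> m * (1 - t)" unfolding lin'[OF t(2)] using m t by (intro mult_right_mono) auto
      then have "1 / (m * (1 - t)) \<le> 1 / \<phi> t" using p by (intro divide_left_mono) auto
      then show ?thesis using p by (simp add: inverse_ennreal divide_inverse ennreal_leI)
    qed simp
    then show ?thesis using True t by (simp add: P_integrand_def add_increasing)
  qed simp
  then have "ennreal (I + 1) \<le> (\<integral>\<^sup>+x. P_integrand \<phi> x \<partial>lborel)"
    unfolding int[symmetric] by (intro nn_integral_mono)
  also have "\<dots> \<le> ennreal I" using I(2) unfolding Pfun_eq by (metis le_iff_add)
  finally show False using I by simp
qed

lemma phi_ge: "x \<in> {0..1} \<Longrightarrow> \<phi> 1 \<le> \<phi> x"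
  using phi_anti[of x 1] by simp

lemma phi_pos: "x \<in> {0..1} \<Longrightarrow> 0 < \<phi> x"
  using phi_ge[of x] phi_1_pos by simp

end

section \<open>First variation and Lipschitz bound\<close>

lemma Cset_add_scaled:
  assumes f: "Cset f" and g: "Cset g" and e: "0 \<le> e"
  shows "Cset (\<lambda>x. f x + e * g x)"
  unfolding Cset_def
proof (intro conjI ballI impI)
  show "continuous_on {0..1} (\<lambda>x. f x + e * g x)"
    using f g unfolding Cset_def by (intro continuous_intros) auto
  show "0 \<le> f x + e * g x" if "x \<in> {0..1}" for x
    using f g e that unfolding Cset_def by auto
  show "f y + e * g y \<le> f x + e * g x" if "x \<in> {0..1}" "y \<in> {0..1}" "x \<le> y" for x y
    using f g e that unfolding Cset_def by (intro add_mono mult_left_mono) auto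
  show "concave_on {0..1} (\<lambda>x. f x + e * g x)"
    using f g e unfolding Cset_def by (intro concave_on_add concave_on_cmul) auto
qed

text \<open>For interior \<open>s\<close> the negative second derivative of this hinge is the unit
  mass at \<open>s\<close>; pairing it with \<open>L\<close> therefore produces pointwise
  information.\<close>

lemma Cset_hinge:
  assumes "s \<le> 1"
  shows "Cset (\<lambda>t. 1 - max s t)"
  unfolding Cset_def
proof (intro conjI ballI impI)
  show "concave_on {0..1} (\<lambda>t. 1 - max s t)"
    unfolding concave_on_def
  proof (rule convex_onI)
    fix t x y :: real assume t: "0 < t" "t < 1"
    have "(1 - t) * s + t * s \<le> (1 - t) * max s x + t * max s y"
      "(1 - t) * x + t * y \<le> (1 - t) * max s x + t * max s y"
      using t by (intro add_mono mult_left_mono; simp)+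
    moreover have "(1 - t) * s + t * s = s" by (simp add: algebra_simps)
    ultimately have "max s ((1 - t) * x + t * y) \<le> (1 - t) * max s x + t * max s y" by simp
    then show "- (1 - max s ((1 - t) *\<^sub>R x + t *\<^sub>R y)) \<le> (1 - t) * - (1 - max s x) + t * - (1 - max s y)"
      by (simp add: algebra_simps)
  qed simp
qed (use assms in \<open>auto intro!: continuous_intros\<close>)

lemma tangent_below_if_mono_deriv:
  fixes f g :: "real \<Rightarrow> real"
  assumes deriv: "\<And>x. x \<in> {0..1} \<Longrightarrow> (f has_real_derivative g x) (at x within {0..1})"
    and mono: "\<And>x y. 0 \<le> x \<Longrightarrow> x \<le> y \<Longrightarrow> y \<le> 1 \<Longrightarrow> g x \<le> g y"
    and z: "z \<in> {0..1}" and w: "w \<in> {0..1}"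
  shows "f z + g z * (w - z) \<le> f w"
proof -
  have I: "(g has_integral (f y - f x)) {x..y}" if "0 \<le> x" "x \<le> y" "y \<le> 1" for x y
    by (rule fundamental_theorem_of_calculus)
       (use that in \<open>auto simp flip: has_real_derivative_iff_has_vector_derivative
          intro!: has_field_derivative_subset[OF deriv]\<close>)
  show ?thesis
  proof (cases "z \<le> w")
    case True
    have "((\<lambda>_. g z) has_integral (g z * (w - z))) {z..w}"
      using has_integral_const_real[of "g z" z w] True by (simp add: mult.commute)
    then have "g z * (w - z) \<le> f w - f z"
      by (rule has_integral_le[OF _ I]) (use True z w mono in auto)
    then show ?thesis by simp
  next
    case False
    have "((\<lambda>_. g z) has_integral (g z * (z - w))) {w..z}"
      using has_integral_const_real[of "g z" w z] False by (simp add: mult.commute)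
    then have "f z - f w \<le> g z * (z - w)"
      by (rule has_integral_le[OF I, rotated 3]) (use False z w mono in auto)
    then show ?thesis by (simp add: algebra_simps)
  qed
qed

lemma convex_on_if_mono_deriv:
  fixes f g :: "real \<Rightarrow> real"
  assumes deriv: "\<And>x. x \<in> {0..1} \<Longrightarrow> (f has_real_derivative g x) (at x within {0..1})"
    and mono: "\<And>x y. 0 \<le> x \<Longrightarrow> x \<le> y \<Longrightarrow> y \<le> 1 \<Longrightarrow> g x \<le> g y"
  shows "convex_on {0..1} f"
proof (rule convex_onI)
  fix t x y :: real assume t: "0 < t" "t < 1" and xy: "x \<in> {0..1}" "y \<in> {0..1}"
  define z where "z = (1 - t) *\<^sub>R x + t *\<^sub>R y"
  have z: "z \<in> {0..1}"
    unfolding z_def using convexD_alt[of "{0..1::real}" x y t] t xy by simp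
  have tx: "f z + g z * (x - z) \<le> f x" and ty: "f z + g z * (y - z) \<le> f y"
    using tangent_below_if_mono_deriv[OF deriv mono z] xy by blast+
  have "(1 - t) * (f z + g z * (x - z)) + t * (f z + g z * (y - z)) \<le> (1 - t) * f x + t * f y"
    using t by (intro add_mono mult_left_mono tx ty) auto
  moreover have "(1 - t) * (f z + g z * (x - z)) + t * (f z + g z * (y - z)) = f z + g z * ((1 - t) * x + t * y - z)"
    by (simp add: algebra_simps)
  ultimately show "f ((1 - t) *\<^sub>R x + t *\<^sub>R y) \<le> (1 - t) * f x + t * f y"
    by (simp add: z_def)
qed simp

context Pfun_minimizer
begin

definition v :: "real \<Rightarrow> real" where "v x = 1 / (\<phi> x)\<^sup>2"

lemma v_pos: "x \<in> {0..1} \<Longrightarrow> 0 < v x"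
  using phi_pos[of x] by (simp add: v_def)

lemma v_cont: "continuous_on {0..1} v"
  unfolding v_def[abs_def] by (intro continuous_intros phi_cont) (use phi_pos in fastforce)

definition L :: "(real \<Rightarrow> real) \<Rightarrow> real" where
  "L \<psi> = integral {0..1} (\<lambda>x. (X2 x - v x) * \<psi> x) + h\<^sup>2 * \<psi> 0"

lemma L_integrable: "continuous_on {0..1} \<psi> \<Longrightarrow> (\<lambda>x. (X2 x - v x) * \<psi> x) integrable_on {0..1}"
  by (intro integrable_continuous_real continuous_intros X2_cont v_cont)

lemma L_linear:
  assumes "continuous_on {0..1} \<psi>" "continuous_on {0..1} \<theta>"
  shows "L (\<lambda>x. a * \<psi> x + b * \<theta> x) = a * L \<psi> + b * L \<theta>"
proof -
  have "integral {0..1} (\<lambda>x. (X2 x - v x) * (a * \<psi> x + b * \<theta> x))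
      = integral {0..1} (\<lambda>x. a * ((X2 x - v x) * \<psi> x) + b * ((X2 x - v x) * \<theta> x))"
    by (rule integral_cong) (simp add: algebra_simps)
  also have "\<dots> = a * integral {0..1} (\<lambda>x. (X2 x - v x) * \<psi> x) + b * integral {0..1} (\<lambda>x. (X2 x - v x) * \<theta> x)"
    using L_integrable[OF assms(1)] L_integrable[OF assms(2)]
    by (subst integral_add) (auto intro!: integrable_on_mult_right)
  finally show ?thesis by (simp add: L_def algebra_simps)
qed

text \<open>Admissibility is required of \<open>\<phi> + e * \<psi>\<close> only, so that directions
  outside the cone can be used. The remainder of \<open>1 / \<phi>\<close> is quadratic in
  \<open>e\<close> uniformly in \<open>x\<close>; dividing by \<open>e\<close> and letting it tend
  to 0 leaves \<open>L \<psi>\<close>.\<close>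

lemma first_variation:
  assumes cont: "continuous_on {0..1} \<psi>" and e0: "0 < e0"
    and C: "\<And>e. 0 < e \<Longrightarrow> e \<le> e0 \<Longrightarrow> Cset (\<lambda>x. \<phi> x + e * \<psi> x)"
  shows "0 \<le> L \<psi>"
proof -
  have "bounded (\<psi> ` {0..1})" by (intro compact_imp_bounded compact_continuous_image cont) auto
  then obtain N where N: "\<forall>x\<in>{0..1}. \<bar>\<psi> x\<bar> \<le> N" unfolding bounded_iff by auto
  have N0: "0 \<le> N" using N by fastforce
  define c where "c = \<phi> 1"
  have c: "0 < c" using phi_1_pos by (simp add: c_def)
  \<comment> \<open>\<open>K\<close> bounds \<open>\<psi>^2 / (\<phi>^2 * q)\<close> using
    \<open>\<phi> \<ge> c\<close> and \<open>q \<ge> c / 2\<close>. The latter holds for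
    \<open>e \<le> d\<close>, where \<open>N + 1\<close> avoids division by zero.\<close>
  define K where "K = 2 * N\<^sup>2 / c ^ 3"
  define d where "d = min e0 (c / (2 * (N + 1)))"
  have d: "0 < d" using e0 c N0 by (simp add: d_def)
  have main: "0 \<le> L \<psi> + e * K" if e: "0 < e" "e \<le> d" for e
  proof -
    define q where "q x = \<phi> x + e * \<psi> x" for x
    have Cq: "Cset q" using C[of e] e by (simp add: q_def[abs_def] d_def)
    have q_cont: "continuous_on {0..1} q" using Cq by (simp add: Cset_def)
    have q_ge: "c / 2 \<le> q x" if x: "x \<in> {0..1}" for x
    proof -
      have "e * \<bar>\<psi> x\<bar> \<le> c / (2 * (N + 1)) * N"
        using e N x N0 c by (intro mult_mono) (auto simp: d_def)
      also have "\<dots> \<le> c / 2" using c N0 by (simp add: field_simps)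
      finally have "\<bar>e * \<psi> x\<bar> \<le> c / 2" using e by (simp add: abs_mult)
      then show ?thesis using phi_ge[OF x] unfolding q_def c_def by linarith
    qed
    have q_pos: "0 < q x" if "x \<in> {0..1}" for x using q_ge[OF that] c by linarith
    have "ennreal (PR \<phi>) \<le> ennreal (PR q)"
      using minimal[OF Cq] Pfun_eq_PR(1)[OF phi_cont phi_pos] Pfun_eq_PR(1)[OF q_cont q_pos] by simp
    then have PR: "PR \<phi> \<le> PR q" using Pfun_eq_PR(2)[OF q_cont q_pos] by (simp add: ennreal_le_iff)
    have i: "(\<lambda>x. X2 x * q x + 1 / q x) integrable_on {0..1}" "(\<lambda>x. X2 x * \<phi> x + 1 / \<phi> x) integrable_on {0..1}"
      using P_continuous[OF q_cont q_pos] P_continuous[OF phi_cont phi_pos]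
      by (auto intro: integrable_continuous_real)
    have "integral {0..1} (\<lambda>x. X2 x * q x + 1 / q x) - integral {0..1} (\<lambda>x. X2 x * \<phi> x + 1 / \<phi> x)
        = integral {0..1} (\<lambda>x. (X2 x * q x + 1 / q x) - (X2 x * \<phi> x + 1 / \<phi> x))"
      using i by (simp add: integral_diff)
    also have "\<dots> \<le> integral {0..1} (\<lambda>x. e * ((X2 x - v x) * \<psi> x) + e * (e * K))"
    proof (rule integral_le)
      show "(\<lambda>x. (X2 x * q x + 1 / q x) - (X2 x * \<phi> x + 1 / \<phi> x)) integrable_on {0..1}"
        using i by (rule integrable_diff)
      show "(\<lambda>x. e * ((X2 x - v x) * \<psi> x) + e * (e * K)) integrable_on {0..1}"
        using L_integrable[OF cont] by (intro integrable_add integrable_on_mult_right) auto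
      fix x :: real assume x: "x \<in> {0..1}"
      have p: "c \<le> \<phi> x" "0 < \<phi> x" "c / 2 \<le> q x" "0 < q x" using phi_ge[OF x] phi_pos[OF x] q_ge[OF x] q_pos[OF x]
        by (auto simp: c_def)
      have "1 / q x - 1 / \<phi> x = e * (- \<psi> x / (\<phi> x)\<^sup>2) + e\<^sup>2 * ((\<psi> x)\<^sup>2 / ((\<phi> x)\<^sup>2 * q x))"
        using p by (simp add: field_simps power2_eq_square) (simp add: q_def algebra_simps)
      moreover have "(\<psi> x)\<^sup>2 / ((\<phi> x)\<^sup>2 * q x) \<le> K"
      proof -
        have "\<bar>\<psi> x\<bar>\<^sup>2 \<le> N\<^sup>2" using N x by (intro power_mono) auto
        moreover have "c\<^sup>2 * (c / 2) \<le> (\<phi> x)\<^sup>2 * q x" using p c by (intro mult_mono power_mono) auto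
        ultimately have "(\<psi> x)\<^sup>2 / ((\<phi> x)\<^sup>2 * q x) \<le> N\<^sup>2 / (c\<^sup>2 * (c / 2))"
          using c by (intro frac_le) auto
        then show ?thesis by (simp add: K_def power2_eq_square power3_eq_cube mult_ac)
      qed
      then have "e\<^sup>2 * ((\<psi> x)\<^sup>2 / ((\<phi> x)\<^sup>2 * q x)) \<le> e\<^sup>2 * K" by (intro mult_left_mono) auto
      moreover have "X2 x * q x = X2 x * \<phi> x + e * (X2 x * \<psi> x)" by (simp add: q_def algebra_simps)
      ultimately show "(X2 x * q x + 1 / q x) - (X2 x * \<phi> x + 1 / \<phi> x) \<le> e * ((X2 x - v x) * \<psi> x) + e * (e * K)"
        by (simp add: v_def algebra_simps power2_eq_square)
    qed
    also have "\<dots> = e * integral {0..1} (\<lambda>x. (X2 x - v x) * \<psi> x) + e * (e * K)"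
      using L_integrable[OF cont] by (subst integral_add) (auto intro!: integrable_on_mult_right)
    finally have "0 \<le> e * (L \<psi> + e * K)"
      using PR unfolding PR_def L_def q_def by (simp add: algebra_simps)
    then show ?thesis using e by (simp add: zero_le_mult_iff)
  qed
  show ?thesis
  proof (rule tendsto_lowerbound)
    show "((\<lambda>e. L \<psi> + e * K) \<longlongrightarrow> L \<psi>) (at_right 0)"
      by (auto intro!: tendsto_eq_intros)
    have "\<forall>\<^sub>F e in at_right 0. 0 < e \<and> e < d"
      by (intro eventually_conj eventually_at_right_less order_tendstoD(2)[OF tendsto_ident_at] d)
    then show "\<forall>\<^sub>F e in at_right 0. 0 \<le> L \<psi> + e * K"
      by eventually_elim (auto intro: main)
  qed simp
qed

lemma L_nonneg: "Cset \<psi> \<Longrightarrow> 0 \<le> L \<psi>"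
  by (rule first_variation[of _ 1]) (auto simp: Cset_def[of \<psi>] intro: Cset_add_scaled[OF phi])

text \<open>Shrinking \<open>\<phi>\<close> by the factor \<open>1 - e\<close> stays in the cone, so
  \<open>\<phi>\<close> and \<open>- \<phi>\<close> are both admissible directions.\<close>

lemma L_phi: "L \<phi> = 0"
proof -
  have "Cset (\<lambda>x. \<phi> x + e * - \<phi> x)" if "0 < e" "e \<le> 1" for e
  proof -
    have "Cset (\<lambda>x. 0 + (1 - e) * \<phi> x)"
      by (rule Cset_add_scaled[OF Cset_const phi]) (use that in auto)
    then show ?thesis by (simp add: algebra_simps)
  qed
  then have "0 \<le> L (\<lambda>x. - \<phi> x)"
    by (intro first_variation[of _ 1] continuous_intros phi_cont) auto
  also have "L (\<lambda>x. - \<phi> x) = - L \<phi>"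
    using L_linear[OF phi_cont phi_cont, of "-1" 0] by simp
  finally show ?thesis using L_nonneg[OF phi] by simp
qed

text \<open>\<open>\<phi> - \<phi> 1\<close> is still in the cone, so
  \<open>0 \<le> L \<phi> - \<phi> 1 * L 1 = - \<phi> 1 * L 1\<close>; positivity of
  \<open>\<phi> 1\<close> decides the sign.\<close>

lemma L_1: "L (\<lambda>_. 1) = 0"
proof -
  have "Cset (\<lambda>x. \<phi> x - \<phi> 1)"
    unfolding Cset_def
    using phi_cont phi_ge phi_anti phi_concave
    by (auto intro!: continuous_intros concave_on_diff simp: convex_on_const)
  then have "0 \<le> L (\<lambda>x. \<phi> x - \<phi> 1)" by (rule L_nonneg)
  also have "\<dots> = L \<phi> - \<phi> 1 * L (\<lambda>_. 1)"
    using L_linear[OF phi_cont continuous_on_const[of _ 1], of 1 "- \<phi> 1"] by simp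
  finally have "\<phi> 1 * L (\<lambda>_. 1) \<le> 0" by (simp add: L_phi)
  then have "L (\<lambda>_. 1) \<le> 0" using phi_1_pos by (simp add: mult_le_0_iff)
  then show ?thesis using L_nonneg[OF Cset_const[of 1]] by simp
qed

text \<open>If \<open>\<xi>''(1) \<phi>(1)\<^sup>2 \<ge> 1\<close> and the slopes of \<open>\<phi>\<close> were unbounded near 1, then \<open>\<xi>'' > 1 / \<phi>\<^sup>2\<close>
  near 1, so the first variation in a direction \<open>1 - max s t\<close> would be negative.\<close>
lemma phi_lipschitz_1: obtains B where "0 \<le> B" "\<And>x. x \<in> {0..<1} \<Longrightarrow> \<phi> x - \<phi> 1 \<le> B * (1 - x)"
proof (cases "X2 1 * (\<phi> 1)\<^sup>2 < 1")
  case True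
  \<comment> \<open>In this case \<open>\<phi>\<close> is linear near 1, and by concavity the slope
    of that final piece bounds every chord ending at 1.\<close>
  then obtain s r where s: "0 < s" "s < 1" and lin: "\<And>t. t \<in> {s..1} \<Longrightarrow> \<phi> t = \<phi> s + r * (t - s)" and r: "r \<le> 0"
    using linear_near_1 by blast
  show thesis
  proof (rule that[of "- r"])
    show "0 \<le> - r" using r by simp
    fix x :: real assume x: "x \<in> {0..<1}"
    show "\<phi> x - \<phi> 1 \<le> - r * (1 - x)"
    proof (cases "s \<le> x")
      case True
      then show ?thesis using lin[of x] lin[of 1] x s by (simp add: algebra_simps)
    next
      case False
      have "\<phi> 1 - \<phi> s = r * (1 - s)" using lin[of 1] s by simp
      then have "(\<phi> 1 - \<phi> s) / (1 - s) = r" using s by simp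
      then have "r \<le> (\<phi> s - \<phi> x) / (s - x)"
        using concave_chord_mono[OF phi_concave, of x s 1] x s False by simp
      then have "r * (s - x) \<le> \<phi> s - \<phi> x" using False by (simp add: field_simps)
      then show ?thesis using \<open>\<phi> 1 - \<phi> s = r * (1 - s)\<close> by (simp add: algebra_simps)
    qed
  qed
next
  case False
  define c where "c = \<phi> 1"
  have c: "0 < c" using phi_1_pos by (simp add: c_def)
  have ge1: "1 \<le> X2 1 * c\<^sup>2" using False by (simp add: c_def)
  then have X21: "0 < X2 1" using X_derivs(3)[of 1] by (cases "X2 1 = 0") auto
  obtain B0 where B0: "0 \<le> B0" "\<And>x. x \<in> {0..1} \<Longrightarrow> X2 1 - X2 x \<le> B0 * (1 - x)"
    using X2_lipschitz_1 by blast
  \<comment> \<open>Chosen so that the gain \<open>2 * X2 1 * c * K * (1 - t)\<close> in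
    \<open>X2 1 * \<phi>^2\<close> exceeds the loss from replacing \<open>X2 1\<close> by
    \<open>X2 t\<close>, at most \<open>B0 * (\<phi> 0)^2 * (1 - t)\<close>, by exactly
    \<open>1 - t\<close>.\<close>
  define K where "K = (B0 * (\<phi> 0)\<^sup>2 + 1) / (2 * X2 1 * c)"
  have K0: "0 \<le> K" using B0 X21 c by (simp add: K_def)
  have K: "2 * X2 1 * c * K = B0 * (\<phi> 0)\<^sup>2 + 1" using X21 c by (simp add: K_def)
  have "\<forall>x\<in>{0..<1}. \<phi> x - \<phi> 1 \<le> K * (1 - x)"
  proof (rule ccontr)
    assume "\<not> ?thesis"
    then obtain s where s: "0 \<le> s" "s < 1" "K * (1 - s) < \<phi> s - \<phi> 1" by (auto simp: not_le)
    \<comment> \<open>Concavity keeps \<open>\<phi>\<close> above its chord from \<open>s\<close> to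
      1, which lies above the line of slope \<open>- K\<close> through the end point.\<close>
    have above: "c + K * (1 - t) \<le> \<phi> t" if t: "s \<le> t" "t < 1" for t
    proof (rule ccontr)
      assume "\<not> ?thesis"
      then have lt: "\<phi> t - \<phi> 1 < K * (1 - t)" by (simp add: c_def)
      then have ts: "s < t" using s t by (cases "s = t") auto
      have "- K < (\<phi> 1 - \<phi> t) / (1 - t)" using lt t by (simp add: field_simps)
      also have "\<dots> \<le> (\<phi> t - \<phi> s) / (t - s)"
        using concave_chord_mono[OF phi_concave, of s t 1] s ts t by simp
      finally have "- K * (t - s) < \<phi> t - \<phi> s" using ts by (simp add: field_simps)
      then show False using lt s(3) by (simp add: algebra_simps)
    qed
    have pos: "0 < X2 t - v t" if t: "s \<le> t" "t < 1" for t
    proof -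
      have tt: "t \<in> {0..1}" using t s by simp
      have pt: "0 < \<phi> t" using phi_pos[OF tt] .
      have "(c + K * (1 - t))\<^sup>2 \<le> (\<phi> t)\<^sup>2" using above[OF t] c K0 t by (intro power_mono) auto
      moreover have "c\<^sup>2 + 2 * c * K * (1 - t) \<le> (c + K * (1 - t))\<^sup>2"
        by (simp add: power2_sum mult.assoc)
      ultimately have "X2 1 * (c\<^sup>2 + 2 * c * K * (1 - t)) \<le> X2 1 * (\<phi> t)\<^sup>2"
        using X21 by (intro mult_left_mono) auto
      then have "1 + (B0 * (\<phi> 0)\<^sup>2 + 1) * (1 - t) \<le> X2 1 * (\<phi> t)\<^sup>2"
        using ge1 K[symmetric] by (simp add: algebra_simps)
      moreover have "(X2 1 - X2 t) * (\<phi> t)\<^sup>2 \<le> B0 * (1 - t) * (\<phi> 0)\<^sup>2"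
        using B0(2)[OF tt] B0(1) phi_anti[of 0 t] pt t s by (intro mult_mono power_mono) auto
      ultimately have "1 + (1 - t) \<le> X2 t * (\<phi> t)\<^sup>2" by (simp add: algebra_simps)
      then have "1 < X2 t * (\<phi> t)\<^sup>2" using t by linarith
      then show ?thesis using pt by (simp add: v_def field_simps)
    qed
    \<comment> \<open>This is \<open>max s t - s\<close>, minus a hinge up to a constant, so
      \<open>L 1 = 0\<close> gives \<open>L ?\<psi> \<le> 0\<close>. It vanishes on
      \<open>{0..s}\<close>, in particular at 0, so only the region where \<open>X2 - v\<close> is
      positive contributes.\<close>
    let ?\<psi> = "\<lambda>t. (1 - s) * 1 + (- 1) * (1 - max s t)"
    have hc: "continuous_on {0..1} (\<lambda>t. 1 - max s t)" by (intro continuous_intros)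
    have "L ?\<psi> \<le> 0"
      using L_linear[OF continuous_on_const[of _ 1] hc, of "1 - s" "- 1"] L_1 L_nonneg[OF Cset_hinge, of s] s by simp
    then have le: "integral {0..1} (\<lambda>t. (X2 t - v t) * ?\<psi> t) \<le> 0" using s by (simp add: L_def)
    have cont: "continuous_on {0..1} (\<lambda>t. (X2 t - v t) * ?\<psi> t)"
      by (intro continuous_intros X2_cont v_cont)
    have lim: "0 \<le> X2 1 - v 1" using False phi_1_pos by (simp add: v_def field_simps)
    have nn: "0 \<le> (X2 t - v t) * ?\<psi> t" if "t \<in> {0..1}" for t
    proof (cases "s \<le> t")
      case True
      then show ?thesis using pos[of t] lim that by (cases "t = 1") (auto simp: less_imp_le)
    qed simp
    have "integral {0..1} (\<lambda>t. (X2 t - v t) * ?\<psi> t) = 0"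
      using le integral_nonneg[OF integrable_continuous_real[OF cont] nn] by simp
    then have "\<forall>t\<in>{0..1}. (X2 t - v t) * ?\<psi> t = 0"
      using integral_eq_0_iff[OF cont _ nn] by simp
    moreover define z where "z = (s + 1) / 2"
    moreover have z: "z \<in> {0..1}" "s < z" "z < 1" using s by (auto simp: z_def)
    ultimately have "(X2 z - v z) * ?\<psi> z = 0" by blast
    then show False using pos[of z] z by simp
  qed
  then show thesis using K0 by (intro that[of K]) auto
qed

end

section \<open>The dual candidate\<close>

lemma convex_on_deriv_0_le:
  fixes f :: "real \<Rightarrow> real"
  assumes conv: "convex_on {0..1} f" and D: "(f has_real_derivative D) (at 0 within {0..1})"
    and y: "y \<in> {0<..1}"
  shows "D * y \<le> f y - f 0"
proof -
  have "((\<lambda>t. (f t - f 0) / (t - 0)) \<longlongrightarrow> D) (at 0 within {0..1})"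
    using D by (simp add: has_field_derivative_iff)
  then have lim: "((\<lambda>t. (f t - f 0) / t) \<longlongrightarrow> D) (at_right 0)"
    by (simp add: at_within_Icc_at_right)
  have "\<forall>\<^sub>F t in at_right 0. 0 < t \<and> t < y"
    by (intro eventually_conj eventually_at_right_less order_tendstoD(2)[OF tendsto_ident_at]) (use y in simp)
  then have "\<forall>\<^sub>F t in at_right 0. (f t - f 0) / t \<le> (f y - f 0) / y"
  proof eventually_elim
    case (elim t)
    have "(f 0 - f t) / (0 - t) \<le> (f 0 - f y) / (0 - y)"
      using convex_on_slope_le(1)[OF conv, of 0 y t] y elim by simp
    moreover have "(f 0 - f t) / (0 - t) = (f t - f 0) / t" "(f 0 - f y) / (0 - y) = (f y - f 0) / y"
      using elim y by (simp_all add: field_simps)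
    ultimately show ?case by simp
  qed
  then have "D \<le> (f y - f 0) / y" by (rule tendsto_upperbound[OF lim]) simp
  then show ?thesis using y by (simp add: field_simps)
qed

context Pfun_minimizer
begin

text \<open>The slope at 0 is prescribed. At 1, touching \<open>\<xi>\<close> from above forces a
  slope of at most \<open>\<xi>'(1)\<close>.\<close>

lemma Kset_bounded_slope:
  assumes "Kset \<beta> h \<eta>"
  shows "convex_bounded_slope \<eta> (- h\<^sup>2) (X1 1)"
proof
  show "convex_on {0..1} \<eta>" "continuous_on {0..1} \<eta>" using assms by (auto simp: Kset_def)
  have "(\<eta> has_real_derivative (- h\<^sup>2)) (at 0 within {0..1})"
    using assms X1_0 by (simp add: Kset_def)
  then show "- h\<^sup>2 * y \<le> \<eta> y - \<eta> 0" if "y \<in> {0<..1}" for y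
    using convex_on_deriv_0_le[OF \<open>convex_on {0..1} \<eta>\<close> _ that] by blast
  show "\<eta> 1 - \<eta> x \<le> X1 1 * (1 - x)" if "x \<in> {0..<1}" for x
  proof -
    have "X0 x \<le> \<eta> x" "\<eta> 1 = X0 1" using assms that by (auto simp: Kset_def)
    then show ?thesis using X0_tangent_1[of x] that by auto
  qed
qed

lemma phi_bounded_slope: "\<exists>B. convex_bounded_slope (\<lambda>x. - \<phi> x) 0 B"
proof -
  obtain B where "0 \<le> B" and B: "\<And>x. x \<in> {0..<1} \<Longrightarrow> \<phi> x - \<phi> 1 \<le> B * (1 - x)"
    using phi_lipschitz_1 by blast
  have "convex_bounded_slope (\<lambda>x. - \<phi> x) 0 B"
  proof
    show "convex_on {0..1} (\<lambda>x. - \<phi> x)" using phi_concave by (simp add: concave_on_def)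
    show "continuous_on {0..1} (\<lambda>x. - \<phi> x)" by (intro continuous_intros phi_cont)
    show "0 * y \<le> - \<phi> y - - \<phi> 0" if "y \<in> {0<..1}" for y using phi_anti[of 0 y] that by simp
    show "- \<phi> 1 - - \<phi> x \<le> B * (1 - x)" if "x \<in> {0..<1}" for x using B[OF that] by simp
  qed
  then show ?thesis by blast
qed

text \<open>Right derivative of \<open>- \<phi>\<close>: thus \<open>- k\<close> represents
  \<open>\<phi>'\<close>, the Stieltjes measure of \<open>k\<close> is \<open>\<mu>\<close>, and
  \<open>- k 0\<close> is the one-sided derivative of \<open>\<phi>\<close> at 0.\<close>

abbreviation "k \<equiv> slope_fun (\<lambda>x. - \<phi> x)"

lemma primitive_phi: "primitive \<phi> (\<lambda>x. - k x)"
proof -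
  obtain B where "convex_bounded_slope (\<lambda>x. - \<phi> x) 0 B" using phi_bounded_slope by blast
  from primitive_uminus[OF convex_bounded_slope.primitive_slope_fun[OF this]] show ?thesis by simp
qed

lemma primitive_X0: "primitive X0 (\<lambda>x. indicator {0..1} x * X1 x)"
  by (rule primitive_of_C1) (auto intro!: has_field_derivative_at_within X_derivs X1_cont)

lemma primitive_X1: "primitive X1 (\<lambda>x. indicator {0..1} x * X2 x)"
  by (rule primitive_of_C1) (auto intro!: has_field_derivative_at_within X_derivs X2_cont)

section \<open>The dual candidate and its boundary values\<close>

definition e1 :: "real \<Rightarrow> real" where "e1 x = integral {0..x} v - h\<^sup>2"

definition E :: "real \<Rightarrow> real" where "E x = X0 1 - integral {0..1} e1 + integral {0..x} e1"

lemma e1_deriv: "x \<in> {0..1} \<Longrightarrow> (e1 has_real_derivative v x) (at x within {0..1})"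
  unfolding e1_def[abs_def]
  by (auto intro!: derivative_eq_intros integral_has_real_derivative v_cont)

lemma e1_cont: "continuous_on {0..1} e1"
  by (rule DERIV_continuous_on) (rule e1_deriv)

lemma E_deriv: "x \<in> {0..1} \<Longrightarrow> (E has_real_derivative e1 x) (at x within {0..1})"
  unfolding E_def[abs_def]
  by (auto intro!: derivative_eq_intros integral_has_real_derivative e1_cont)

lemma E_cont: "continuous_on {0..1} E"
  by (rule DERIV_continuous_on) (rule E_deriv)

lemma E_1: "E 1 = X0 1" and e1_0: "e1 0 = - h\<^sup>2"
  by (simp_all add: E_def e1_def)

lemma primitive_E: "primitive E (\<lambda>x. indicator {0..1} x * e1 x)"
  by (rule primitive_of_C1[OF E_deriv e1_cont])

lemma primitive_e1: "primitive e1 (\<lambda>x. indicator {0..1} x * v x)"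
  by (rule primitive_of_C1[OF e1_deriv v_cont])

lemma e1_mono:
  assumes "0 \<le> x" "x \<le> y" "y \<le> 1"
  shows "e1 x \<le> e1 y"
proof -
  have "integral {x..y} (\<lambda>t. indicator {0..1} t * v t) = e1 y - e1 x"
    by (rule primitive_integral[OF primitive_e1 assms])
  moreover have "0 \<le> integral {x..y} (\<lambda>t. indicator {0..1} t * v t)"
    by (rule integral_nonneg)
       (use assms v_pos in \<open>auto intro!: primitive_integrable[OF primitive_e1] simp: less_imp_le\<close>)
  ultimately show ?thesis by simp
qed

text \<open>Explicit antiderivatives on both sides of the kink at \<open>s\<close>. The boundary
  term \<open>h^2 * (1 - s)\<close> of \<open>L\<close> cancels against the initial slope
  \<open>- h^2\<close> of \<open>E\<close>.\<close>

lemma E_minus_X0: 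
  assumes s: "s \<in> {0..1}"
  shows "E s - X0 s = L (\<lambda>t. 1 - max s t)"
proof -
  have d1: "((\<lambda>t. e1 t - X1 t) has_real_derivative v t - X2 t) (at t within {0..1})" if "t \<in> {0..1}" for t
    using e1_deriv[OF that] X_derivs(2)[OF that] by (auto intro!: derivative_intros intro: has_field_derivative_at_within)
  have d0: "((\<lambda>t. E t - X0 t) has_real_derivative e1 t - X1 t) (at t within {0..1})" if "t \<in> {0..1}" for t
    using E_deriv[OF that] X_derivs(1)[OF that] by (auto intro!: derivative_intros intro: has_field_derivative_at_within)
  have left: "((\<lambda>t. (X2 t - v t) * (1 - max s t)) has_integral
      (- (1 - s) * (e1 s - X1 s) - (- (1 - s) * (e1 0 - X1 0)))) {0..s}"
  proof (rule fundamental_theorem_of_calculus)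
    fix t assume t: "t \<in> {0..s}"
    then have "((\<lambda>t. - (1 - s) * (e1 t - X1 t)) has_real_derivative - (1 - s) * (v t - X2 t)) (at t within {0..s})"
      using s by (intro DERIV_cmult has_field_derivative_subset[OF d1]) auto
    moreover have "- (1 - s) * (v t - X2 t) = (X2 t - v t) * (1 - max s t)"
      using t by (simp add: max_absorb1 algebra_simps)
    ultimately show "((\<lambda>t. - (1 - s) * (e1 t - X1 t)) has_vector_derivative (X2 t - v t) * (1 - max s t)) (at t within {0..s})"
      by (simp add: has_real_derivative_iff_has_vector_derivative)
  qed (use s in simp)
  define F where "F t = - ((1 - t) * (e1 t - X1 t) + (E t - X0 t))" for t
  have right: "((\<lambda>t. (X2 t - v t) * (1 - max s t)) has_integral (F 1 - F s)) {s..1}"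
  proof (rule fundamental_theorem_of_calculus)
    fix t assume t: "t \<in> {s..1}"
    then have tt: "t \<in> {0..1}" using s by simp
    have "(F has_real_derivative - ((0 - 1) * (e1 t - X1 t) + (v t - X2 t) * (1 - t) + (e1 t - X1 t))) (at t within {0..1})"
      unfolding F_def[abs_def]
      by (intro DERIV_minus DERIV_add DERIV_mult DERIV_diff DERIV_const DERIV_ident d1[OF tt] d0[OF tt])
    then have "(F has_real_derivative (X2 t - v t) * (1 - max s t)) (at t within {0..1})"
      by (rule DERIV_cong) (use t in \<open>simp add: algebra_simps max_absorb2\<close>)
    then have "(F has_real_derivative (X2 t - v t) * (1 - max s t)) (at t within {s..1})"
      by (rule has_field_derivative_subset) (use s in auto)
    then show "(F has_vector_derivative (X2 t - v t) * (1 - max s t)) (at t within {s..1})"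
      by (simp add: has_real_derivative_iff_has_vector_derivative)
  qed (use s in simp)
  have "integral {0..1} (\<lambda>t. (X2 t - v t) * (1 - max s t))
      = - (1 - s) * (e1 s - X1 s) - (- (1 - s) * (e1 0 - X1 0)) + (F 1 - F s)"
    by (rule integral_unique, rule has_integral_combine[OF _ _ left right]) (use s in auto)
  then show ?thesis
    unfolding L_def using s by (simp add: F_def E_1 e1_0 X1_0 algebra_simps)
qed

lemma E_ge: "s \<in> {0..1} \<Longrightarrow> X0 s \<le> E s"
  using E_minus_X0[of s] L_nonneg[OF Cset_hinge, of s] by auto

text \<open>The natural boundary condition at 1: \<open>L 1 = 0\<close> says that \<open>v\<close>
  has integral \<open>\<xi>'(1) + h^2\<close>.\<close>

lemma e1_1: "e1 1 = X1 1"
proof -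
  have "integral {0..1} (\<lambda>t. indicator {0..1} t * X2 t - indicator {0..1} t * v t) = (X1 1 - e1 1) - (X1 0 - e1 0)"
    using primitive_integral[OF primitive_diff[OF primitive_X1 primitive_e1], of 0 1] by simp
  moreover have "integral {0..1} (\<lambda>t. indicator {0..1} t * X2 t - indicator {0..1} t * v t) = integral {0..1} (\<lambda>x. (X2 x - v x) * 1)"
    by (rule integral_cong) simp
  ultimately show ?thesis using L_1 unfolding L_def by (simp add: X1_0 e1_0)
qed

lemma Kset_E: "Kset \<beta> h E"
  unfolding Kset_def
proof (intro conjI ballI)
  show "convex_on {0..1} E" by (rule convex_on_if_mono_deriv[OF E_deriv]) (auto intro: e1_mono)
  show "(E has_real_derivative X1 0 - h\<^sup>2) (at 0 within {0..1})"
    using E_deriv[of 0] by (simp add: e1_0 X1_0)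
qed (auto intro: E_cont E_ge simp: E_1)

text \<open>\<open>L \<phi> = 0\<close> makes \<open>2 * J\<close> the minimal value of
  \<open>P\<close>; it is also the value of \<open>D\<close> at \<open>E\<close>, so there is no
  duality gap.\<close>

definition J :: real where "J = integral {0..1} (\<lambda>x. 1 / \<phi> x)"

lemma inverse_phi_cont: "continuous_on {0..1} (\<lambda>x. 1 / \<phi> x)"
  by (intro continuous_intros phi_cont) (use phi_pos in fastforce)

lemma L_phi_expanded: "integral {0..1} (\<lambda>x. X2 x * \<phi> x) + h\<^sup>2 * \<phi> 0 = J"
proof -
  have "integral {0..1} (\<lambda>x. (X2 x - v x) * \<phi> x) = integral {0..1} (\<lambda>x. X2 x * \<phi> x - 1 / \<phi> x)"
    by (rule integral_cong) (use phi_pos in \<open>force simp: v_def field_simps power2_eq_square\<close>)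
  also have "\<dots> = integral {0..1} (\<lambda>x. X2 x * \<phi> x) - J"
    unfolding J_def
    by (intro integral_diff integrable_continuous_real continuous_intros X2_cont phi_cont inverse_phi_cont)
  finally show ?thesis using L_phi unfolding L_def by simp
qed

lemma J_by_parts: "J = X1 1 * \<phi> 1 + h\<^sup>2 * \<phi> 0 + integral {0..1} (\<lambda>t. k t * X1 t)"
proof -
  have "integral {0..1} (\<lambda>x. X2 x * \<phi> x) = integral {0..1} (\<lambda>t. indicator {0..1} t * X2 t * \<phi> t)"
    by (rule integral_cong) simp
  also have "\<dots> = X1 1 * \<phi> 1 + integral {0..1} (\<lambda>t. k t * X1 t)"
    using primitive_by_parts[OF primitive_X1 primitive_phi] by (simp add: X1_0)
  finally show ?thesis using L_phi_expanded by simp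
qed

text \<open>Stieltjes integration by parts with \<open>w 1 = 0\<close>. Both remaining terms have a
  sign because \<open>w \<ge> 0\<close> and \<open>\<phi>\<close> is non-increasing;
  \<open>w\<close> will be the gap between a dual competitor and \<open>\<xi>\<close>.\<close>

lemma slope_contact_measure:
  assumes w: "primitive w b" "w 1 = 0" "\<forall>x\<in>{0..1}. 0 \<le> w x"
  shows "integral {0..1} (\<lambda>t. b t * k t) = - (w 0 * k 0) - (LINT s:{0<..<1}|interval_measure k. w s)"
    and "0 \<le> w 0 * k 0" "0 \<le> (LINT s:{0<..<1}|interval_measure k. w s)"
proof -
  obtain B where "convex_bounded_slope (\<lambda>x. - \<phi> x) 0 B" using phi_bounded_slope by blast
  then interpret S: convex_bounded_slope "\<lambda>x. - \<phi> x" 0 B .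
  show "integral {0..1} (\<lambda>t. b t * k t) = - (w 0 * k 0) - (LINT s:{0<..<1}|interval_measure k. w s)"
    using S.integral_slope_measure(1)[OF w(1)] w(2) by simp
  show "0 \<le> w 0 * k 0" using bspec[OF w(3), of 0] S.slope_fun_bounds(1)[of 0] by simp
  show "0 \<le> (LINT s:{0<..<1}|interval_measure k. w s)"
    unfolding set_lebesgue_integral_def
    by (rule integral_nonneg_AE) (use w(3) in \<open>auto simp: indicator_def intro!: AE_I2\<close>)
qed

text \<open>Subtracting the formula for \<open>J\<close> from the Stieltjes formula leaves
  \<open>\<phi> 1 * (\<eta>'(1) - \<xi>'(1))\<close>, minus
  \<open>(\<eta> 0 - \<xi> 0) * k 0\<close>, minus the integral of \<open>\<eta> - \<xi>\<close>
  against \<open>\<mu>\<close>. The first term is at most 0 by the slope bound, and the subtracted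
  quantities are nonnegative.\<close>

lemma slope_measure_phi_le:
  assumes \<eta>: "Kset \<beta> h \<eta>"
  shows "(LINT s:{0<..<1}|interval_measure (slope_fun \<eta>). \<phi> s) \<le> J"
proof -
  interpret N: convex_bounded_slope \<eta> "- h\<^sup>2" "X1 1" by (rule Kset_bounded_slope[OF \<eta>])
  have g0: "N.a 0 = - h\<^sup>2"
    by (rule N.slope_fun_0_eq) (use \<eta> X1_0 in \<open>simp add: Kset_def\<close>)
  have "(LINT s:{0<..<1}|N.m. \<phi> s) = \<phi> 1 * N.a 1 - \<phi> 0 * N.a 0 - integral {0..1} (\<lambda>t. - k t * N.a t)"
    by (rule N.integral_slope_measure(1)[OF primitive_phi])
  also have "\<dots> = \<phi> 1 * N.a 1 + h\<^sup>2 * \<phi> 0 + integral {0..1} (\<lambda>t. k t * N.a t)"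
    by (simp add: g0)
  finally have 1: "(LINT s:{0<..<1}|N.m. \<phi> s) = \<phi> 1 * N.a 1 + h\<^sup>2 * \<phi> 0 + integral {0..1} (\<lambda>t. k t * N.a t)" .
  have pw: "primitive (\<lambda>x. \<eta> x - X0 x) (\<lambda>x. N.a x - indicator {0..1} x * X1 x)"
    by (rule primitive_diff[OF N.primitive_slope_fun primitive_X0])
  have "integral {0..1} (\<lambda>t. (N.a t - indicator {0..1} t * X1 t) * k t) \<le> 0"
  proof -
    have "\<eta> 1 - X0 1 = 0" "\<forall>x\<in>{0..1}. 0 \<le> \<eta> x - X0 x"
      using \<eta> by (auto simp: Kset_def)
    from slope_contact_measure[OF pw this] show ?thesis by linarith
  qed
  moreover have "integral {0..1} (\<lambda>t. (N.a t - indicator {0..1} t * X1 t) * k t)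
      = integral {0..1} (\<lambda>t. k t * N.a t - k t * X1 t)"
    by (rule integral_cong) (simp add: algebra_simps)
  moreover have "\<dots> = integral {0..1} (\<lambda>t. k t * N.a t) - integral {0..1} (\<lambda>t. k t * X1 t)"
  proof (rule integral_diff)
    show "(\<lambda>t. k t * N.a t) integrable_on {0..1}"
      using integrable_neg[OF primitive_integrable_mult(2)[OF primitive_phi N.primitive_slope_fun]] by simp
    show "(\<lambda>t. k t * X1 t) integrable_on {0..1}"
      using integrable_neg[OF primitive_integrable_mult(1)[OF primitive_phi primitive_X1]] by simp
  qed
  ultimately have "integral {0..1} (\<lambda>t. k t * N.a t) \<le> integral {0..1} (\<lambda>t. k t * X1 t)" by simp
  moreover have "\<phi> 1 * N.a 1 \<le> \<phi> 1 * X1 1"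
    using N.slope_fun_bounds(2)[of 1] phi_1_pos by simp
  ultimately show ?thesis using 1 J_by_parts by (simp add: mult.commute)
qed

text \<open>For \<open>E\<close> the sum of the two nonnegative terms is 0 by
  \<open>L \<phi> = 0\<close> and the end slopes of \<open>E\<close>, so each term vanishes: one
  decides the alternative at 0, the other locates the support of \<open>\<mu>\<close>.\<close>

lemma E_slackness:
  shows "(E 0 - X0 0) * k 0 = 0" "(LINT s:{0<..<1}|interval_measure k. E s - X0 s) = 0"
proof -
  have "integral {0..1} (\<lambda>t. (indicator {0..1} t * v t - indicator {0..1} t * X2 t) * \<phi> t)
      = (e1 1 - X1 1) * \<phi> 1 - (e1 0 - X1 0) * \<phi> 0 - integral {0..1} (\<lambda>t. - k t * (e1 t - X1 t))"
    by (rule primitive_by_parts[OF primitive_diff[OF primitive_e1 primitive_X1] primitive_phi])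
  moreover have "integral {0..1} (\<lambda>t. (indicator {0..1} t * v t - indicator {0..1} t * X2 t) * \<phi> t)
      = integral {0..1} (\<lambda>t. - ((X2 t - v t) * \<phi> t))"
    by (rule integral_cong) (simp add: algebra_simps)
  moreover have "\<dots> = h\<^sup>2 * \<phi> 0" using L_phi unfolding L_def by simp
  ultimately have 0: "integral {0..1} (\<lambda>t. k t * (e1 t - X1 t)) = 0" by (simp add: e1_1 e1_0 X1_0)
  have "E 1 - X0 1 = 0" "\<forall>x\<in>{0..1}. 0 \<le> E x - X0 x"
    using E_ge by (simp_all add: E_1)
  note c = slope_contact_measure[OF primitive_diff[OF primitive_E primitive_X0] this]
  have "integral {0..1} (\<lambda>t. (indicator {0..1} t * e1 t - indicator {0..1} t * X1 t) * k t) = integral {0..1} (\<lambda>t. k t * (e1 t - X1 t))"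
    by (rule integral_cong) (simp add: algebra_simps)
  then show "(E 0 - X0 0) * k 0 = 0" "(LINT s:{0<..<1}|interval_measure k. E s - X0 s) = 0"
    using 0 c by linarith+
qed

end

section \<open>Uniqueness of the maximizer\<close>

lemma mvt_within_01:
  fixes f g :: "real \<Rightarrow> real"
  assumes deriv: "\<And>x. x \<in> {0..1} \<Longrightarrow> (f has_real_derivative g x) (at x within {0..1})"
    and xy: "0 \<le> x" "x < y" "y \<le> 1"
  shows "\<exists>z. x < z \<and> z < y \<and> f y - f x = g z * (y - x)"
proof -
  have at: "(f has_real_derivative g z) (at z)" if "x < z" "z < y" for z
    using deriv[of z] that xy by (simp add: at_within_Icc_at)
  have "continuous_on {0..1} f" by (rule DERIV_continuous_on) (rule deriv)
  then have "continuous_on {x..y} f" by (rule continuous_on_subset) (use xy in auto)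
  moreover have "f differentiable (at z)" if "x < z" "z < y" for z
    using at[OF that] real_differentiable_def by blast
  ultimately obtain l z where z: "x < z" "z < y" "(f has_real_derivative l) (at z)" "f y - f x = (y - x) * l"
    using MVT[OF xy(2), of f] by blast
  then have "l = g z" using at[of z] DERIV_unique by blast
  then show ?thesis using z by (auto simp: mult.commute)
qed

text \<open>A negative second derivative near a critical point makes \<open>u\<close> strictly
  smaller next to it, by two mean value steps. Going right, or left when \<open>t = 1\<close>, keeps
  the argument valid at the ends.\<close>

lemma second_derivative_at_minimum:
  fixes u u1 u2 :: "real \<Rightarrow> real"
  assumes d1: "\<And>x. x \<in> {0..1} \<Longrightarrow> (u has_real_derivative u1 x) (at x within {0..1})"
    and d2: "\<And>x. x \<in> {0..1} \<Longrightarrow> (u1 has_real_derivative u2 x) (at x within {0..1})"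
    and cont: "continuous_on {0..1} u2"
    and min: "\<And>x. x \<in> {0..1} \<Longrightarrow> u t \<le> u x" and t: "t \<in> {0..1}" and crit: "u1 t = 0"
  shows "0 \<le> u2 t"
proof (rule ccontr)
  assume neg: "\<not> 0 \<le> u2 t"
  have "(u2 \<longlongrightarrow> u2 t) (at t within {0..1})" using cont t by (simp add: continuous_on_def)
  then have "\<forall>\<^sub>F x in at t within {0..1}. u2 x < 0" using neg by (intro order_tendstoD) auto
  then obtain e where e: "0 < e" "\<And>x. x \<in> {0..1} \<Longrightarrow> x \<noteq> t \<Longrightarrow> dist x t < e \<Longrightarrow> u2 x < 0"
    unfolding eventually_at by blast
  show False
  proof (cases "t < 1")
    case True
    define y where "y = min 1 (t + e / 2)"
    have y: "t < y" "y \<le> 1" "y - t < e" using True e(1) by (auto simp: y_def)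
    obtain z where z: "t < z" "z < y" "u y - u t = u1 z * (y - t)"
      using mvt_within_01[OF d1, of t y] y t by auto
    obtain w where w: "t < w" "w < z" "u1 z - u1 t = u2 w * (z - t)"
      using mvt_within_01[OF d2, of t z] y z t by auto
    have "u2 w < 0" using w z y t by (intro e(2)) (auto simp: dist_real_def)
    then have "u1 z < 0" using w crit by (simp add: mult_neg_pos)
    then have "u y - u t < 0" using z y by (simp add: mult_neg_pos)
    then show False using min[of y] y t by simp
  next
    case False
    then have t1: "t = 1" using t by simp
    define y where "y = max 0 (t - e / 2)"
    have y: "y < t" "0 \<le> y" "t - y < e" using t1 e(1) by (auto simp: y_def)
    obtain z where z: "y < z" "z < t" "u t - u y = u1 z * (t - y)"
      using mvt_within_01[OF d1, of y t] y t by auto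
    obtain w where w: "z < w" "w < t" "u1 t - u1 z = u2 w * (t - z)"
      using mvt_within_01[OF d2, of z t] y z t by auto
    have "u2 w < 0" using w z y t by (intro e(2)) (auto simp: dist_real_def)
    then have "u2 w * (t - z) < 0" using z by (simp add: mult_neg_pos)
    then have "0 < u1 z" using w crit by simp
    then have "0 < u t - u y" using z y by simp
    then show False using min[of y] y t by simp
  qed
qed

context Pfun_minimizer
begin

text \<open>Cut off to the open interval so that the density is Borel on the line and its measure
  charges no point outside, as \<open>radon01\<close> demands.\<close>

definition vt :: "real \<Rightarrow> real" where "vt x = indicator {0<..<1} x * v x"

lemma vt_measurable [measurable]: "vt \<in> borel_measurable borel"
  using borel_measurable_continuous_on_indicator[OF _ continuous_on_subset[OF v_cont], of "{0<..<1}"]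
  unfolding vt_def[abs_def] by (simp add: subset_eq)

lemma vt_nonneg: "0 \<le> vt x"
  using v_pos[of x] by (auto simp: vt_def indicator_def)

lemma nn_integral_vt:
  assumes t: "t \<in> {0..1}"
  shows "(\<integral>\<^sup>+x. ennreal (vt x) * indicator {0<..t} x \<partial>lborel) = ennreal (e1 t - e1 0)"
proof -
  have "(v has_integral (e1 t - e1 0)) {0..t}"
    by (rule fundamental_theorem_of_calculus)
       (use t in \<open>auto simp flip: has_real_derivative_iff_has_vector_derivative
          intro!: has_field_derivative_subset[OF e1_deriv]\<close>)
  then have "(\<integral>\<^sup>+x. ennreal (v x) * indicator {0..t} x \<partial>lborel) = ennreal (e1 t - e1 0)"
    by (intro nn_integral_has_integral_lebesgue') (use t v_pos in \<open>auto simp: less_imp_le\<close>)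
  moreover have "(\<integral>\<^sup>+x. ennreal (vt x) * indicator {0<..t} x \<partial>lborel) = (\<integral>\<^sup>+x. ennreal (v x) * indicator {0..t} x \<partial>lborel)"
  proof (rule nn_integral_cong_AE)
    show "AE x in lborel. ennreal (vt x) * indicator {0<..t} x = ennreal (v x) * indicator {0..t} x"
      using AE_lborel_singleton[of 0] AE_lborel_singleton[of 1]
      by eventually_elim (use t in \<open>auto simp: vt_def indicator_def\<close>)
  qed
  ultimately show ?thesis by simp
qed

lemma finite_vt: "finite_measure (density lborel vt)"
proof (rule finite_measureI)
  have "(\<integral>\<^sup>+x. ennreal (vt x) \<partial>lborel) = (\<integral>\<^sup>+x. ennreal (vt x) * indicator {0<..1} x \<partial>lborel)"
    by (rule nn_integral_cong) (auto simp: vt_def indicator_def)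
  then show "emeasure (density lborel vt) (space (density lborel vt)) \<noteq> \<infinity>"
    using nn_integral_vt[of 1] by (simp add: emeasure_density)
qed

lemma dist_dd_E: "dist_dd_measure E (density lborel vt)"
  unfolding dist_dd_measure_def radon01_def
proof (intro conjI allI impI)
  show "emeasure (density lborel vt) (- {0<..<1}) = 0"
    by (simp add: emeasure_density nn_integral_0_iff_AE) (simp add: vt_def indicator_def)
  show "emeasure (density lborel vt) {a..b} < \<infinity>" for a b
    using finite_measure.emeasure_finite[OF finite_vt, of "{a..b}"] by (simp add: less_top[symmetric])
  fix \<psi> assume \<psi>: "test_fun \<psi>"
  note s = test_fun_support[OF \<psi>]
  have \<psi>c: "continuous_on UNIV \<psi>"
    by (intro continuous_at_imp_continuous_on ballI DERIV_isCont[OF test_fun_differentiable[OF \<psi>]])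
  have "integral {0..1} (\<lambda>x. E x * deriv (deriv \<psi>) x)
      = integral {0..1} (\<lambda>x. indicator {0..1} x * deriv (deriv \<psi>) x * E x)"
    by (rule integral_cong) simp
  also have "\<dots> = - integral {0..1} (\<lambda>t. indicator {0..1} t * e1 t * deriv \<psi> t)"
    using primitive_by_parts[OF test_fun_primitive(2)[OF \<psi>] primitive_E] s by simp
  also have "\<dots> = - integral {0..1} (\<lambda>t. indicator {0..1} t * deriv \<psi> t * e1 t)"
    by (intro arg_cong[of _ _ uminus] integral_cong) simp
  also have "\<dots> = integral {0..1} (\<lambda>t. indicator {0..1} t * v t * \<psi> t)"
    using primitive_by_parts[OF test_fun_primitive(1)[OF \<psi>] primitive_e1] s by simp
  also have "\<dots> = integral {0..1} (\<lambda>t. v t * \<psi> t)"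
    by (rule integral_cong) simp
  also have "\<dots> = (LINT t:{0..1}|lborel. v t * \<psi> t)"
    by (rule set_borel_integral_eq_integral(2)[symmetric])
       (intro borel_integrable_atLeastAtMost' continuous_intros v_cont continuous_on_subset[OF \<psi>c], simp)
  also have "\<dots> = (\<integral>t. vt t * \<psi> t \<partial>lborel)"
    unfolding set_lebesgue_integral_def
    by (rule Bochner_Integration.integral_cong) (use s(5) in \<open>auto simp: vt_def indicator_def\<close>)
  also have "\<dots> = integral\<^sup>L (density lborel vt) \<psi>"
    by (rule integral_real_density[symmetric])
       (use vt_nonneg borel_measurable_continuous_onI[OF \<psi>c] in auto)
  finally show "integral {0..1} (\<lambda>x. E x * deriv (deriv \<psi>) x) = integral\<^sup>L (density lborel vt) \<psi>" .
qed simp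

lemma nn_integral_inverse_phi: "(\<integral>\<^sup>+x. ennreal (1 / \<phi> x) * indicator {0<..<1} x \<partial>lborel) = ennreal J"
proof -
  have "((\<lambda>x. 1 / \<phi> x) has_integral J) {0..1}"
    unfolding J_def using integrable_continuous_real[OF inverse_phi_cont] by blast
  then have "((\<lambda>x. 1 / \<phi> x) has_integral J) {0<..<1}"
    by (simp add: has_integral_Icc_iff_Ioo)
  then show ?thesis
    by (intro nn_integral_has_integral_lebesgue') (use phi_pos in \<open>auto simp: less_imp_le\<close>)
qed

lemma J_nonneg: "0 \<le> J"
  unfolding J_def
  by (rule integral_nonneg[OF integrable_continuous_real[OF inverse_phi_cont]])
     (use phi_pos in \<open>auto simp: less_imp_le\<close>)

lemma sqrt_v: "x \<in> {0..1} \<Longrightarrow> sqrt (v x) = 1 / \<phi> x"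
  using phi_pos[of x] by (simp add: v_def real_sqrt_divide)

lemma Dfun_E: "Dfun E = ennreal (2 * J)"
proof -
  obtain d where d: "ac_density (density lborel vt) d"
    and D: "Dfun E = 2 * (\<integral>\<^sup>+ x\<in>{0<..<1}. ennreal (sqrt (d x)) \<partial>lborel)"
    by (rule Dfun_eq[OF dist_dd_E ac_density_exists[OF finite_vt]]) simp_all
  have "AE x in lborel. d x = vt x"
    by (rule ac_density_unique[OF d vt_measurable vt_nonneg])
  then have "AE x in lborel. ennreal (sqrt (d x)) * indicator {0<..<1} x = ennreal (1 / \<phi> x) * indicator {0<..<1} x"
    by eventually_elim (use sqrt_v in \<open>auto simp: vt_def indicator_def\<close>)
  then have "(\<integral>\<^sup>+ x\<in>{0<..<1}. ennreal (sqrt (d x)) \<partial>lborel) = ennreal J"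
    using nn_integral_inverse_phi nn_integral_cong_AE by metis
  then show ?thesis unfolding D using J_nonneg by (simp add: ennreal_mult)
qed

text \<open>Every estimate between \<open>Dfun E\<close> and \<open>Dfun \<eta>\<close> must be an
  equality. This removes the singular part and fixes the density; the initial slope then fixes the
  derivative, and the value at 1 fixes \<open>\<eta>\<close>.\<close>

lemma maximizer_eq_E:
  assumes \<eta>: "Kset \<beta> h \<eta>" and le: "Dfun E \<le> Dfun \<eta>" and s: "s \<in> {0..1}"
  shows "\<eta> s = E s"
proof -
  interpret N: convex_bounded_slope \<eta> "- h\<^sup>2" "X1 1" by (rule Kset_bounded_slope[OF \<eta>])
  have g0: "N.a 0 = - h\<^sup>2"
    by (rule N.slope_fun_0_eq) (use \<eta> X1_0 in \<open>simp add: Kset_def\<close>)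
  obtain d where "ac_density N.m d"
    and D: "Dfun \<eta> = 2 * (\<integral>\<^sup>+ x\<in>{0<..<1}. ennreal (sqrt (d x)) \<partial>lborel)"
    by (rule Dfun_eq[OF N.dist_dd_slope_measure ac_density_exists[OF N.finite_slope_measure]]) simp_all
  then obtain N0 where dm[measurable]: "d \<in> borel_measurable borel" and d0: "\<And>x. 0 \<le> d x"
    and N0[measurable]: "N0 \<in> sets borel" and N0n: "emeasure lborel N0 = 0"
    and dec: "\<And>A. A \<in> sets borel \<Longrightarrow> emeasure N.m A =
      emeasure (density lborel (\<lambda>x. ennreal (d x))) A + emeasure N.m (A \<inter> N0)"
    unfolding ac_density_def by blast
  define f where "f x = ennreal (indicator {0<..<1} x * \<phi> x)" for x
  have [measurable]: "(\<lambda>x. indicator {0<..<1} x * \<phi> x) \<in> borel_measurable borel"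
    using borel_measurable_continuous_on_indicator[OF _ continuous_on_subset[OF phi_cont], of "{0<..<1}"]
    by (simp add: subset_eq)
  have f[measurable]: "f \<in> borel_measurable borel" unfolding f_def[abs_def] by measurable
  have total: "(\<integral>\<^sup>+x. f x \<partial>N.m) \<le> ennreal J"
  proof -
    have i: "integrable N.m (\<lambda>x. indicator {0<..<1} x * \<phi> x)"
      using N.integral_slope_measure(2)[OF primitive_phi] by (simp add: set_integrable_def)
    have "(\<integral>\<^sup>+x. f x \<partial>N.m) = ennreal (\<integral>x. indicator {0<..<1} x * \<phi> x \<partial>N.m)"
      unfolding f_def
      by (rule nn_integral_eq_integral[OF i]) (use phi_pos in \<open>auto simp: indicator_def less_imp_le\<close>)
    also have "\<dots> \<le> ennreal J"
      using slope_measure_phi_le[OF \<eta>] by (intro ennreal_leI) (simp add: set_lebesgue_integral_def)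
    finally show ?thesis .
  qed
  \<comment> \<open>As \<open>N0\<close> is Lebesgue null, the absolutely continuous part is the
    restriction of the whole measure to the complement of \<open>N0\<close>. This form splits
    integrals and not only masses.\<close>
  have dens: "density lborel (\<lambda>x. ennreal (d x)) = density N.m (indicator (- N0))"
  proof (rule measure_eqI)
    fix A assume "A \<in> sets (density lborel (\<lambda>x. ennreal (d x)))"
    then have A: "A \<in> sets borel" by simp
    have "AE x in lborel. x \<notin> N0" using N0n N0 by (intro AE_not_in) auto
    then have "AE x in density lborel (\<lambda>x. ennreal (d x)). x \<in> A \<longleftrightarrow> x \<in> A - N0"
      by (subst AE_density) (auto elim!: eventually_mono)
    then have "emeasure (density lborel (\<lambda>x. ennreal (d x))) A = emeasure (density lborel (\<lambda>x. ennreal (d x))) (A - N0)"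
      by (rule emeasure_eq_AE) (use A in auto)
    also have "\<dots> = emeasure N.m (A - N0)"
    proof -
      have "(A - N0) \<inter> N0 = {}" by blast
      then show ?thesis using dec[of "A - N0"] A N0 by (simp add: sets.Diff)
    qed
    also have "\<dots> = emeasure (density N.m (indicator (- N0))) A"
      using A N0 by (subst emeasure_restricted) (auto intro!: arg_cong[of _ _ "emeasure N.m"])
    finally show "emeasure (density lborel (\<lambda>x. ennreal (d x))) A = emeasure (density N.m (indicator (- N0))) A" .
  qed simp
  have split: "(\<integral>\<^sup>+x. f x \<partial>N.m) = (\<integral>\<^sup>+x. ennreal (d x) * f x \<partial>lborel) + (\<integral>\<^sup>+x. f x * indicator N0 x \<partial>N.m)"
  proof -
    have "(\<integral>\<^sup>+x. ennreal (d x) * f x \<partial>lborel) = (\<integral>\<^sup>+x. f x \<partial>density lborel (\<lambda>x. ennreal (d x)))"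
      by (rule nn_integral_density[symmetric]) auto
    also have "\<dots> = (\<integral>\<^sup>+x. indicator (- N0) x * f x \<partial>N.m)"
      unfolding dens by (rule nn_integral_density) auto
    finally have "(\<integral>\<^sup>+x. ennreal (d x) * f x \<partial>lborel) + (\<integral>\<^sup>+x. f x * indicator N0 x \<partial>N.m)
        = (\<integral>\<^sup>+x. indicator (- N0) x * f x + f x * indicator N0 x \<partial>N.m)"
      by (subst nn_integral_add) auto
    also have "\<dots> = (\<integral>\<^sup>+x. f x \<partial>N.m)"
      by (rule nn_integral_cong) (auto simp: indicator_def)
    finally show ?thesis by simp
  qed
  define S where "S x = ennreal (2 * sqrt (d x)) * indicator {0<..<1} x" for x
  define G where "G x = ennreal (d x) * f x + ennreal (1 / \<phi> x) * indicator {0<..<1} x" for x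
  have G_eq: "G x = ennreal (\<phi> x * d x + 1 / \<phi> x)" if "x \<in> {0<..<1}" for x
    using that phi_pos[of x] d0[of x]
    by (simp add: G_def f_def mult.commute ennreal_mult'[symmetric] ennreal_plus[symmetric] del: ennreal_plus)
  have square: "\<phi> x * d x + 1 / \<phi> x - 2 * sqrt (d x) = (\<phi> x * sqrt (d x) - 1)\<^sup>2 / \<phi> x" if "x \<in> {0<..<1}" for x
  proof -
    define r where "r = sqrt (d x)"
    have "d x = r\<^sup>2" using d0[of x] by (simp add: r_def)
    then show ?thesis
      using phi_pos[of x] that unfolding r_def[symmetric]
      by (simp add: field_simps power2_eq_square)
  qed
  have SG: "S x \<le> G x" for x
  proof (cases "x \<in> {0<..<1}")
    case True
    have "0 \<le> (\<phi> x * sqrt (d x) - 1)\<^sup>2 / \<phi> x"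
      using phi_pos[of x] True by (intro divide_nonneg_pos) auto
    then have "2 * sqrt (d x) \<le> \<phi> x * d x + 1 / \<phi> x"
      using square[OF True] by linarith
    then show ?thesis using True G_eq[OF True] by (simp add: S_def ennreal_leI)
  qed (simp add: S_def)
  have Sm[measurable]: "S \<in> borel_measurable borel" unfolding S_def[abs_def] by measurable
  have ipm[measurable]: "(\<lambda>x. ennreal (1 / \<phi> x) * indicator {0<..<1} x) \<in> borel_measurable borel"
  proof -
    have "(\<lambda>x. ennreal (1 / (indicator {0<..<1} x * \<phi> x)) * indicator {0<..<1} x) \<in> borel_measurable borel"
      by measurable
    moreover have "(\<lambda>x. ennreal (1 / (indicator {0<..<1} x * \<phi> x)) * indicator {0<..<1} x)
        = (\<lambda>x. ennreal (1 / \<phi> x) * indicator {0<..<1} x)"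
      by (auto simp: indicator_def)
    ultimately show ?thesis by simp
  qed
  have Gm[measurable]: "G \<in> borel_measurable borel" unfolding G_def[abs_def] by measurable
  have IS: "(\<integral>\<^sup>+x. S x \<partial>lborel) = Dfun \<eta>"
  proof -
    have "S x = 2 * (ennreal (sqrt (d x)) * indicator {0<..<1} x)" for x
      using d0[of x] by (simp add: S_def ennreal_mult mult.assoc)
    then show ?thesis unfolding D by (simp add: nn_integral_cmult)
  qed
  have IG: "(\<integral>\<^sup>+x. G x \<partial>lborel) = (\<integral>\<^sup>+x. ennreal (d x) * f x \<partial>lborel) + ennreal J"
    unfolding G_def by (subst nn_integral_add) (auto simp: nn_integral_inverse_phi)
  have JJ: "ennreal (2 * J) = ennreal J + ennreal J" using J_nonneg by (simp flip: ennreal_plus)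
  have fd_le: "(\<integral>\<^sup>+x. ennreal (d x) * f x \<partial>lborel) \<le> ennreal J"
    using total unfolding split by (rule order_trans[rotated]) simp
  have S_ge: "ennreal (2 * J) \<le> (\<integral>\<^sup>+x. S x \<partial>lborel)" using le unfolding IS Dfun_E .
  have S_le: "(\<integral>\<^sup>+x. S x \<partial>lborel) \<le> (\<integral>\<^sup>+x. G x \<partial>lborel)" by (rule nn_integral_mono) (rule SG)
  have G_le: "(\<integral>\<^sup>+x. G x \<partial>lborel) \<le> ennreal (2 * J)"
    unfolding IG JJ by (intro add_right_mono fd_le)
  have fd: "(\<integral>\<^sup>+x. ennreal (d x) * f x \<partial>lborel) = ennreal J"
  proof (rule antisym[OF fd_le])
    have "ennreal J + ennreal J \<le> ennreal J + (\<integral>\<^sup>+x. ennreal (d x) * f x \<partial>lborel)"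
      using order_trans[OF S_ge S_le] unfolding IG JJ by (simp only: add.commute)
    then show "ennreal J \<le> (\<integral>\<^sup>+x. ennreal (d x) * f x \<partial>lborel)"
      unfolding ennreal_add_left_cancel_le by simp
  qed
  \<comment> \<open>\<open>J\<close> is finite and cancels. What remains is the integral of
    \<open>\<phi>\<close> over the singular part; as \<open>\<phi>\<close> is positive, that part
    has no mass.\<close>
  have "ennreal J + (\<integral>\<^sup>+x. f x * indicator N0 x \<partial>N.m) \<le> ennreal J + 0"
    using total unfolding split fd by simp
  then have "(\<integral>\<^sup>+x. f x * indicator N0 x \<partial>N.m) = 0"
    unfolding ennreal_add_left_cancel_le by simp
  then have "AE x in N.m. f x * indicator N0 x = 0"
    by (subst (asm) nn_integral_0_iff_AE) auto
  then have "AE x in N.m. x \<notin> N0"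
    using N.AE_slope_measure
  proof eventually_elim
    case (elim x)
    then show ?case using phi_pos[of x] by (auto simp: f_def indicator_def split: if_splits)
  qed
  then have "emeasure N.m N0 = 0"
    by (subst (asm) AE_iff_measurable[OF _ refl]) auto
  then have N0': "N0 \<in> null_sets N.m" by auto
  have ac: "emeasure N.m A = emeasure (density lborel (\<lambda>x. ennreal (d x))) A" if A: "A \<in> sets borel" for A
  proof -
    have "A \<inter> N0 \<in> null_sets N.m" by (rule null_sets_subset[OF N0']) (use A in auto)
    then have "emeasure N.m (A \<inter> N0) = 0" by (rule null_setsD1)
    with dec[OF A] show ?thesis by (simp only: add_0_right)
  qed
  \<comment> \<open>\<open>S \<le> G\<close> pointwise with equal finite integrals, so they agree
    almost everywhere; their gap is a square divided by \<open>\<phi>\<close>, which determines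
    \<open>d\<close>.\<close>
  have "AE x in lborel. G x \<le> S x"
  proof (rule ccontr)
    assume "\<not> ?thesis"
    then have "(\<integral>\<^sup>+x. S x \<partial>lborel) < (\<integral>\<^sup>+x. G x \<partial>lborel)"
      using S_le G_le SG by (intro nn_integral_less) (auto simp: top_unique)
    then show False using S_ge G_le by (meson leD order_trans)
  qed
  then have dv: "AE x in lborel. x \<in> {0<..<1} \<longrightarrow> d x = vt x"
  proof eventually_elim
    case (elim x)
    show ?case
    proof
      assume x: "x \<in> {0<..<1}"
      then have px: "0 < \<phi> x" using phi_pos[of x] by simp
      have "\<phi> x * d x + 1 / \<phi> x \<le> 2 * sqrt (d x)"
        using elim G_eq[OF x] x d0[of x] px by (simp add: S_def ennreal_le_iff del: ennreal_plus)
      then have "(\<phi> x * sqrt (d x) - 1)\<^sup>2 / \<phi> x \<le> 0" using square[OF x] by linarith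
      then have "(\<phi> x * sqrt (d x) - 1)\<^sup>2 \<le> 0" using px by (simp add: divide_le_0_iff)
      then have "sqrt (d x) = 1 / \<phi> x" using px by (simp add: field_simps)
      then have "(sqrt (d x))\<^sup>2 = v x" by (simp add: v_def power_divide)
      then show "d x = vt x" using d0[of x] x by (simp add: vt_def)
    qed
  qed
  have slope: "N.a t = e1 t" if t: "t \<in> {0..1}" for t
  proof -
    have "ennreal (N.a t - N.a 0) = emeasure N.m {0<..t}"
      using N.emeasure_slope_Ioc[of 0 t] t by simp
    also have "\<dots> = (\<integral>\<^sup>+x. ennreal (d x) * indicator {0<..t} x \<partial>lborel)"
      using ac[of "{0<..t}"] by (simp add: emeasure_density)
    also have "\<dots> = (\<integral>\<^sup>+x. ennreal (vt x) * indicator {0<..t} x \<partial>lborel)"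
    proof (rule nn_integral_cong_AE)
      show "AE x in lborel. ennreal (d x) * indicator {0<..t} x = ennreal (vt x) * indicator {0<..t} x"
        using dv AE_lborel_singleton[of 1]
        by eventually_elim (use t in \<open>auto simp: indicator_def\<close>)
    qed
    also have "\<dots> = ennreal (e1 t - e1 0)" by (rule nn_integral_vt[OF t])
    finally have "N.a t - N.a 0 = e1 t - e1 0"
      using N.slope_fun_mono[of 0 t] e1_mono[of 0 t] t by simp
    then show ?thesis by (simp add: g0 e1_0)
  qed
  have "\<eta> 1 - \<eta> s = integral {s..1} N.a"
    using N.integral_slope_fun[of s 1] s by simp
  also have "\<dots> = integral {s..1} (\<lambda>x. indicator {0..1} x * e1 x)"
    by (rule integral_cong) (use slope s in simp)
  also have "\<dots> = E 1 - E s"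
    using primitive_integral[OF primitive_E, of s 1] s by simp
  finally show ?thesis using \<eta> by (simp add: E_1 Kset_def)
qed

text \<open>A contact point minimizes \<open>E - \<xi>\<close>. Inside, the derivative vanishes; at
  1 it does so by the natural boundary condition; at 0 the one-sided inequality meets the opposite
  sign of the prescribed slope.\<close>

lemma E_contact:
  assumes t: "t \<in> {0..1}" and contact: "X0 t = E t"
  shows "e1 t = X1 t" "X2 t \<le> v t"
proof -
  define u where "u x = E x - X0 x" for x
  have d1: "(u has_real_derivative e1 x - X1 x) (at x within {0..1})" if "x \<in> {0..1}" for x
    unfolding u_def[abs_def] using E_deriv[OF that] X_derivs(1)[OF that]
    by (auto intro!: derivative_intros intro: has_field_derivative_at_within)
  have d2: "((\<lambda>x. e1 x - X1 x) has_real_derivative v x - X2 x) (at x within {0..1})" if "x \<in> {0..1}" for x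
    using e1_deriv[OF that] X_derivs(2)[OF that]
    by (auto intro!: derivative_intros intro: has_field_derivative_at_within)
  have min: "u t \<le> u x" if "x \<in> {0..1}" for x using E_ge[OF that] contact by (simp add: u_def)
  show crit: "e1 t = X1 t"
  proof -
    consider "t = 0" | "t = 1" | "0 < t" "t < 1" using t by fastforce
    then show ?thesis
    proof cases
      case 1
      have "((\<lambda>x. (u x - u 0) / (x - 0)) \<longlongrightarrow> e1 0 - X1 0) (at 0 within {0..1})"
        using d1[of 0] by (simp add: has_field_derivative_iff)
      then have lim: "((\<lambda>x. (u x - u 0) / x) \<longlongrightarrow> e1 0 - X1 0) (at_right 0)"
        by (simp add: at_within_Icc_at_right)
      have "\<forall>\<^sub>F x in at_right 0. 0 < x \<and> x < (1::real)"
        by (intro eventually_conj eventually_at_right_less order_tendstoD(2)[OF tendsto_ident_at]) simp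
      then have "\<forall>\<^sub>F x in at_right 0. 0 \<le> (u x - u 0) / x"
        by eventually_elim (use min 1 in simp)
      then have "0 \<le> e1 0 - X1 0" by (rule tendsto_lowerbound[OF lim]) simp
      \<comment> \<open>The inequality reads \<open>0 \<le> - h^2\<close>: contact at 0 is possible
        only when \<open>h = 0\<close>.\<close>
      then have "e1 0 = X1 0" unfolding e1_0 X1_0 using zero_le_power2[of h] by linarith
      then show ?thesis using 1 by simp
    next
      case 2
      then show ?thesis using e1_1 by simp
    next
      case 3
      have "(u has_real_derivative e1 t - X1 t) (at t)" using d1[OF t] 3 by (simp add: at_within_Icc_at)
      then have "e1 t - X1 t = 0"
        by (rule DERIV_local_min[of _ _ _ "min t (1 - t)"]) (use 3 min in \<open>auto simp: abs_less_iff\<close>)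
      then show ?thesis by simp
    qed
  qed
  have "0 \<le> v t - X2 t"
    by (rule second_derivative_at_minimum[OF d1 d2 _ min t]) (auto intro!: continuous_intros v_cont X2_cont simp: crit)
  then show "X2 t \<le> v t" by simp
qed

text \<open>\<open>E - \<xi>\<close> is nonnegative with zero integral, hence zero almost everywhere
  for \<open>\<mu>\<close>. By continuity a point off the contact set has a whole ball off it, which
  is then null.\<close>

lemma slope_measure_support:
  assumes x: "x \<in> {0<..<1}" "x \<in> msupp (interval_measure k)"
  shows "X0 x = E x"
proof (rule ccontr)
  assume ne: "X0 x \<noteq> E x"
  obtain B where "convex_bounded_slope (\<lambda>x. - \<phi> x) 0 B" using phi_bounded_slope by blast
  then interpret S: convex_bounded_slope "\<lambda>x. - \<phi> x" 0 B .
  let ?F = "\<lambda>s. indicator {0<..<1} s * (E s - X0 s)"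
  have int: "integrable S.m ?F"
    using S.integral_slope_measure(2)[OF primitive_diff[OF primitive_E primitive_X0]] by (simp add: set_integrable_def)
  have nn: "0 \<le> ?F s" for s using E_ge[of s] by (auto simp: indicator_def)
  have "integral\<^sup>L S.m ?F = 0" using E_slackness(2) by (simp add: set_lebesgue_integral_def)
  then have ae: "AE s in S.m. ?F s = 0"
    using integral_nonneg_eq_0_iff_AE[OF int] nn by simp
  have "continuous_on {0<..<1} (\<lambda>s. E s - X0 s)"
    by (intro continuous_intros continuous_on_subset[OF E_cont] continuous_on_subset[OF X0_cont]) auto
  then have "open ((\<lambda>s. E s - X0 s) -` (- {0}) \<inter> {0<..<1})"
    by (rule continuous_on_open_vimage[THEN iffD1, rotated, rule_format]) auto
  moreover have "x \<in> (\<lambda>s. E s - X0 s) -` (- {0}) \<inter> {0<..<1}" using x ne by simp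
  ultimately obtain e where e: "0 < e" "ball x e \<subseteq> (\<lambda>s. E s - X0 s) -` (- {0}) \<inter> {0<..<1}"
    by (meson openE)
  have "AE s in S.m. s \<notin> ball x e"
    using ae by eventually_elim (use e(2) in \<open>auto simp: subset_eq\<close>)
  then have "emeasure S.m (ball x e) = 0"
    by (subst (asm) AE_iff_measurable[OF _ refl]) (auto simp: ball_def)
  then show False using x(2) e(1) by (auto simp: msupp_def)
qed

end

theorem theorem1p11:
  fixes \<beta> :: "nat \<Rightarrow> real" and h :: real and \<phi> \<eta> :: "real \<Rightarrow> real"
  assumes model: "is_model \<beta>"
    and h: "0 \<le> h"
    and phi_min: "Cset \<phi>" "\<forall>\<psi>. Cset \<psi> \<longrightarrow> Pfun \<beta> h \<phi> \<le> Pfun \<beta> h \<psi>"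
    and eta_max: "Kset \<beta> h \<eta>" "\<forall>\<zeta>. Kset \<beta> h \<zeta> \<longrightarrow> Dfun \<zeta> \<le> Dfun \<eta>"
  shows
    \<comment> \<open>(1a)\<close>
    "(\<exists>c>0. \<forall>x\<in>{0..1}. c \<le> \<phi> x)
     \<comment> \<open>(1b)\<close>
     \<and> (\<exists>g M. weak_deriv \<phi> g \<and> (\<forall>x\<in>{0<..<1}. \<bar>g x\<bar> \<le> M))
     \<and> (\<exists>\<eta>1 \<eta>2 \<mu>.
          \<comment> \<open>(2a): eta is C^2 on [0,1] with derivatives eta1, eta2 (one-sided at endpoints)\<close>
          (\<forall>x\<in>{0..1}. (\<eta> has_real_derivative \<eta>1 x) (at x within {0..1})) \<and>
          (\<forall>x\<in>{0..1}. (\<eta>1 has_real_derivative \<eta>2 x) (at x within {0..1})) \<and>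
          continuous_on {0..1} \<eta>2 \<and>
          \<comment> \<open>(2b)\<close>
          (\<forall>x\<in>{0..1}. 0 < \<eta>2 x) \<and>
          continuous_on {0..1} (\<lambda>x. 1 / sqrt (\<eta>2 x)) \<and>
          (\<exists>g. weak_deriv (\<lambda>x. 1 / sqrt (\<eta>2 x)) g \<and> g absolutely_integrable_on {0<..<1} \<and>
               (\<forall>x\<in>{0<..<1}. \<forall>y\<in>{0<..<1}. x \<le> y \<longrightarrow> g y \<le> g x)) \<and>
          radon01 \<mu> \<and>
          (\<forall>\<psi>. test_fun \<psi> \<longrightarrow>
             integral {0..1} (\<lambda>x. 1 / sqrt (\<eta>2 x) * deriv (deriv \<psi>) x) = - integral\<^sup>L \<mu> \<psi>) \<and>
          (\<forall>x\<in>{0<..<1}. x \<in> msupp \<mu> \<longrightarrow> xi \<beta> x = \<eta> x) \<and>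
          \<comment> \<open>(2c)\<close>
          (\<forall>t\<in>{0..1}. xi \<beta> t = \<eta> t \<longrightarrow>
             \<eta>1 t = deriv (xi \<beta>) t \<and> deriv (deriv (xi \<beta>)) t \<le> \<eta>2 t) \<and>
          \<comment> \<open>(2d)\<close>
          \<eta>1 1 = deriv (xi \<beta>) 1 \<and>
          (\<eta> 0 = xi \<beta> 0 \<or> ((\<lambda>t. (\<phi> t - \<phi> 0) / t) \<longlongrightarrow> 0) (at_right 0)) \<and>
          \<comment> \<open>(3)\<close>
          (\<forall>\<psi>. test_fun \<psi> \<longrightarrow>
             integral {0..1} (\<lambda>x. \<phi> x * deriv (deriv \<psi>) x) = - integral\<^sup>L \<mu> \<psi>) \<and>
          emeasure \<mu> {0<..<1} < \<infinity>)"
proof -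
  interpret Pfun_minimizer \<beta> h \<phi>
    by unfold_locales (use model phi_min in auto)
  obtain B where "convex_bounded_slope (\<lambda>x. - \<phi> x) 0 B" using phi_bounded_slope by blast
  then interpret S: convex_bounded_slope "\<lambda>x. - \<phi> x" 0 B .
  have eq: "\<eta> x = E x" if "x \<in> {0..1}" for x
    by (rule maximizer_eq_E[OF eta_max(1) _ that]) (use eta_max(2) Kset_E in blast)
  \<comment> \<open>With \<open>\<eta>'' = 1 / \<phi>^2\<close>, the function
    \<open>1 / sqrt \<eta>''\<close> is \<open>\<phi>\<close> itself, so both have the
    distributional derivatives \<open>- k\<close> and \<open>- \<mu>\<close>.\<close>
  have inv_sqrt: "1 / sqrt (v x) = \<phi> x" if "x \<in> {0..1}" for x
    using sqrt_v[OF that] by simp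
  have anti: "- k y \<le> - k x" if "x \<le> y" for x y
    using S.slope_fun_mono[OF that] by simp
  have wd: "weak_deriv \<phi> (\<lambda>x. - k x)" by (rule weak_deriv_primitive[OF primitive_phi])
  have integral_inv_sqrt: "integral {0..1} (\<lambda>x. 1 / sqrt (v x) * f x) = integral {0..1} (\<lambda>x. \<phi> x * f x)" for f
    by (rule integral_cong) (simp add: inv_sqrt)
  have wd': "weak_deriv (\<lambda>x. 1 / sqrt (v x)) (\<lambda>x. - k x)"
    using wd unfolding weak_deriv_def integral_inv_sqrt .
  have k_int: "(\<lambda>x. - k x) absolutely_integrable_on {0<..<1}"
  proof -
    have "set_integrable lborel {0..1} (\<lambda>x. - k x)"
      by (rule primitive_set_integrable[OF primitive_phi]) simp
    then have "set_integrable lborel {0<..<1} (\<lambda>x. - k x)"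
      by (rule set_integrable_subset) auto
    then show ?thesis
      unfolding set_integrable_def
      using integrable_completion[OF borel_measurable_integrable] by blast
  qed
  have dd: "integral {0..1} (\<lambda>x. \<phi> x * deriv (deriv \<psi>) x) = - integral\<^sup>L S.m \<psi>" if "test_fun \<psi>" for \<psi>
  proof -
    have "- integral {0..1} (\<lambda>x. \<phi> x * deriv (deriv \<psi>) x) = integral\<^sup>L S.m \<psi>"
      using S.dist_dd_slope_measure that unfolding dist_dd_measure_def by simp
    then show ?thesis by linarith
  qed
  have 1: "\<exists>c>0. \<forall>x\<in>{0..1}. c \<le> \<phi> x" using phi_1_pos phi_ge by blast
  have 2: "\<exists>g M. weak_deriv \<phi> g \<and> (\<forall>x\<in>{0<..<1}. \<bar>g x\<bar> \<le> M)"
    using wd S.slope_fun_abs_le by (metis abs_minus_cancel)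
  show ?thesis
  proof (rule conjI[OF 1 conjI[OF 2]], rule exI[of _ e1], rule exI[of _ v], rule exI[of _ S.m],
      intro conjI)
    show "\<forall>x\<in>{0..1}. (\<eta> has_real_derivative e1 x) (at x within {0..1})"
      using has_field_derivative_transform_within[OF E_deriv zero_less_one] eq by metis
    show "\<forall>x\<in>{0..1}. (e1 has_real_derivative v x) (at x within {0..1})" using e1_deriv by blast
    show "continuous_on {0..1} v" by (rule v_cont)
    show "\<forall>x\<in>{0..1}. 0 < v x" using v_pos by blast
    show "continuous_on {0..1} (\<lambda>x. 1 / sqrt (v x))"
      using phi_cont by (rule continuous_on_cong[THEN iffD1, OF refl, rotated]) (simp add: inv_sqrt)
    show "\<exists>g. weak_deriv (\<lambda>x. 1 / sqrt (v x)) g \<and> g absolutely_integrable_on {0<..<1} \<and>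
        (\<forall>x\<in>{0<..<1}. \<forall>y\<in>{0<..<1}. x \<le> y \<longrightarrow> g y \<le> g x)"
      using wd' k_int anti by blast
    show "radon01 S.m" by (rule S.radon01_slope_measure)
    show "\<forall>\<psi>. test_fun \<psi> \<longrightarrow> integral {0..1} (\<lambda>x. 1 / sqrt (v x) * deriv (deriv \<psi>) x) = - integral\<^sup>L S.m \<psi>"
      unfolding integral_inv_sqrt using dd by blast
    show "\<forall>x\<in>{0<..<1}. x \<in> msupp S.m \<longrightarrow> X0 x = \<eta> x"
      using slope_measure_support eq by simp
    show "\<forall>t\<in>{0..1}. X0 t = \<eta> t \<longrightarrow> e1 t = X1 t \<and> X2 t \<le> v t"
      using E_contact eq by simp
    show "e1 1 = X1 1" by (rule e1_1)
    show "\<eta> 0 = X0 0 \<or> ((\<lambda>t. (\<phi> t - \<phi> 0) / t) \<longlongrightarrow> 0) (at_right 0)"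
    \<comment> \<open>\<open>k 0\<close> is minus the slope of \<open>\<phi>\<close> at 0; if it is
      nonzero, slackness forces contact at 0.\<close>
    proof (cases "k 0 = 0")
      case True
      have "((\<lambda>t. - ((- \<phi> t - - \<phi> 0) / t)) \<longlongrightarrow> - k 0) (at_right 0)"
        by (rule tendsto_minus[OF S.right_slope_limit])
      moreover have "(\<lambda>t. - ((- \<phi> t - - \<phi> 0) / t)) = (\<lambda>t. (\<phi> t - \<phi> 0) / t)"
        by (simp add: minus_divide_left)
      ultimately show ?thesis using True by simp
    next
      case False
      then show ?thesis using E_slackness(1) eq[of 0] by simp
    qed
    show "\<forall>\<psi>. test_fun \<psi> \<longrightarrow> integral {0..1} (\<lambda>x. \<phi> x * deriv (deriv \<psi>) x) = - integral\<^sup>L S.m \<psi>"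
      using dd by blast
    show "emeasure S.m {0<..<1} < \<infinity>"
      using finite_measure.emeasure_finite[OF S.finite_slope_measure, of "{0<..<1}"]
      by (simp add: less_top[symmetric])
  qed
qed

end
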